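(* Let $P\subset\mathbb C$ be a discrete subset, $\Sigma=\mathbb C\setminus P$, and let $F:\Sigma\to\mathbb R^n$ be a branched minimal immersion that is locally complete with finite total curvature around $P$. Then $F$ is stable if and only if $F$ is holomorphic up to a rigid motion. (No completeness or curvature assumption is made at the end corresponding to $\infty$.)
   Context: A branched minimal immersion of a Riemann surface into $\mathbb R^n$ is a nonconstant smooth map that is harmonic and conformal in local holomorphic coordinates. For a compact surface $\Omega$ with smooth boundary, $F$ is stable if $\frac{d^2}{dt^2}\big|_{t=0}A(F+tW)\geq 0$ for every smooth $W:\Omega\to\mathbb R^n$ vanishing on $\partial\Omega$, where $A$ is the area of the induced (possibly degenerate) metric; for an open surface, $F$ is stable if its restriction to every compact subsurface with smooth boundary is stable. $F$ is locally complete with finite total curvature around $P$ if each $p\in P$ has a punctured neighborhood $U$ such that every curve in $U$ tending to $p$ has infinite length in the induced metric $F^*\delta$ and $\int_U |K|\,dA<\infty$ ($K$ the Gaussian curvature of the induced metric). $F$ is holomorphic up to a rigid motion if its image lies in an even-dimensional affine subspace $b+W\subset\mathbb R^n$ and there is a linear $J:W\to W$ with $J^2=-I$ preserving the Euclidean inner product such that $dF\circ j=J\circ dF$, $j$ the complex structure of the source. *)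

theory Defs
  imports "HOL-Analysis.Analysis"
begin

definition px :: "(complex \<Rightarrow> 'a::real_normed_vector) \<Rightarrow> complex \<Rightarrow> 'a" where
  "px f z = frechet_derivative f (at z) 1"

definition py :: "(complex \<Rightarrow> 'a::real_normed_vector) \<Rightarrow> complex \<Rightarrow> 'a" where
  "py f z = frechet_derivative f (at z) \<i>"

fun Ck :: "nat \<Rightarrow> complex set \<Rightarrow> (complex \<Rightarrow> 'a::real_normed_vector) \<Rightarrow> bool" where
  "Ck 0 S f = continuous_on S f"
| "Ck (Suc k) S f = ((\<forall>z\<in>S. f differentiable (at z)) \<and> Ck k S (px f) \<and> Ck k S (py f))"

definition Cinf :: "complex set \<Rightarrow> (complex \<Rightarrow> 'a::real_normed_vector) \<Rightarrow> bool" where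
  "Cinf S f = (\<forall>k. Ck k S f)"

text \<open>Branched minimal immersion of the (connected) open set S (with the complex structure
  inherited from C, global coordinate z): smooth, nonconstant, harmonic and conformal.\<close>

definition branched_minimal_immersion :: "complex set \<Rightarrow> (complex \<Rightarrow> real^'n) \<Rightarrow> bool" where
  "branched_minimal_immersion S F \<longleftrightarrow>
     open S \<and> Cinf S F \<and> (\<exists>z\<in>S. \<exists>w\<in>S. F z \<noteq> F w) \<and>
     (\<forall>z\<in>S. px (px F) z + py (py F) z = 0) \<and>
     (\<forall>z\<in>S. px F z \<bullet> px F z = py F z \<bullet> py F z \<and> px F z \<bullet> py F z = 0)"

definition metE :: "(complex \<Rightarrow> real^'n) \<Rightarrow> complex \<Rightarrow> real" where
  "metE F z = px F z \<bullet> px F z"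

definition metF :: "(complex \<Rightarrow> real^'n) \<Rightarrow> complex \<Rightarrow> real" where
  "metF F z = px F z \<bullet> py F z"

definition metG :: "(complex \<Rightarrow> real^'n) \<Rightarrow> complex \<Rightarrow> real" where
  "metG F z = py F z \<bullet> py F z"

definition area_density :: "(complex \<Rightarrow> real^'n) \<Rightarrow> complex \<Rightarrow> real" where
  "area_density F z = sqrt (metE F z * metG F z - (metF F z)\<^sup>2)"

definition area_on :: "complex set \<Rightarrow> (complex \<Rightarrow> real^'n) \<Rightarrow> real" where
  "area_on \<Omega> F = integral \<Omega> (area_density F)"

text \<open>Gaussian curvature of the induced metric via the Brioschi formula (u = x, v = y).\<close>

definition det3 :: "real \<Rightarrow> real \<Rightarrow> real \<Rightarrow> real \<Rightarrow> real \<Rightarrow> real \<Rightarrow> real \<Rightarrow> real \<Rightarrow> real \<Rightarrow> real" where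
  "det3 a b c d e f g h i = a * (e * i - f * h) - b * (d * i - f * g) + c * (d * h - e * g)"

definition gauss_curvature :: "(complex \<Rightarrow> real^'n) \<Rightarrow> complex \<Rightarrow> real" where
  "gauss_curvature F z =
    (let E = metE F; Fm = metF F; G = metG F in
     (det3 (- py (py E) z / 2 + px (py Fm) z - px (px G) z / 2) (px E z / 2) (px Fm z - py E z / 2)
           (py Fm z - px G z / 2) (E z) (Fm z)
           (py G z / 2) (Fm z) (G z)
      - det3 0 (py E z / 2) (px G z / 2)
             (py E z / 2) (E z) (Fm z)
             (px G z / 2) (Fm z) (G z))
     / (E z * G z - (Fm z)\<^sup>2)\<^sup>2)"

text \<open>Local completeness with finite total curvature around P.  Curves tending to p are
  C^1 curves gamma : [0,1) \<rightarrow> U with gamma(s) \<rightarrow> p as s \<rightarrow> 1; their length in the induced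
  metric is the integral of |dF(gamma'(s))| over [0,1) (infinite iff not integrable, the
  integrand being nonnegative and continuous).\<close>

definition locally_complete_ftc :: "complex set \<Rightarrow> (complex \<Rightarrow> real^'n) \<Rightarrow> complex set \<Rightarrow> bool" where
  "locally_complete_ftc S F P \<longleftrightarrow>
    (\<forall>p\<in>P. \<exists>U. open U \<and> p \<notin> U \<and> U \<subseteq> S \<and> (\<exists>r>0. ball p r - {p} \<subseteq> U) \<and>
       (\<forall>\<gamma> \<gamma>'. (\<forall>s\<in>{0..<1}. \<gamma> s \<in> U \<and> (\<gamma> has_vector_derivative \<gamma>' s) (at s within {0..<1})) \<and>
                continuous_on {0..<1} \<gamma>' \<and> (\<gamma> \<longlongrightarrow> p) (at_left 1) \<longrightarrow>
                \<not> ((\<lambda>s. norm (frechet_derivative F (at (\<gamma> s)) (\<gamma>' s))) integrable_on {0..<1})) \<and>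
       (\<lambda>z. \<bar>gauss_curvature F z\<bar> * area_density F z) integrable_on U)"

definition compact_smooth_domain :: "complex set \<Rightarrow> complex set \<Rightarrow> bool" where
  "compact_smooth_domain S \<Omega> \<longleftrightarrow> compact \<Omega> \<and> \<Omega> \<subseteq> S \<and>
     (\<forall>p\<in>frontier \<Omega>. \<exists>V (\<phi>::complex \<Rightarrow> real). open V \<and> p \<in> V \<and> Cinf V \<phi> \<and>
        (\<exists>v. frechet_derivative \<phi> (at p) v \<noteq> 0) \<and> \<Omega> \<inter> V = {z\<in>V. \<phi> z \<le> 0})"

definition has_second_deriv_at :: "(real \<Rightarrow> real) \<Rightarrow> real \<Rightarrow> real \<Rightarrow> bool" where
  "has_second_deriv_at a a2 t0 \<longleftrightarrow>
     (\<exists>a1 e. e > 0 \<and> (\<forall>t. \<bar>t - t0\<bar> < e \<longrightarrow> (a has_real_derivative a1 t) (at t)) \<and>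
             (a1 has_real_derivative a2) (at t0))"

definition stable_on :: "complex set \<Rightarrow> (complex \<Rightarrow> real^'n) \<Rightarrow> bool" where
  "stable_on S F \<longleftrightarrow>
    (\<forall>\<Omega> (W::complex \<Rightarrow> real^'n). compact_smooth_domain S \<Omega> \<and> Cinf S W \<and> (\<forall>z\<in>frontier \<Omega>. W z = 0) \<longrightarrow>
       (\<exists>a2. has_second_deriv_at (\<lambda>t. area_on \<Omega> (\<lambda>z. F z + t *\<^sub>R W z)) a2 0 \<and> a2 \<ge> 0))"

definition holomorphic_up_to_rigid_motion :: "complex set \<Rightarrow> (complex \<Rightarrow> real^'n) \<Rightarrow> bool" where
  "holomorphic_up_to_rigid_motion S F \<longleftrightarrow>
    (\<exists>b W (J::real^'n \<Rightarrow> real^'n). subspace W \<and> even (dim W) \<and> (\<forall>z\<in>S. F z - b \<in> W) \<and>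
       linear J \<and> (\<forall>w\<in>W. J w \<in> W \<and> J (J w) = - w) \<and> (\<forall>u\<in>W. \<forall>w\<in>W. J u \<bullet> J w = u \<bullet> w) \<and>
       (\<forall>z\<in>S. \<forall>v. frechet_derivative F (at z) (\<i> * v) = J (frechet_derivative F (at z) v)))"

end

theory Submission
  imports Defs "HOL-Complex_Analysis.Complex_Analysis"
begin

text \<open>Let \<open>\<Phi> = F_x - i F_y\<close>, a holomorphic isotropic \<open>\<complex>\<^sup>n\<close>-valued function. Comparing area
  with energy for a conformal structure perturbed by \<open>m\<close> bounds the second variation in the
  direction \<open>W\<close> by a quadratic expression in \<open>W\<close> and \<open>m\<close> that is regular at the branch points.
  If \<open>u\<close> is \<open>\<complex>\<^sup>n\<close>-valued with \<open>u_x + i u_y = m \<Phi>\<close>, where \<open>m\<close> has compact support off \<open>P\<close>, and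
  \<open>u = O(1 / \<bar>z\<bar>)\<close>, then for \<open>W = \<eta> Re u\<close> this bound tends to a multiple of the real part of the
  integral of \<open>u \<cdot> (\<partial>\<^sub>x - i \<partial>\<^sub>y)(m \<Phi>)\<close> when the Dirichlet energy of the cutoff \<open>\<eta>\<close>, weighted by
  \<open>\<bar>u\<bar>\<^sup>2\<close>, tends to zero; such cutoffs exist because points have capacity zero and \<open>u\<close> decays.
  Stability makes this real part nonnegative for all complex multiples of \<open>u\<close>, hence the integral
  vanishes. Polarizing, with \<open>m\<close> a radial bump at \<open>p\<close> and another one at \<open>q\<close>, gives
  \<open>\<Phi>(p) \<cdot> \<Phi>(q) / (p - q)\<^sup>2 = 0\<close>. So the values of \<open>\<Phi>\<close> span an isotropic subspace, and
  \<open>F_x \<mapsto> F_y\<close> extends to an orthogonal complex structure.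

  Conversely the Kaehler form of \<open>J\<close> calibrates \<open>F\<close>, so \<open>F\<close> minimizes area among the \<open>F + t W\<close>.
  The area is twice differentiable at \<open>t = 0\<close> in spite of the branch points: for small \<open>t\<close> the
  area density vanishes only on a null set, and its \<open>t\<close>-derivative differs from its value at
  \<open>t = 0\<close> by at most a constant times \<open>\<bar>t\<bar>\<close>.\<close>

section \<open>Calculus of smooth functions\<close>

text \<open>Differentiating the area density twice divides by the density, which vanishes at the
  branch points; both directions are shaped by avoiding this division. In the first one the energy
  of the structure t m bounds the area up to the factor 1 / sqrt (1 - t^2 |m|^2); replacing this
  factor by a polynomial gives a bound for the second difference of the area that is polynomial in
  the derivatives of F and W. The field u is built from \<Phi> inside two small discs and is a
  combination of \<Phi>(p) / (z - p) and \<Phi>(q) / (z - q) elsewhere, so near P and near infinity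
  its size is controlled by these two vectors. In the converse the Kaehler form on F + t W is a
  function h0 + t h1 + t^2 h2 whose absolute value is at most the area density. Here h0 = |F_x|^2
  has only zeros of finite order, because \<Phi> is holomorphic and not identically 0; some iterated
  x-derivative stays nonzero for small t, which is why the zeros of the density form a null
  set.\<close>

lemma px_eq: "(f has_derivative f') (at z) \<Longrightarrow> px f z = f' 1"
  unfolding px_def by (metis frechet_derivative_at)

lemma py_eq: "(f has_derivative f') (at z) \<Longrightarrow> py f z = f' \<i>"
  unfolding py_def by (metis frechet_derivative_at)

lemma
  assumes "open S" "z \<in> S" "\<And>w. w \<in> S \<Longrightarrow> f w = g w"
  shows px_cong: "px f z = px g z" and py_cong: "py f z = py g z"
proof -
  have "(f has_derivative D) (at z) \<longleftrightarrow> (g has_derivative D) (at z)" for D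
    by (intro iffI; erule has_derivative_transform_within_open[OF _ assms(1,2)]; simp add: assms(3))
  then show "px f z = px g z" "py f z = py g z"
    unfolding px_def py_def frechet_derivative_def by simp_all
qed

lemma px_const [simp]: "px (\<lambda>z. c) z = 0" and py_const [simp]: "py (\<lambda>z. c) z = 0"
  by (simp_all add: px_def py_def)

lemma frechet_has_derivative:
  "f differentiable (at z) \<Longrightarrow> (f has_derivative frechet_derivative f (at z)) (at z)"
  by (simp add: frechet_derivative_works)

lemma has_derivative_px_py:
  fixes f :: "complex \<Rightarrow> 'a::real_normed_vector"
  assumes "f differentiable (at z)"
  shows "(f has_derivative (\<lambda>v. Re v *\<^sub>R px f z + Im v *\<^sub>R py f z)) (at z)"
proof -
  note d = frechet_has_derivative[OF assms]
  interpret bounded_linear "frechet_derivative f (at z)"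
    using d by (rule has_derivative_bounded_linear)
  have "frechet_derivative f (at z) v = Re v *\<^sub>R px f z + Im v *\<^sub>R py f z" for v
  proof -
    have "v = Re v *\<^sub>R 1 + Im v *\<^sub>R \<i>" by (simp add: complex_eq_iff)
    then have "frechet_derivative f (at z) v = frechet_derivative f (at z) (Re v *\<^sub>R 1 + Im v *\<^sub>R \<i>)" by simp
    then show ?thesis unfolding px_def py_def add scaleR .
  qed
  then have "frechet_derivative f (at z) = (\<lambda>v. Re v *\<^sub>R px f z + Im v *\<^sub>R py f z)" ..
  with d show ?thesis by simp
qed

lemma px_py_linear:
  assumes "bounded_linear L" "f differentiable (at z)"
  shows "px (\<lambda>z. L (f z)) z = L (px f z)" "py (\<lambda>z. L (f z)) z = L (py f z)"
proof -
  have d: "((\<lambda>z. L (f z)) has_derivative (\<lambda>v. L (Re v *\<^sub>R px f z + Im v *\<^sub>R py f z))) (at z)"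
    by (intro bounded_linear.has_derivative[OF assms(1)] has_derivative_px_py assms)
  show "px (\<lambda>z. L (f z)) z = L (px f z)" "py (\<lambda>z. L (f z)) z = L (py f z)"
    using px_eq[OF d] py_eq[OF d] by simp_all
qed

lemmas px_py_Re = px_py_linear[OF bounded_linear_Re]
lemmas px_py_Im = px_py_linear[OF bounded_linear_Im]
lemmas px_py_nth = px_py_linear[OF bounded_linear_vec_nth]

lemma px_py_add:
  assumes "f differentiable (at z)" "g differentiable (at z)"
  shows "px (\<lambda>z. f z + g z) z = px f z + px g z" "py (\<lambda>z. f z + g z) z = py f z + py g z"
proof -
  have d: "((\<lambda>z. f z + g z) has_derivative (\<lambda>v. (Re v *\<^sub>R px f z + Im v *\<^sub>R py f z) + (Re v *\<^sub>R px g z + Im v *\<^sub>R py g z))) (at z)"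
    by (intro has_derivative_add has_derivative_px_py assms)
  show "px (\<lambda>z. f z + g z) z = px f z + px g z" "py (\<lambda>z. f z + g z) z = py f z + py g z"
    using px_eq[OF d] py_eq[OF d] by simp_all
qed

lemma px_py_diff:
  assumes "f differentiable (at z)" "g differentiable (at z)"
  shows "px (\<lambda>z. f z - g z) z = px f z - px g z" "py (\<lambda>z. f z - g z) z = py f z - py g z"
proof -
  have d: "((\<lambda>z. f z - g z) has_derivative (\<lambda>v. (Re v *\<^sub>R px f z + Im v *\<^sub>R py f z) - (Re v *\<^sub>R px g z + Im v *\<^sub>R py g z))) (at z)"
    by (intro has_derivative_diff has_derivative_px_py assms)
  show "px (\<lambda>z. f z - g z) z = px f z - px g z" "py (\<lambda>z. f z - g z) z = py f z - py g z"
    using px_eq[OF d] py_eq[OF d] by simp_all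
qed

lemma px_py_bilinear:
  assumes "bounded_bilinear B" "f differentiable (at z)" "g differentiable (at z)"
  shows "px (\<lambda>z. B (f z) (g z)) z = B (px f z) (g z) + B (f z) (px g z)"
    "py (\<lambda>z. B (f z) (g z)) z = B (py f z) (g z) + B (f z) (py g z)"
proof -
  interpret bounded_bilinear B by fact
  have d: "((\<lambda>z. B (f z) (g z)) has_derivative (\<lambda>v. B (f z) (Re v *\<^sub>R px g z + Im v *\<^sub>R py g z)
      + B (Re v *\<^sub>R px f z + Im v *\<^sub>R py f z) (g z))) (at z)"
    by (intro FDERIV has_derivative_px_py assms)
  show "px (\<lambda>z. B (f z) (g z)) z = B (px f z) (g z) + B (f z) (px g z)"
    "py (\<lambda>z. B (f z) (g z)) z = B (py f z) (g z) + B (f z) (py g z)"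
    using px_eq[OF d] py_eq[OF d] by simp_all
qed

lemmas px_py_mult = px_py_bilinear[OF bounded_bilinear_mult]
lemmas px_py_inner = px_py_bilinear[OF bounded_bilinear_inner]
lemmas px_py_cmult = px_py_linear[OF bounded_linear_mult_right]

text \<open>The formulas for \<open>px\<close> and \<open>py\<close> of sums, products and
  compositions hold only on the open set S, while \<open>px f\<close> is a total function; the
  induction steps below pass through this congruence.\<close>

lemma Ck_cong:
  assumes "open S" "\<And>w. w \<in> S \<Longrightarrow> f w = g w" "Ck k S f"
  shows "Ck k S g"
  using assms(2,3)
proof (induction k arbitrary: f g)
  case 0
  then show ?case using continuous_on_cong[of S S f g] by simp
next
  case (Suc k)
  have "g differentiable (at z)" if "z \<in> S" for z
    using has_derivative_transform_within_open[OF frechet_has_derivative assms(1) that, of f g] Suc.prems that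
    by (auto intro: differentiableI)
  moreover have "Ck k S (px g)"
    by (rule Suc.IH[of "px f"], rule px_cong[OF assms(1)]) (use Suc.prems in auto)
  moreover have "Ck k S (py g)"
    by (rule Suc.IH[of "py f"], rule py_cong[OF assms(1)]) (use Suc.prems in auto)
  ultimately show ?case by simp
qed

lemma Ck_Suc_imp: "Ck (Suc k) S f \<Longrightarrow> Ck k S f"
proof (induction k arbitrary: f)
  case 0
  then show ?case
    by (auto intro!: continuous_at_imp_continuous_on differentiable_imp_continuous_within)
next
  case (Suc k)
  from Suc.prems have "\<forall>z\<in>S. f differentiable (at z)" "Ck (Suc k) S (px f)" "Ck (Suc k) S (py f)"
    unfolding Ck.simps(2)[of "Suc k"] by blast+
  then show ?case using Suc.IH[of "px f"] Suc.IH[of "py f"] unfolding Ck.simps(2)[of k] by blast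
qed

lemma Ck_subset: "Ck k S f \<Longrightarrow> T \<subseteq> S \<Longrightarrow> Ck k T f"
  by (induction k arbitrary: f) (auto intro: continuous_on_subset)

lemma Ck_Un: "open S \<Longrightarrow> open T \<Longrightarrow> Ck k S f \<Longrightarrow> Ck k T f \<Longrightarrow> Ck k (S \<union> T) f"
  by (induction k arbitrary: f) (auto intro: continuous_on_open_Un)

lemma Ck_const: "Ck k S (\<lambda>z. c)"
proof (induction k arbitrary: c)
  case (Suc k)
  have "px (\<lambda>z. c) = (\<lambda>z. 0)" "py (\<lambda>z. c) = (\<lambda>z. 0)"
    by (auto simp: px_def py_def)
  then show ?case using Suc by simp
qed simp

lemma Ck_add:
  assumes "open S" "Ck k S f" "Ck k S g"
  shows "Ck k S (\<lambda>z. f z + g z)"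
  using assms(2,3)
proof (induction k arbitrary: f g)
  case 0
  then show ?case by (auto intro: continuous_intros)
next
  case (Suc k)
  have d: "((\<lambda>z. f z + g z) has_derivative (\<lambda>v. (Re v *\<^sub>R px f z + Im v *\<^sub>R py f z) + (Re v *\<^sub>R px g z + Im v *\<^sub>R py g z))) (at z)" if "z \<in> S" for z
    using has_derivative_add[OF has_derivative_px_py[of f z] has_derivative_px_py[of g z]] Suc.prems that by simp
  have "Ck k S (px (\<lambda>z. f z + g z))"
    by (rule Ck_cong[OF assms(1), of "\<lambda>z. px f z + px g z"]) (use px_eq[OF d] Suc in auto)
  moreover have "Ck k S (py (\<lambda>z. f z + g z))"
    by (rule Ck_cong[OF assms(1), of "\<lambda>z. py f z + py g z"]) (use py_eq[OF d] Suc in auto)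
  ultimately show ?case using d unfolding Ck.simps differentiable_def by blast
qed

lemma Ck_bilinear:
  assumes "open S" "bounded_bilinear B" "Ck k S f" "Ck k S g"
  shows "Ck k S (\<lambda>z. B (f z) (g z))"
  using assms(3,4)
proof (induction k arbitrary: f g)
  case 0
  then show ?case using bounded_bilinear.continuous_on[OF assms(2)] by auto
next
  case (Suc k)
  interpret B: bounded_bilinear B by fact
  have d: "((\<lambda>z. B (f z) (g z)) has_derivative (\<lambda>v. B (f z) (Re v *\<^sub>R px g z + Im v *\<^sub>R py g z) + B (Re v *\<^sub>R px f z + Im v *\<^sub>R py f z) (g z))) (at z)" if "z \<in> S" for z
    using B.FDERIV[OF has_derivative_px_py[of f z] has_derivative_px_py[of g z]] Suc.prems that by simp
  have k: "Ck k S f" "Ck k S g" using Ck_Suc_imp Suc.prems by auto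
  have "Ck k S (px (\<lambda>z. B (f z) (g z)))"
    by (rule Ck_cong[OF assms(1), of "\<lambda>z. B (f z) (px g z) + B (px f z) (g z)"], use px_eq[OF d] in simp,
        rule Ck_add[OF assms(1)]) (use Suc k in auto)
  moreover have "Ck k S (py (\<lambda>z. B (f z) (g z)))"
    by (rule Ck_cong[OF assms(1), of "\<lambda>z. B (f z) (py g z) + B (py f z) (g z)"], use py_eq[OF d] in simp,
        rule Ck_add[OF assms(1)]) (use Suc k in auto)
  ultimately show ?case using d unfolding Ck.simps differentiable_def by blast
qed

lemma Ck_linear:
  assumes "open S" "bounded_linear L" "Ck k S f"
  shows "Ck k S (\<lambda>z. L (f z))"
  using Ck_bilinear[OF assms(1) bounded_bilinear.comp[OF bounded_bilinear_scaleR bounded_linear_ident assms(2)]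
      Ck_const[of k S "1::real"] assms(3)] by simp

text \<open>H is a function together with all its derivatives. Carrying the whole sequence lets the
  induction on k move from \<open>H j\<close> to \<open>H (Suc j)\<close>.\<close>

lemma Ck_compose_real:
  fixes H :: "nat \<Rightarrow> real \<Rightarrow> real" and f :: "complex \<Rightarrow> real"
  assumes "open S" "\<And>j x. (H j has_real_derivative H (Suc j) x) (at x)" "Ck k S f"
  shows "Ck k S (\<lambda>z. H j (f z))"
  using assms(3)
proof (induction k arbitrary: f j)
  case 0
  have "continuous_on UNIV (H j)"
    by (rule DERIV_continuous_on) (rule assms(2)[THEN has_field_derivative_at_within])
  then show ?case using 0 continuous_on_compose2[of UNIV "H j" S f] by auto
next
  case (Suc k)
  have d: "((\<lambda>z. H j (f z)) has_derivative (\<lambda>v. H (Suc j) (f z) * (Re v *\<^sub>R px f z + Im v *\<^sub>R py f z))) (at z)" if "z \<in> S" for z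
  proof -
    have "f differentiable at z" using Suc.prems that by simp
    from has_derivative_compose[OF has_derivative_px_py[OF this], of "H j" "(*) (H (Suc j) (f z))"]
    show ?thesis using assms(2)[of j "f z"] unfolding has_field_derivative_def by blast
  qed
  have k: "Ck k S f" using Ck_Suc_imp[OF Suc.prems] .
  have "Ck k S (px (\<lambda>z. H j (f z)))"
  proof (rule Ck_cong[OF assms(1), of "\<lambda>z. H (Suc j) (f z) * px f z"])
    show "Ck k S (\<lambda>z. H (Suc j) (f z) * px f z)"
      by (rule Ck_bilinear[OF assms(1) bounded_bilinear_mult Suc.IH[OF k]]) (use Suc.prems in simp)
  qed (subst px_eq[OF d], auto)
  moreover have "Ck k S (py (\<lambda>z. H j (f z)))"
  proof (rule Ck_cong[OF assms(1), of "\<lambda>z. H (Suc j) (f z) * py f z"])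
    show "Ck k S (\<lambda>z. H (Suc j) (f z) * py f z)"
      by (rule Ck_bilinear[OF assms(1) bounded_bilinear_mult Suc.IH[OF k]]) (use Suc.prems in simp)
  qed (subst py_eq[OF d], auto)
  moreover have "\<forall>z\<in>S. (\<lambda>z. H j (f z)) differentiable at z"
    using d by (auto intro: differentiableI)
  ultimately show ?case by simp
qed

lemma px_holomorphic: "f field_differentiable (at z) \<Longrightarrow> px f z = deriv f z"
  and py_holomorphic: "f field_differentiable (at z) \<Longrightarrow> py f z = \<i> * deriv f z"
proof -
  assume "f field_differentiable (at z)"
  then have d: "(f has_derivative (\<lambda>v. deriv f z * v)) (at z)"
    by (simp add: field_differentiable_derivI has_field_derivative_imp_has_derivative)
  show "px f z = deriv f z" "py f z = \<i> * deriv f z"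
    using px_eq[OF d] py_eq[OF d] by auto
qed

lemma Ck_holomorphic:
  assumes "open S" "f holomorphic_on S"
  shows "Ck k S f"
  using assms(2)
proof (induction k arbitrary: f)
  case 0
  then show ?case by (simp add: holomorphic_on_imp_continuous_on)
next
  case (Suc k)
  have d: "f field_differentiable (at z)" if "z \<in> S" for z
    using Suc.prems assms(1) that holomorphic_on_imp_differentiable_at by blast
  have h: "deriv f holomorphic_on S" using Suc.prems assms(1) by (rule holomorphic_deriv)
  have "Ck k S (px f)"
    by (rule Ck_cong[OF assms(1), of "deriv f"]) (use px_holomorphic[OF d] Suc.IH h in auto)
  moreover have "Ck k S (py f)"
    by (rule Ck_cong[OF assms(1), of "\<lambda>z. \<i> * deriv f z"])
       (use py_holomorphic[OF d] in simp, intro Suc.IH holomorphic_intros h)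
  moreover have "\<forall>z\<in>S. f differentiable (at z)"
    using d field_differentiable_imp_differentiable by blast
  ultimately show ?case by simp
qed

lemma Cinf_differentiable: "Cinf S f \<Longrightarrow> z \<in> S \<Longrightarrow> f differentiable (at z)"
  unfolding Cinf_def by (metis Ck.simps(2))

lemma Cinf_continuous: "Cinf S f \<Longrightarrow> continuous_on S f"
  unfolding Cinf_def by (metis Ck.simps(1))

lemma Cinf_px: "Cinf S f \<Longrightarrow> Cinf S (px f)"
  unfolding Cinf_def by (metis Ck.simps(2))

lemma Cinf_py: "Cinf S f \<Longrightarrow> Cinf S (py f)"
  unfolding Cinf_def by (metis Ck.simps(2))

lemma Cinf_subset: "Cinf S f \<Longrightarrow> T \<subseteq> S \<Longrightarrow> Cinf T f"
  unfolding Cinf_def using Ck_subset by blast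

lemma Cinf_Un: "open S \<Longrightarrow> open T \<Longrightarrow> Cinf S f \<Longrightarrow> Cinf T f \<Longrightarrow> Cinf (S \<union> T) f"
  unfolding Cinf_def using Ck_Un by blast

lemma Cinf_cong: "open S \<Longrightarrow> (\<And>w. w \<in> S \<Longrightarrow> f w = g w) \<Longrightarrow> Cinf S f \<Longrightarrow> Cinf S g"
  unfolding Cinf_def using Ck_cong by blast

lemma Cinf_const: "Cinf S (\<lambda>z. c)"
  unfolding Cinf_def using Ck_const by blast

lemma Cinf_linear: "open S \<Longrightarrow> bounded_linear L \<Longrightarrow> Cinf S f \<Longrightarrow> Cinf S (\<lambda>z. L (f z))"
  unfolding Cinf_def using Ck_linear by blast

lemma Cinf_add: "open S \<Longrightarrow> Cinf S f \<Longrightarrow> Cinf S g \<Longrightarrow> Cinf S (\<lambda>z. f z + g z)"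
  unfolding Cinf_def using Ck_add by blast

lemma Cinf_bilinear:
  "open S \<Longrightarrow> bounded_bilinear B \<Longrightarrow> Cinf S f \<Longrightarrow> Cinf S g \<Longrightarrow> Cinf S (\<lambda>z. B (f z) (g z))"
  unfolding Cinf_def using Ck_bilinear by blast

lemma Cinf_compose_real:
  fixes H :: "nat \<Rightarrow> real \<Rightarrow> real" and f :: "complex \<Rightarrow> real"
  assumes "open S" "\<And>j x. (H j has_real_derivative H (Suc j) x) (at x)" "Cinf S f"
  shows "Cinf S (\<lambda>z. H j (f z))"
  using assms Ck_compose_real unfolding Cinf_def by blast

lemma Cinf_holomorphic: "open S \<Longrightarrow> f holomorphic_on S \<Longrightarrow> Cinf S f"
  unfolding Cinf_def using Ck_holomorphic by blast

lemmas Cinf_inner = Cinf_bilinear[OF _ bounded_bilinear_inner]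
lemmas Cinf_scaleR = Cinf_bilinear[OF _ bounded_bilinear_scaleR]
lemmas Cinf_Re = Cinf_linear[OF _ bounded_linear_Re]
lemmas Cinf_Im = Cinf_linear[OF _ bounded_linear_Im]
lemmas Cinf_of_real = Cinf_linear[OF _ bounded_linear_of_real]
lemmas Cinf_nth = Cinf_linear[OF _ bounded_linear_vec_nth]
lemmas Cinf_minus = Cinf_linear[OF _ bounded_linear_minus[OF bounded_linear_ident]]

lemma Cinf_mult:
  fixes f g :: "complex \<Rightarrow> 'a::real_normed_algebra"
  shows "open S \<Longrightarrow> Cinf S f \<Longrightarrow> Cinf S g \<Longrightarrow> Cinf S (\<lambda>z. f z * g z)"
  by (rule Cinf_bilinear[OF _ bounded_bilinear_mult])

lemma Cinf_diff: "open S \<Longrightarrow> Cinf S f \<Longrightarrow> Cinf S g \<Longrightarrow> Cinf S (\<lambda>z. f z - g z)"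
  using Cinf_add[of S f "\<lambda>z. - g z"] Cinf_minus[of S g] by simp

lemma Cinf_sum:
  "open S \<Longrightarrow> (\<And>i. i \<in> I \<Longrightarrow> Cinf S (f i)) \<Longrightarrow> Cinf S (\<lambda>z. \<Sum>i\<in>I. f i z)"
  by (induction I rule: infinite_finite_induct) (auto intro: Cinf_const Cinf_add)

lemma Cinf_vec:
  fixes f :: "complex \<Rightarrow> real^'n"
  assumes "open S" "\<And>i. Cinf S (\<lambda>z. f z $ i)"
  shows "Cinf S f"
proof -
  have "f z = (\<Sum>i\<in>UNIV. (f z $ i) *\<^sub>R axis i 1)" for z
    by (simp add: vec_eq_iff axis_def if_distrib cong: if_cong)
  moreover have "Cinf S (\<lambda>z. \<Sum>i\<in>UNIV. (f z $ i) *\<^sub>R (axis i 1 :: real^'n))"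
    by (intro Cinf_sum Cinf_scaleR assms Cinf_const)
  ultimately show ?thesis by presburger
qed

text \<open>Symmetry of second derivatives: compare the second difference on a small square with both
  mixed derivatives.\<close>

lemma py_px_eq_px_py:
  fixes f :: "complex \<Rightarrow> real"
  assumes "open S" "Cinf S f" "z \<in> S"
  shows "py (px f) z = px (py f) z"
proof -
  obtain r where r: "r > 0" "ball z r \<subseteq> S" using assms openE by blast
  have inS: "z + Complex a b \<in> S" if "\<bar>a\<bar> < r/2" "\<bar>b\<bar> < r/2" for a b
  proof -
    have "cmod (Complex a b) \<le> \<bar>a\<bar> + \<bar>b\<bar>" using cmod_le[of "Complex a b"] by simp
    then have "z + Complex a b \<in> ball z r" using that by (simp add: dist_norm)
    then show ?thesis using r by auto
  qed
  have dx: "((\<lambda>t. g (z + Complex t b)) has_real_derivative px g (z + Complex a b)) (at a)"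
    if "Cinf S g" "\<bar>a\<bar> < r/2" "\<bar>b\<bar> < r/2" for a b and g :: "complex \<Rightarrow> real"
  proof -
    have d: "((\<lambda>t. z + Complex t b) has_derivative (\<lambda>t. Complex t 0)) (at a)"
      unfolding complex_of_real_def[symmetric] Complex_eq by (auto intro!: derivative_eq_intros)
    from has_derivative_compose[OF this has_derivative_px_py[OF Cinf_differentiable[OF that(1) inS[OF that(2,3)]]]]
    show ?thesis unfolding has_field_derivative_def by (simp add: mult.commute mult_commute_abs)
  qed
  have dy: "((\<lambda>t. g (z + Complex a t)) has_real_derivative py g (z + Complex a b)) (at b)"
    if "Cinf S g" "\<bar>a\<bar> < r/2" "\<bar>b\<bar> < r/2" for a b and g :: "complex \<Rightarrow> real"
  proof -
    have d: "((\<lambda>t. z + Complex a t) has_derivative (\<lambda>t. Complex 0 t)) (at b)"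
      unfolding Complex_eq by (auto intro!: derivative_eq_intros)
    from has_derivative_compose[OF this has_derivative_px_py[OF Cinf_differentiable[OF that(1) inS[OF that(2,3)]]]]
    show ?thesis unfolding has_field_derivative_def by (simp add: mult.commute mult_commute_abs)
  qed
  define \<Delta> where "\<Delta> s = f (z + Complex s s) - f (z + Complex s 0) - f (z + Complex 0 s) + f (z + Complex 0 0)" for s
  have A: "\<exists>a b. 0 < a \<and> a < s \<and> 0 < b \<and> b < s \<and> \<Delta> s = s * s * py (px f) (z + Complex a b)"
    if s: "0 < s" "s < r/2" for s
  proof -
    have "\<exists>a. 0 < a \<and> a < s \<and> (f (z + Complex s s) - f (z + Complex s 0)) - (f (z + Complex 0 s) - f (z + Complex 0 0))
        = (s - 0) * (px f (z + Complex a s) - px f (z + Complex a 0))"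
      by (rule MVT2[OF s(1)]) (intro DERIV_diff dx assms; use s in auto)
    then obtain a where a: "0 < a" "a < s" "\<Delta> s = s * (px f (z + Complex a s) - px f (z + Complex a 0))"
      unfolding \<Delta>_def by auto
    have "\<exists>b. 0 < b \<and> b < s \<and> px f (z + Complex a s) - px f (z + Complex a 0) = (s - 0) * py (px f) (z + Complex a b)"
      by (rule MVT2[OF s(1)]) (intro dy Cinf_px assms; use s a in auto)
    then show ?thesis using a by force
  qed
  have B: "\<exists>a b. 0 < a \<and> a < s \<and> 0 < b \<and> b < s \<and> \<Delta> s = s * s * px (py f) (z + Complex a b)"
    if s: "0 < s" "s < r/2" for s
  proof -
    have "\<exists>b. 0 < b \<and> b < s \<and> (f (z + Complex s s) - f (z + Complex 0 s)) - (f (z + Complex s 0) - f (z + Complex 0 0))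
        = (s - 0) * (py f (z + Complex s b) - py f (z + Complex 0 b))"
      by (rule MVT2[OF s(1)]) (intro DERIV_diff dy assms; use s in auto)
    then obtain b where b: "0 < b" "b < s" "\<Delta> s = s * (py f (z + Complex s b) - py f (z + Complex 0 b))"
      unfolding \<Delta>_def by auto
    have "\<exists>a. 0 < a \<and> a < s \<and> py f (z + Complex s b) - py f (z + Complex 0 b) = (s - 0) * px (py f) (z + Complex a b)"
      by (rule MVT2[OF s(1)]) (intro dx Cinf_py assms; use s b in auto)
    then show ?thesis using b by force
  qed
  show ?thesis
  proof (rule ccontr)
    let ?p = "py (px f)" and ?q = "px (py f)"
    assume ne: "?p z \<noteq> ?q z"
    define e where "e = \<bar>?p z - ?q z\<bar> / 2"
    have e: "e > 0" using ne unfolding e_def by simp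
    have "isCont ?p z" "isCont ?q z"
      using assms Cinf_continuous Cinf_px Cinf_py continuous_on_eq_continuous_at by blast+
    then obtain d1 d2 where d: "d1 > 0" "\<And>w. dist w z < d1 \<Longrightarrow> dist (?p w) (?p z) < e"
       "d2 > 0" "\<And>w. dist w z < d2 \<Longrightarrow> dist (?q w) (?q z) < e"
      unfolding continuous_at_eps_delta using e by metis
    \<comment> \<open>Both mean value points lie in the square of side s, hence within distance 2 *
      s of z.\<close>
    define s where "s = min (r/4) (min d1 d2 / 4)"
    have s: "0 < s" "s < r/2" "2 * s < d1" "2 * s < d2" using r d unfolding s_def by auto
    obtain a b where ab: "0 < a" "a < s" "0 < b" "b < s" "\<Delta> s = s * s * ?p (z + Complex a b)" using A[OF s(1,2)] by blast
    obtain a' b' where ab': "0 < a'" "a' < s" "0 < b'" "b' < s" "\<Delta> s = s * s * ?q (z + Complex a' b')" using B[OF s(1,2)] by blast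
    have *: "dist (z + Complex a b) z < 2 * s" if "0 < a" "a < s" "0 < b" "b < s" for a b
      using cmod_le[of "Complex a b"] that by (simp add: dist_norm)
    have "?p (z + Complex a b) = ?q (z + Complex a' b')" using ab(5) ab'(5) s(1) by simp
    moreover have "dist (?p (z + Complex a b)) (?p z) < e" using *[OF ab(1-4)] s d by auto
    moreover have "dist (?q (z + Complex a' b')) (?q z) < e" using *[OF ab'(1-4)] s d by auto
    ultimately show False unfolding e_def dist_real_def by argo
  qed
qed

section \<open>The divergence theorem for functions vanishing on the frontier\<close>

lemma compact_absolutely_integrable:
  fixes f :: "'a::euclidean_space \<Rightarrow> 'b::euclidean_space"
  assumes "compact K" "continuous_on K f"
  shows "f absolutely_integrable_on K"
proof -
  have "set_integrable lborel K f"
    unfolding set_integrable_def by (rule borel_integrable_compact[OF assms])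
  then show ?thesis
    unfolding set_integrable_def by (metis integrable_completion borel_measurable_integrable)
qed

lemmas compact_integrable = absolutely_integrable_on_def[THEN iffD1, OF compact_absolutely_integrable, THEN conjunct1]

lemma directional_DERIV:
  fixes h :: "'a::real_normed_vector \<Rightarrow> real"
  assumes "(h has_derivative D) (at (z + t *\<^sub>R d))"
  shows "((\<lambda>t. h (z + t *\<^sub>R d)) has_real_derivative D d) (at t)"
proof -
  interpret bounded_linear D using assms by (rule has_derivative_bounded_linear)
  have "((\<lambda>t. z + t *\<^sub>R d) has_derivative (\<lambda>t. t *\<^sub>R d)) (at t)"
    by (auto intro!: derivative_eq_intros)
  from has_derivative_compose[OF this assms]
  show ?thesis unfolding has_field_derivative_def by (simp add: scaleR mult.commute mult_commute_abs)
qed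

text \<open>A compact part of the zero set on which the directional derivative does not vanish is disjoint
  from all its small translates in that direction, so it is null.\<close>

lemma negligible_compact_transversal_zeros:
  fixes h :: "'a::euclidean_space \<Rightarrow> real"
  assumes S: "open S" and h: "\<And>z. z \<in> S \<Longrightarrow> (h has_derivative D z) (at z)"
    and cont: "continuous_on S (\<lambda>z. D z d)" and K: "compact K" "K \<subseteq> S"
    and zero: "\<And>z. z \<in> K \<Longrightarrow> h z = 0 \<and> D z d \<noteq> 0"
  shows "negligible K"
proof (cases "K = {}")
  case False
  then obtain z0 where z0: "z0 \<in> K" by blast
  have "linear (D z0)"
    using h z0 K has_derivative_bounded_linear bounded_linear.linear by blast
  then have d0: "d \<noteq> 0" using zero[OF z0] linear_0 by blast
  define U where "U = {z \<in> S. D z d \<noteq> 0}"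
  have "U = S \<inter> (\<lambda>z. D z d) -` (- {0})" unfolding U_def by auto
  then have U: "open U" using continuous_open_preimage[OF cont S, of "- {0}"] by auto
  have "K \<subseteq> U" using zero K unfolding U_def by auto
  then obtain \<delta> where \<delta>: "\<delta> > 0" "(\<Union>x\<in>K. ball x \<delta>) \<subseteq> U"
    using compact_subset_open_imp_ball_epsilon_subset[OF K(1) U] by blast
  have nz: "h (z + s *\<^sub>R d) \<noteq> 0" if z: "z \<in> K" and s: "0 < s" "s * norm d < \<delta>" for z s
  proof
    assume h0: "h (z + s *\<^sub>R d) = 0"
    have inU: "z + t *\<^sub>R d \<in> U" if "0 \<le> t" "t \<le> s" for t
    proof -
      have "t * norm d \<le> s * norm d" using that by (simp add: mult_right_mono)
      then have "z + t *\<^sub>R d \<in> ball z \<delta>" using that s by (simp add: dist_norm)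
      then show ?thesis using \<delta> z by blast
    qed
    have "\<exists>\<xi>. 0 < \<xi> \<and> \<xi> < s \<and> h (z + s *\<^sub>R d) - h (z + 0 *\<^sub>R d) = (s - 0) * D (z + \<xi> *\<^sub>R d) d"
      by (rule MVT2[OF s(1)]) (intro directional_DERIV h, use inU U_def in auto)
    then obtain \<xi> where \<xi>: "0 < \<xi>" "\<xi> < s"
        "h (z + s *\<^sub>R d) - h (z + 0 *\<^sub>R d) = (s - 0) * D (z + \<xi> *\<^sub>R d) d"
      by blast
    then have "D (z + \<xi> *\<^sub>R d) d = 0" using h0 zero[OF z] s(1) by simp
    then show False using inU[of \<xi>] \<xi> unfolding U_def by auto
  qed
  obtain R where R: "K \<subseteq> cball 0 R" using compact_imp_bounded[OF K(1)] unfolding bounded_iff by (metis mem_cball_0 subsetI)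
  \<comment> \<open>All shifts below are at most c in units of d, so every segment between two
    shifted copies of a point stays in U, where h is strictly monotone in the direction d.\<close>
  define c where "c = \<delta> / (2 * norm d)"
  have c: "c > 0" "c * norm d < \<delta>" using \<delta> d0 unfolding c_def by auto
  have mK: "K \<in> lmeasurable" using K(1) lmeasurable_compact by blast
  \<comment> \<open>n disjoint translates of K lie in one fixed ball, so n times the measure of K is
    bounded independently of n.\<close>
  have bound: "real n * measure lebesgue K \<le> measure lebesgue (cball (0::'a) (R + \<delta>))" for n
  proof -
    define s where "s k = c * (real k / real (Suc n))" for k
    define T where "T k = (\<lambda>z. s k *\<^sub>R d + z) ` K" for k :: nat
    have sless: "s j < s k" if "j < k" for j k
      unfolding s_def using that c by (simp add: divide_strict_right_mono)
    have sle: "0 \<le> s k" "s k \<le> c" if "k < n" for k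
    proof -
      have "real k / real (Suc n) \<le> 1" using that by simp
      then show "s k \<le> c" unfolding s_def using c by (metis mult_left_le less_imp_le)
      show "0 \<le> s k" unfolding s_def using c by simp
    qed
    have disj: "T j \<inter> T k = {}" if "j < k" "k < n" for j k
    proof (rule ccontr)
      assume "T j \<inter> T k \<noteq> {}"
      then obtain x y where xy: "x \<in> K" "y \<in> K" "s j *\<^sub>R d + x = s k *\<^sub>R d + y"
        unfolding T_def by auto
      then have "x = y + (s k - s j) *\<^sub>R d" by (simp add: algebra_simps)
      moreover have "(s k - s j) * norm d < \<delta>"
      proof -
        have "s k - s j \<le> c" using sle[of k] sle[of j] that by auto
        then have "(s k - s j) * norm d \<le> c * norm d" by (simp add: mult_right_mono)
        then show ?thesis using c by linarith
      qed
      ultimately show False using nz[of y "s k - s j"] sless[OF that(1)] zero[OF xy(1)] xy by auto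
    qed
    have "T i \<inter> T j = {}" if "i < n" "j < n" "i \<noteq> j" for i j
      using disj[of i j] disj[of j i] that by (cases i j rule: linorder_cases) auto
    then have pw: "pairwise (\<lambda>x y. negligible (T x \<inter> T y)) {..<n}"
      by (auto simp: pairwise_def)
    have mT: "T k \<in> lmeasurable" "measure lebesgue (T k) = measure lebesgue K" for k
      unfolding T_def using measurable_translation[OF mK] measure_translation by auto
    have "real n * measure lebesgue K = measure lebesgue (\<Union>(T ` {..<n}))"
      using measure_negligible_finite_Union_image[of "{..<n}" T] pw mT by simp
    also have "\<dots> \<le> measure lebesgue (cball (0::'a) (R + \<delta>))"
    proof (rule measure_mono_fmeasurable)
      show "\<Union> (T ` {..<n}) \<subseteq> cball 0 (R + \<delta>)"
      proof clarify
        fix k x assume k: "k < n" and "x \<in> T k"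
        then obtain z where z: "z \<in> K" "x = s k *\<^sub>R d + z" unfolding T_def by auto
        have "s k * norm d \<le> c * norm d" using sle[OF k] by (simp add: mult_right_mono)
        then have "norm (s k *\<^sub>R d) \<le> \<delta>" using sle[OF k] c by simp
        moreover have "norm z \<le> R" using z R by auto
        ultimately show "x \<in> cball 0 (R + \<delta>)" using norm_triangle_ineq[of "s k *\<^sub>R d" z] z by simp
      qed
      show "\<Union> (T ` {..<n}) \<in> sets lebesgue" using mT by (auto intro!: sets.finite_UN)
    qed simp
    finally show ?thesis .
  qed
  have "measure lebesgue K \<le> 0"
  proof (rule ccontr)
    assume "\<not> measure lebesgue K \<le> 0"
    then have "measure lebesgue K > 0" by simp
    then obtain n where "real n * measure lebesgue K > measure lebesgue (cball (0::'a) (R + \<delta>))"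
      using reals_Archimedean3 by blast
    then show False using bound[of n] by simp
  qed
  then have "measure lebesgue K = 0" using measure_nonneg[of lebesgue K] by linarith
  then show ?thesis using negligible_iff_measure mK by blast
qed auto

text \<open>The open set where the directional derivative is nonzero is a countable union of closed
  boxes, and the zeros inside each box form a compact set.\<close>

lemma negligible_transversal_zeros:
  fixes h :: "'a::euclidean_space \<Rightarrow> real"
  assumes S: "open S" and h: "\<And>z. z \<in> S \<Longrightarrow> (h has_derivative D z) (at z)"
    and cont: "continuous_on S (\<lambda>z. D z d)"
  shows "negligible {z \<in> S. h z = 0 \<and> D z d \<noteq> 0}"
proof -
  define U where "U = {z \<in> S. D z d \<noteq> 0}"
  have "U = S \<inter> (\<lambda>z. D z d) -` (- {0})" unfolding U_def by auto
  then have U: "open U" using continuous_open_preimage[OF cont S, of "- {0}"] by auto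
  obtain \<D> where \<D>: "countable \<D>" "\<D> \<subseteq> Pow U" "\<And>X. X \<in> \<D> \<Longrightarrow> \<exists>a b. X = cbox a b" "\<Union>\<D> = U"
    using open_countable_Union_open_cbox[OF U] by metis
  have "negligible {z \<in> X. h z = 0}" if X: "X \<in> \<D>" for X
  proof -
    have XU: "X \<subseteq> U" using \<D> X by blast
    have XS: "X \<subseteq> S" using XU U_def by auto
    have "compact X" using \<D>(3)[OF X] by auto
    moreover have "continuous_on X h"
      using h XS by (auto intro!: continuous_at_imp_continuous_on has_derivative_continuous)
    ultimately have "compact {z \<in> X. h z = 0}"
    proof -
      assume X': "compact X" "continuous_on X h"
      have "{z \<in> X. h z = 0} = X \<inter> h -` {0}" by auto
      then have "closed {z \<in> X. h z = 0}"
        using continuous_closed_preimage[OF X'(2) compact_imp_closed[OF X'(1)], of "{0}"] by simp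
      then show ?thesis using X'(1) by (metis (no_types, lifting) closed_Int_compact inf.absorb1 mem_Collect_eq subsetI)
    qed
    then show ?thesis
      using XU XS cont U_def
      by (intro negligible_compact_transversal_zeros[of S h D d] S h) auto
  qed
  then have "negligible (\<Union>X\<in>\<D>. {z \<in> X. h z = 0})"
    using \<D>(1) by (auto intro!: negligible_countable_Union)
  moreover have "(\<Union>X\<in>\<D>. {z \<in> X. h z = 0}) = {z \<in> S. h z = 0 \<and> D z d \<noteq> 0}"
    using \<D>(4) unfolding U_def by auto
  ultimately show ?thesis by simp
qed


text \<open>The function vanishes at the first frontier point on a segment that leaves the set.\<close>

lemma exit_bound:
  fixes h :: "'a::euclidean_space \<Rightarrow> real"
  assumes h: "\<And>z. z \<in> S \<Longrightarrow> (h has_derivative D z) (at z)"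
    and \<Omega>: "closed \<Omega>" "\<Omega> \<subseteq> S" and zero: "\<And>z. z \<in> frontier \<Omega> \<Longrightarrow> h z = 0"
    and L: "\<And>z. z \<in> \<Omega> \<Longrightarrow> \<bar>D z d\<bar> \<le> L" and x: "x \<in> \<Omega>" and s: "0 \<le> s" "x + s *\<^sub>R d \<notin> \<Omega>"
  shows "\<bar>h x\<bar> \<le> L * s"
proof -
  \<comment> \<open>The infimum of T is the first time at which the segment is not in the interior;
    it is attained because T is closed.\<close>
  define T where "T = {t \<in> {0..s}. x + t *\<^sub>R d \<notin> interior \<Omega>}"
  have "continuous_on {0..s} (\<lambda>t. x + t *\<^sub>R d)" by (intro continuous_intros)
  then have "closed ({0..s} \<inter> (\<lambda>t. x + t *\<^sub>R d) -` (- interior \<Omega>))"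
    by (intro continuous_closed_preimage) auto
  moreover have "T = {0..s} \<inter> (\<lambda>t. x + t *\<^sub>R d) -` (- interior \<Omega>)" unfolding T_def by auto
  ultimately have T: "closed T" by simp
  have "s \<in> T" unfolding T_def using s interior_subset by auto
  moreover have bdd: "bdd_below T" unfolding T_def by (auto intro: bdd_belowI[of _ 0])
  ultimately have cT: "Inf T \<in> T" using closed_contains_Inf[of T] T by blast
  define c where "c = Inf T"
  have c: "0 \<le> c" "c \<le> s" "x + c *\<^sub>R d \<notin> interior \<Omega>" using cT unfolding c_def T_def by auto
  have int: "x + t *\<^sub>R d \<in> interior \<Omega>" if "0 \<le> t" "t < c" for t
  proof (rule ccontr)
    assume "x + t *\<^sub>R d \<notin> interior \<Omega>"
    then have "t \<in> T" using that c unfolding T_def by auto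
    then have "c \<le> t" using cInf_lower[OF _ bdd] unfolding c_def by blast
    then show False using that by simp
  qed
  have "x + c *\<^sub>R d \<in> \<Omega>"
  proof (cases "c = 0")
    case False
    then have c0: "c > 0" using c by simp
    have "((\<lambda>t. x + t *\<^sub>R d) \<longlongrightarrow> x + c *\<^sub>R d) (at_left c)"
      by (intro tendsto_intros)
    moreover have "eventually (\<lambda>t. x + t *\<^sub>R d \<in> \<Omega>) (at_left c)"
      using eventually_at_left_real[OF c0] int interior_subset[of \<Omega>]
      by (auto elim!: eventually_mono)
    ultimately show ?thesis
      using Lim_in_closed_set[OF \<Omega>(1), of "\<lambda>t. x + t *\<^sub>R d" "at_left c"] by auto
  qed (use x in simp)
  then have front: "x + c *\<^sub>R d \<in> frontier \<Omega>" and cin: "x + c *\<^sub>R d \<in> \<Omega>"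
    using c \<Omega> by (auto simp: frontier_def)
  have inO: "x + t *\<^sub>R d \<in> \<Omega>" if "0 \<le> t" "t \<le> c" for t
    using int[of t] that cin interior_subset by (cases "t = c") auto
  have L0: "0 \<le> L" using L[OF x] by linarith
  show ?thesis
  proof (cases "c = 0")
    case True
    then show ?thesis using zero[OF front] L0 s by simp
  next
    case False
    then have c0: "0 < c" using c by simp
    have "\<exists>\<xi>. 0 < \<xi> \<and> \<xi> < c \<and> h (x + c *\<^sub>R d) - h (x + 0 *\<^sub>R d) = (c - 0) * D (x + \<xi> *\<^sub>R d) d"
      by (rule MVT2[OF c0]) (intro directional_DERIV h, use inO \<Omega> in auto)
    then obtain \<xi> where \<xi>: "0 < \<xi>" "\<xi> < c" "- h x = c * D (x + \<xi> *\<^sub>R d) d"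
      using zero[OF front] by auto
    then have "\<bar>h x\<bar> = c * \<bar>D (x + \<xi> *\<^sub>R d) d\<bar>"
      using c0 by (metis abs_minus_cancel abs_mult abs_of_pos)
    also have "\<dots> \<le> s * L"
      using \<xi> c c0 inO[of \<xi>] by (intro mult_mono L) auto
    finally show ?thesis by (simp add: mult.commute)
  qed
qed

text \<open>A segment with both ends in \<Omega> may leave \<Omega> in between. Then h is compared
  with its zeros on the frontier, starting from each end, and the two bounds L * t and L * (s - t)
  add up.\<close>

lemma restricted_lipschitz:
  fixes h :: "'a::euclidean_space \<Rightarrow> real"
  assumes h: "\<And>z. z \<in> S \<Longrightarrow> (h has_derivative D z) (at z)"
    and \<Omega>: "closed \<Omega>" "\<Omega> \<subseteq> S" and zero: "\<And>z. z \<in> frontier \<Omega> \<Longrightarrow> h z = 0"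
    and L: "\<And>z. z \<in> \<Omega> \<Longrightarrow> \<bar>D z d\<bar> \<le> L" and L0: "0 \<le> L" and s: "0 \<le> s"
  defines "g \<equiv> \<lambda>z. if z \<in> \<Omega> then h z else 0"
  shows "\<bar>g (x + s *\<^sub>R d) - g x\<bar> \<le> L * s"
proof -
  have Lm: "\<bar>D z (- d)\<bar> \<le> L" if "z \<in> \<Omega>" for z
  proof -
    have "linear (D z)" using h that \<Omega> has_derivative_bounded_linear bounded_linear.linear by blast
    then show ?thesis using L[OF that] by (simp add: linear_neg)
  qed
  note fwd = exit_bound[of S h D \<Omega> d L, OF h \<Omega> zero L]
  note bwd = exit_bound[of S h D \<Omega> "- d" L, OF h \<Omega> zero Lm]
  consider "x \<in> \<Omega>" "x + s *\<^sub>R d \<notin> \<Omega>" | "x \<notin> \<Omega>" "x + s *\<^sub>R d \<in> \<Omega>" | "x \<notin> \<Omega>" "x + s *\<^sub>R d \<notin> \<Omega>"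
    | "x \<in> \<Omega>" "x + s *\<^sub>R d \<in> \<Omega>" by blast
  then show ?thesis
  proof cases
    case 1
    then show ?thesis using fwd[of x s] s unfolding g_def by simp
  next
    case 2
    then show ?thesis using bwd[of "x + s *\<^sub>R d" s] s unfolding g_def by simp
  next
    case 3
    then show ?thesis using L0 s unfolding g_def by simp
  next
    case 4
    show ?thesis
    proof (cases "\<forall>t\<in>{0..s}. x + t *\<^sub>R d \<in> \<Omega>")
      case True
      show ?thesis
      proof (cases "s = 0")
        case False
        then have s0: "0 < s" using s by simp
        have "\<exists>\<xi>. 0 < \<xi> \<and> \<xi> < s \<and> h (x + s *\<^sub>R d) - h (x + 0 *\<^sub>R d) = (s - 0) * D (x + \<xi> *\<^sub>R d) d"
          by (rule MVT2[OF s0]) (intro directional_DERIV h, use True \<Omega> in auto)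
        then obtain \<xi> where \<xi>: "0 < \<xi>" "\<xi> < s" "h (x + s *\<^sub>R d) - h x = s * D (x + \<xi> *\<^sub>R d) d"
          by auto
        have "\<bar>s * D (x + \<xi> *\<^sub>R d) d\<bar> \<le> s * L"
          using L[of "x + \<xi> *\<^sub>R d"] True \<xi> s by (simp add: abs_mult mult_left_mono)
        then show ?thesis using \<xi> 4 unfolding g_def by (simp add: mult.commute)
      qed simp
    next
      case False
      then obtain t where t: "0 \<le> t" "t \<le> s" "x + t *\<^sub>R d \<notin> \<Omega>" by auto
      have "\<bar>h x\<bar> \<le> L * t" using fwd[of x t] 4 t by auto
      moreover have "\<bar>h (x + s *\<^sub>R d)\<bar> \<le> L * (s - t)"
        using bwd[of "x + s *\<^sub>R d" "s - t"] 4 t by (simp add: algebra_simps)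
      ultimately show ?thesis using 4 unfolding g_def by (simp add: algebra_simps)
    qed
  qed
qed


lemma integral_translate_UNIV:
  fixes g :: "'a::euclidean_space \<Rightarrow> real"
  assumes "integrable lborel g"
  shows "(\<lambda>z. g (a + z)) integrable_on UNIV" "integral UNIV (\<lambda>z. g (a + z)) = integral UNIV g"
proof -
  have m: "g \<in> borel_measurable borel" using borel_measurable_integrable[OF assms] by simp
  have 1: "integrable lborel (\<lambda>z. g (a + z))"
    using integrable_distr_eq[of "(+) a" lborel borel g] m assms lborel_distr_plus[of a] by simp
  then show "(\<lambda>z. g (a + z)) integrable_on UNIV" by (rule integrable_on_lborel)
  have "integral\<^sup>L lborel (\<lambda>z. g (a + z)) = integral\<^sup>L lborel g"
    using integral_distr[of "(+) a" lborel borel g] m lborel_distr_plus[of a] by simp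
  then show "integral UNIV (\<lambda>z. g (a + z)) = integral UNIV g"
    using 1 assms by (simp add: integral_lborel)
qed

text \<open>No boundary regularity of \<open>\<Omega>\<close> is needed: the extension of the function by zero is Lipschitz in the
  direction of differentiation, and its difference quotients converge almost everywhere.\<close>

proposition integral_directional_derivative_eq_0:
  fixes h :: "'a::euclidean_space \<Rightarrow> real"
  assumes S: "open S" and h: "\<And>z. z \<in> S \<Longrightarrow> (h has_derivative D z) (at z)"
    and cont: "continuous_on S (\<lambda>z. D z d)" and \<Omega>: "compact \<Omega>" "\<Omega> \<subseteq> S"
    and zero: "\<And>z. z \<in> frontier \<Omega> \<Longrightarrow> h z = 0"
  shows "integral \<Omega> (\<lambda>z. D z d) = 0"
proof -
  have "compact ((\<lambda>z. D z d) ` \<Omega>)"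
    using compact_continuous_image continuous_on_subset[OF cont \<Omega>(2)] \<Omega>(1) by blast
  then obtain L0 where L0: "\<And>z. z \<in> \<Omega> \<Longrightarrow> \<bar>D z d\<bar> \<le> L0"
    using compact_imp_bounded[of "(\<lambda>z. D z d) ` \<Omega>"] unfolding bounded_iff by auto
  define L where "L = max 0 L0"
  have L: "\<And>z. z \<in> \<Omega> \<Longrightarrow> \<bar>D z d\<bar> \<le> L" "0 \<le> L" using L0 unfolding L_def by fastforce+
  define g where "g z = (if z \<in> \<Omega> then h z else 0)" for z
  have gl: "\<bar>g (x + s *\<^sub>R d) - g x\<bar> \<le> L * s" if "0 \<le> s" for x s
    unfolding g_def by (rule restricted_lipschitz[of S]) (use h \<Omega> compact_imp_closed zero L that in auto)
  define a where "a n = inverse (real (Suc n))" for n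
  have a0: "0 < a n" "a n \<le> 1" for n unfolding a_def by (auto simp: field_simps)
  have a_ne: "a n \<noteq> 0" for n using a0[of n] by simp
  have alim: "a \<longlonglongrightarrow> 0" unfolding a_def by (rule LIMSEQ_inverse_real_of_nat)
  define f where "f n z = (g (z + a n *\<^sub>R d) - g z) / a n" for n z
  obtain R where R: "\<And>z. z \<in> \<Omega> \<Longrightarrow> norm z \<le> R"
    using compact_imp_bounded[OF \<Omega>(1)] unfolding bounded_iff by auto
  \<comment> \<open>Since 0 < a n \<le> 1, every difference quotient of g vanishes outside this
    ball, so b dominates them all.\<close>
  define B where "B = cball (0::'a) (R + norm d)"
  define b where "b z = (if z \<in> B then L else 0)" for z
  have hc: "continuous_on \<Omega> h"
    using h \<Omega> by (auto intro!: continuous_at_imp_continuous_on has_derivative_continuous)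
  have gi: "integrable lborel g"
  proof -
    have "g = (\<lambda>z. indicator \<Omega> z *\<^sub>R h z)" unfolding g_def by auto
    then show ?thesis using borel_integrable_compact[OF \<Omega>(1) hc] by (simp add: indicator_def if_distrib cong: if_cong)
  qed
  have fi: "f n integrable_on UNIV" "integral UNIV (f n) = 0" for n
  proof -
    note t = integral_translate_UNIV[OF gi, of "a n *\<^sub>R d"]
    have f: "f n = (\<lambda>z. (g (a n *\<^sub>R d + z) - g z) / a n)" unfolding f_def by (simp add: add.commute)
    show "f n integrable_on UNIV" unfolding f
      using t(1) integrable_on_lborel[OF gi] by (intro integrable_on_divide integrable_diff)
    show "integral UNIV (f n) = 0" unfolding f
      using t integrable_on_lborel[OF gi] by (simp add: integral_diff)
  qed
  have fb: "norm (f n z) \<le> b z" for n z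
  proof (cases "z \<in> B")
    case True
    have "\<bar>f n z\<bar> \<le> L"
      unfolding f_def abs_divide using gl[of "a n" z] a0[of n] by (simp add: pos_divide_le_eq)
    then show ?thesis using True unfolding b_def by simp
  next
    case False
    have "z \<notin> \<Omega>" using R[of z] False unfolding B_def
      using norm_ge_zero[of d] by (auto simp del: norm_ge_zero)
    moreover have "z + a n *\<^sub>R d \<notin> \<Omega>"
    proof
      assume "z + a n *\<^sub>R d \<in> \<Omega>"
      then have "norm (z + a n *\<^sub>R d) \<le> R" by (rule R)
      moreover have "norm z \<le> norm (z + a n *\<^sub>R d) + norm (a n *\<^sub>R d)"
        by (metis add_diff_cancel norm_triangle_ineq4)
      moreover have "norm (a n *\<^sub>R d) \<le> norm d" using a0[of n] by (simp add: mult_left_le_one_le)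
      ultimately show False using False unfolding B_def by simp
    qed
    ultimately show ?thesis using L unfolding f_def g_def b_def by simp
  qed
  have bi: "b integrable_on UNIV"
  proof -
    have "(\<lambda>z. L) integrable_on B" unfolding B_def by (rule compact_integrable) auto
    then show ?thesis unfolding b_def integrable_restrict_UNIV .
  qed
  define Z where "Z = {z \<in> S. h z = 0 \<and> D z d \<noteq> 0}"
  have Z: "negligible Z" unfolding Z_def by (rule negligible_transversal_zeros[OF S h cont])
  define l where "l z = (if z \<in> \<Omega> then D z d else 0)" for z
  have quot: "(\<lambda>n. (h (z + a n *\<^sub>R d) - h z) / a n) \<longlonglongrightarrow> D z d" if "z \<in> S" for z
  proof -
    have "((\<lambda>t. h (z + t *\<^sub>R d)) has_real_derivative D z d) (at 0)"
      by (rule directional_DERIV) (use h that in simp)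
    then have "((\<lambda>t. (h (z + t *\<^sub>R d) - h z) / t) \<longlongrightarrow> D z d) (at 0)"
      by (simp add: has_field_derivative_iff)
    then show ?thesis
      by (rule filterlim_compose) (use alim a_ne in \<open>auto simp: filterlim_at\<close>)
  qed
  have conv: "(\<lambda>n. f n z) \<longlonglongrightarrow> l z" if "z \<notin> Z" for z
  proof -
    have za: "(\<lambda>n. z + a n *\<^sub>R d) \<longlonglongrightarrow> z"
      using tendsto_add[OF tendsto_const tendsto_scaleR[OF alim tendsto_const], of z d] by simp
    consider "z \<notin> \<Omega>" | "z \<in> interior \<Omega>" | "z \<in> frontier \<Omega>" "z \<in> \<Omega>"
      by (auto simp: frontier_def compact_imp_closed[OF \<Omega>(1)])
    then show ?thesis
    proof cases
      case 1
      then have "eventually (\<lambda>n. z + a n *\<^sub>R d \<in> - \<Omega>) sequentially"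
        using za \<Omega>(1) compact_imp_closed by (intro topological_tendstoD) auto
      then have "eventually (\<lambda>n. f n z = 0) sequentially"
        by eventually_elim (use 1 in \<open>auto simp: f_def g_def\<close>)
      then show ?thesis using 1 unfolding l_def by (simp add: tendsto_eventually)
    next
      case 2
      then have zO: "z \<in> \<Omega>" using interior_subset by blast
      have "eventually (\<lambda>n. z + a n *\<^sub>R d \<in> interior \<Omega>) sequentially"
        using za 2 by (intro topological_tendstoD) auto
      then have "eventually (\<lambda>n. (h (z + a n *\<^sub>R d) - h z) / a n = f n z) sequentially"
        by eventually_elim (use zO interior_subset[of \<Omega>] in \<open>auto simp: f_def g_def\<close>)
      then show ?thesis using Lim_transform_eventually[OF quot] zO \<Omega> unfolding l_def by auto
    next
      case 3
      have hz: "h z = 0" using zero 3 by blast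
      have zS: "z \<in> S" using 3 \<Omega> by blast
      then have D0: "D z d = 0" using hz that unfolding Z_def by auto
      \<comment> \<open>At a frontier point the quotient of g is either that of h or 0, according to
        whether the shifted point lies in \<Omega>. Off Z both have the limit D z d = 0.\<close>
      have "(\<lambda>n. f n z) \<longlonglongrightarrow> 0"
      proof (rule Lim_null_comparison)
        show "\<forall>\<^sub>F n in sequentially. norm (f n z) \<le> \<bar>(h (z + a n *\<^sub>R d) - h z) / a n\<bar>"
          using a0 hz by (auto simp: f_def g_def intro!: always_eventually divide_nonneg_pos less_imp_le)
        show "(\<lambda>n. \<bar>(h (z + a n *\<^sub>R d) - h z) / a n\<bar>) \<longlonglongrightarrow> 0"
          using tendsto_rabs[OF quot[OF zS]] D0 by simp
      qed
      then show ?thesis using D0 unfolding l_def by simp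
    qed
  qed
  \<comment> \<open>Dominated convergence is applied with convergence at every point, so the
    quotients are first set to 0 on the null set Z.\<close>
  define f' where "f' n z = (if z \<in> Z then 0 else f n z)" for n z
  have "f' n integrable_on UNIV" for n
    by (rule integrable_spike[OF fi(1)[of n] Z]) (auto simp: f'_def)
  moreover have "norm (f' n z) \<le> b z" for n z
    using fb[of n z] L unfolding f'_def b_def by auto
  moreover have "(\<lambda>n. f' n z) \<longlonglongrightarrow> (if z \<in> Z then 0 else l z)" for z
    using conv unfolding f'_def by auto
  ultimately have "(\<lambda>n. integral UNIV (f' n)) \<longlonglongrightarrow> integral UNIV (\<lambda>z. if z \<in> Z then 0 else l z)"
    using bi by (intro dominated_convergence(2)[of f' UNIV b]) auto
  moreover have "integral UNIV (f' n) = 0" for n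
    using integral_spike[OF Z, of UNIV "f n" "f' n"] fi(2)[of n] unfolding f'_def by auto
  ultimately have "integral UNIV (\<lambda>z. if z \<in> Z then 0 else l z) = 0"
    by (simp add: LIMSEQ_const_iff)
  moreover have "integral UNIV (\<lambda>z. if z \<in> Z then 0 else l z) = integral UNIV l"
    by (rule integral_spike[OF Z]) auto
  moreover have "integral UNIV l = integral \<Omega> (\<lambda>z. D z d)"
    unfolding l_def by (rule integral_restrict_UNIV)
  ultimately show ?thesis by simp
qed

lemma integral_px_py_eq_0:
  fixes h :: "complex \<Rightarrow> real"
  assumes "open S" "Cinf S h" "compact \<Omega>" "\<Omega> \<subseteq> S" "\<And>z. z \<in> frontier \<Omega> \<Longrightarrow> h z = 0"
  shows "integral \<Omega> (px h) = 0" "integral \<Omega> (py h) = 0"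
proof -
  have d: "(h has_derivative (\<lambda>v. Re v *\<^sub>R px h z + Im v *\<^sub>R py h z)) (at z)" if "z \<in> S" for z
    using has_derivative_px_py[OF Cinf_differentiable[OF assms(2) that]] .
  show "integral \<Omega> (px h) = 0"
    using integral_directional_derivative_eq_0[OF assms(1) d _ assms(3,4), of 1] assms(5)
      Cinf_continuous[OF Cinf_px[OF assms(2)]] by simp
  show "integral \<Omega> (py h) = 0"
    using integral_directional_derivative_eq_0[OF assms(1) d _ assms(3,4), of \<i>] assms(5)
      Cinf_continuous[OF Cinf_py[OF assms(2)]] by simp
qed

text \<open>This turns a second derivative into a limit that pointwise estimates on the area can
  bound from either side. One application of L'Hospital leaves (a1 t - a1 (-t)) / (2 t); since a1 is
  known to be differentiable at 0 only, the rest is the average of two difference quotients of a1 at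
  0.\<close>

lemma second_deriv_symmetric_quotient:
  assumes "has_second_deriv_at a a2 0"
  shows "((\<lambda>t. (a t + a (- t) - 2 * a 0) / t\<^sup>2) \<longlongrightarrow> a2) (at 0)"
proof -
  obtain a1 e where e: "e > 0" and a1: "\<And>t. \<bar>t\<bar> < e \<Longrightarrow> (a has_real_derivative a1 t) (at t)"
    and a2: "(a1 has_real_derivative a2) (at 0)"
    using assms unfolding has_second_deriv_at_def by auto
  have ev: "eventually (\<lambda>t::real. \<bar>t\<bar> < e) (at 0)"
    using e by (auto simp: eventually_at dist_real_def)
  show ?thesis
  proof (rule lhopital[where f' = "\<lambda>t. a1 t - a1 (- t)" and g' = "\<lambda>t. 2 * t"])
    have c: "isCont a 0" using a1[of 0] e DERIV_isCont by auto
    have "((\<lambda>t. a t + a (- t) - 2 * a 0) \<longlongrightarrow> a 0 + a (- 0) - 2 * a 0) (at 0)"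
      using c by (intro tendsto_intros isCont_tendsto_compose[of _ a]) (auto simp: isCont_def)
    then show "((\<lambda>t. a t + a (- t) - 2 * a 0) \<longlongrightarrow> 0) (at 0)" by simp
    have "((\<lambda>t::real. t\<^sup>2) \<longlongrightarrow> 0\<^sup>2) (at 0)" by (intro tendsto_intros)
    then show "((\<lambda>t::real. t\<^sup>2) \<longlongrightarrow> 0) (at 0)" by simp
    show "\<forall>\<^sub>F t::real in at 0. t\<^sup>2 \<noteq> 0" "\<forall>\<^sub>F t::real in at 0. 2 * t \<noteq> 0"
      by (auto simp: eventually_at intro!: exI[of _ 1])
    show "\<forall>\<^sub>F t in at 0. ((\<lambda>t. a t + a (- t) - 2 * a 0) has_real_derivative a1 t - a1 (- t)) (at t)"
      using ev
    proof eventually_elim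
      case (elim t)
      have "((\<lambda>t. a (- t)) has_real_derivative a1 (- t) * (- 1)) (at t)"
        by (rule DERIV_chain2[OF a1]) (use elim in \<open>auto intro!: derivative_eq_intros\<close>)
      then show ?case using a1[OF elim] by (auto intro!: derivative_eq_intros)
    qed
    show "\<forall>\<^sub>F t::real in at 0. ((\<lambda>t. t\<^sup>2) has_real_derivative 2 * t) (at t)"
      by (auto intro!: always_eventually derivative_eq_intros)
    have q: "((\<lambda>t. (a1 t - a1 0) / t) \<longlongrightarrow> a2) (at 0)"
      using a2 by (simp add: has_field_derivative_iff)
    moreover have "((\<lambda>t. (a1 (- t) - a1 0) / (- t)) \<longlongrightarrow> a2) (at 0)"
      by (rule filterlim_compose[OF q])
         (auto simp: filterlim_at eventually_at intro!: tendsto_eq_intros exI[of _ 1])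
    ultimately have "((\<lambda>t. ((a1 t - a1 0) / t + (a1 (- t) - a1 0) / (- t)) / 2) \<longlongrightarrow> (a2 + a2) / 2) (at 0)"
      by (intro tendsto_intros) auto
    moreover have "((a1 t - a1 0) / t + (a1 (- t) - a1 0) / (- t)) / 2 = (a1 t - a1 (- t)) / (2 * t)" for t
      by (cases "t = 0") (auto simp: field_simps)
    ultimately show "((\<lambda>t. (a1 t - a1 (- t)) / (2 * t)) \<longlongrightarrow> a2) (at 0)"
      by (simp only: mult_2[symmetric] nonzero_mult_div_cancel_left[of 2] num.simps zero_neq_numeral not_False_eq_True)
  qed
qed

section \<open>Cutoff functions of small energy\<close>

text \<open>The derivatives of exp (-1/x), extended by 0, all have this form, so a polynomial
  parameter describes the whole sequence at once.\<close>

definition flat_exp :: "real poly \<Rightarrow> real \<Rightarrow> real" where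
  "flat_exp p x = (if x > 0 then poly p (1 / x) * exp (- (1 / x)) else 0)"

lemma poly_mult_exp_tendsto_0: "((\<lambda>x::real. poly p x * exp (- x)) \<longlongrightarrow> 0) at_top"
proof -
  have "((\<lambda>x. \<Sum>i\<le>degree p. coeff p i * (x ^ i / exp x)) \<longlongrightarrow> (\<Sum>i\<le>degree p. coeff p i * 0)) at_top"
    by (intro tendsto_intros tendsto_power_div_exp_0)
  then show ?thesis
    by (simp add: poly_altdef sum_distrib_right exp_minus divide_inverse mult.assoc)
qed

lemma flat_exp_tendsto_0: "(flat_exp p \<longlongrightarrow> 0) (at 0)"
proof -
  have l: "(flat_exp p \<longlongrightarrow> 0) (at_left 0)"
    by (rule tendsto_eventually) (auto simp: flat_exp_def eventually_at_filter)
  have "((\<lambda>x. poly p (inverse x) * exp (- inverse x)) \<longlongrightarrow> 0) (at_right 0)"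
    by (rule filterlim_compose[OF poly_mult_exp_tendsto_0 filterlim_inverse_at_top_right])
  moreover have "eventually (\<lambda>x. poly p (inverse x) * exp (- inverse x) = flat_exp p x) (at_right 0)"
    by (auto simp: flat_exp_def eventually_at_filter field_simps)
  ultimately have r: "(flat_exp p \<longlongrightarrow> 0) (at_right 0)" by (rule Lim_transform_eventually)
  show ?thesis using l r filterlim_at_split by blast
qed

text \<open>With y = 1/x the derivative in x is - y^2 times the derivative in y, which sends p(y)
  exp(-y) to y^2 (p - p')(y) exp(-y).\<close>

lemma flat_exp_DERIV:
  "(flat_exp p has_real_derivative flat_exp (monom 1 2 * (p - pderiv p)) x) (at x)"
proof -
  consider "x < 0" | "x = 0" | "x > 0" by linarith
  then show ?thesis
  proof cases
    case 1
    have "((\<lambda>x. 0) has_real_derivative 0) (at x)" by simp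
    moreover have "\<And>y. y \<in> {..<0} \<Longrightarrow> 0 = flat_exp p y" by (auto simp: flat_exp_def)
    ultimately have "(flat_exp p has_real_derivative 0) (at x)"
      using 1 has_field_derivative_transform_within_open[of "\<lambda>x. 0" 0 x "{..<0}" "flat_exp p"] by auto
    then show ?thesis using 1 by (simp add: flat_exp_def)
  next
    case 2
    \<comment> \<open>At 0 the difference quotient is again such a function, for the polynomial X p,
      and therefore tends to 0.\<close>
    have "eventually (\<lambda>y. flat_exp (monom 1 1 * p) y = (flat_exp p y - flat_exp p 0) / (y - 0)) (at 0)"
      by (auto simp: flat_exp_def eventually_at_filter poly_monom)
    from Lim_transform_eventually[OF flat_exp_tendsto_0 this]
    show ?thesis using 2 by (simp add: has_field_derivative_iff flat_exp_def)
  next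
    case 3
    have d: "((\<lambda>x. poly p (1 / x) * exp (- (1 / x))) has_real_derivative
        flat_exp (monom 1 2 * (p - pderiv p)) x) (at x)"
      using 3 by (auto intro!: derivative_eq_intros simp: flat_exp_def poly_monom field_simps power2_eq_square)
    show ?thesis
      by (rule has_field_derivative_transform_within_open[OF d, of "{0<..}"])
         (use 3 in \<open>auto simp: flat_exp_def\<close>)
  qed
qed

definition flat_poly :: "nat \<Rightarrow> real poly" where
  "flat_poly k = ((\<lambda>p. monom 1 2 * (p - pderiv p)) ^^ k) 1"

lemma flat_DERIV: "(flat_exp (flat_poly k) has_real_derivative flat_exp (flat_poly (Suc k)) x) (at x)"
  using flat_exp_DERIV[of "flat_poly k"] by (simp add: flat_poly_def)

lemma flat_0: "flat_exp (flat_poly 0) x = (if x > 0 then exp (- (1 / x)) else 0)"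
  by (simp add: flat_poly_def flat_exp_def)

lemma flat_1: "flat_exp (flat_poly (Suc 0)) x = (if x > 0 then exp (- (1 / x)) / x\<^sup>2 else 0)"
  by (simp add: flat_poly_def flat_exp_def poly_monom power_divide)

text \<open>A smooth step from 1 on the negative half line to 0 on \<open>[1, \<infinity>)\<close>: the inner expression
  is 1 on the negative half line and nonpositive from 1 on.\<close>

definition step :: "real \<Rightarrow> real" where
  "step x = exp 1 * flat_exp (flat_poly 0) (1 - exp 1 * flat_exp (flat_poly 0) x)"

definition step' :: "real \<Rightarrow> real" where
  "step' x = - (exp 1)\<^sup>2 * flat_exp (flat_poly (Suc 0)) (1 - exp 1 * flat_exp (flat_poly 0) x)
     * flat_exp (flat_poly (Suc 0)) x"

lemma step_DERIV: "(step has_real_derivative step' x) (at x)"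
proof -
  have "((\<lambda>x. 1 - exp 1 * flat_exp (flat_poly 0) x) has_real_derivative
      - exp 1 * flat_exp (flat_poly (Suc 0)) x) (at x)"
    by (auto intro!: derivative_eq_intros flat_DERIV)
  from DERIV_cmult[OF DERIV_chain2[OF flat_DERIV this], of "exp 1" 0]
  show ?thesis unfolding step_def step'_def by (simp add: power2_eq_square mult_ac)
qed

lemma step_eq_1: "x \<le> 0 \<Longrightarrow> step x = 1"
  by (simp add: step_def flat_0 exp_minus)

lemma step_eq_0: "1 \<le> x \<Longrightarrow> step x = 0"
proof -
  assume x: "1 \<le> x"
  have "exp (-1) \<le> exp (- (1 / x))" using x by (simp add: field_simps)
  then have "exp 1 * exp (-1) \<le> exp 1 * exp (- (1 / x))" by (intro mult_left_mono) auto
  then have "1 \<le> exp 1 * exp (- (1 / x))" by (simp add: exp_minus)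
  then show ?thesis using x by (simp add: step_def flat_0)
qed

lemma step_bounds: "0 \<le> step x" "step x \<le> 1"
proof -
  have *: "exp 1 * flat_exp (flat_poly 0) y \<le> 1" if "y \<le> 1" for y
  proof (cases "y > 0")
    case True
    then have "exp (- (1 / y)) \<le> exp (-1)" using that by (simp add: field_simps)
    then have "exp 1 * exp (- (1 / y)) \<le> exp 1 * exp (-1)" by (intro mult_left_mono) auto
    then show ?thesis using True by (simp add: flat_0 exp_minus)
  qed (simp add: flat_0)
  show "0 \<le> step x" by (simp add: step_def flat_0)
  have "0 \<le> flat_exp (flat_poly 0) x" by (simp add: flat_0)
  then show "step x \<le> 1" unfolding step_def by (intro *) simp
qed

lemma step'_nonpos: "step' x \<le> 0"
  by (simp add: step'_def flat_1 mult_nonpos_nonneg)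

lemma step'_eq_0: "x \<le> 0 \<or> 1 \<le> x \<Longrightarrow> step' x = 0"
proof -
  have "step' x = 0" if "1 \<le> x"
  proof -
    have "exp (-1) \<le> exp (- (1 / x))" using that by (simp add: field_simps)
    then have "exp 1 * exp (-1) \<le> exp 1 * exp (- (1 / x))" by (intro mult_left_mono) auto
    then have "1 \<le> exp 1 * exp (- (1 / x))" by (simp add: exp_minus)
    then show ?thesis using that by (simp add: step'_def flat_0 flat_1)
  qed
  then show "x \<le> 0 \<or> 1 \<le> x \<Longrightarrow> step' x = 0" by (auto simp: step'_def flat_1)
qed

lemma step'_neg: "0 < x \<Longrightarrow> x < 1 \<Longrightarrow> step' x < 0"
proof -
  assume x: "0 < x" "x < 1"
  have "exp (- (1 / x)) < exp (-1)" using x by (simp add: field_simps)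
  then have "exp 1 * exp (- (1 / x)) < exp 1 * exp (-1)" by (intro mult_strict_left_mono) auto
  then have "exp 1 * exp (- (1 / x)) < 1" by (simp add: exp_minus)
  then show ?thesis using x by (simp add: step'_def flat_0 flat_1 mult_neg_pos)
qed

lemma Cinf_step:
  assumes "open S" "Cinf S f" shows "Cinf S (\<lambda>z. step (f z))" "Cinf S (\<lambda>z. step' (f z))"
proof -
  note c = Cinf_compose_real[where H = "\<lambda>k. flat_exp (flat_poly k)", OF assms(1) flat_DERIV]
  have i: "Cinf S (\<lambda>z. 1 - exp 1 * flat_exp (flat_poly 0) (f z))"
    by (intro Cinf_diff Cinf_mult Cinf_const c assms)
  show "Cinf S (\<lambda>z. step (f z))" "Cinf S (\<lambda>z. step' (f z))"
    unfolding step_def step'_def by (intro Cinf_mult Cinf_const c[OF i] c[OF assms(2)] assms(1))+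
qed

lemma step'_bounded: "\<exists>M\<ge>0. \<forall>x. \<bar>step' x\<bar> \<le> M"
proof -
  have c: "continuous_on UNIV (flat_exp (flat_poly k))" for k
    by (rule DERIV_continuous_on) (rule flat_DERIV[THEN has_field_derivative_at_within])
  have "continuous_on UNIV step'" unfolding step'_def
    by (intro continuous_intros continuous_on_compose2[OF c[of "Suc 0"]] c continuous_on_compose2[OF c[of 0]]) auto
  then have "continuous_on {0..1} step'" using continuous_on_subset by blast
  then have "compact (step' ` {0..1})" by (intro compact_continuous_image) auto
  then obtain M where "\<forall>x\<in>{0..1}. \<bar>step' x\<bar> \<le> M"
    using compact_imp_bounded[of "step' ` {0..1}"] unfolding bounded_iff by auto
  then have "\<bar>step' x\<bar> \<le> max M 0" for x
    using step'_eq_0[of x] by (cases "x \<in> {0..1}") (force, auto)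
  then show ?thesis by (intro exI[of _ "max M 0"]) auto
qed

text \<open>A radial cutoff that is 1 on the disc of radius r and 0 outside radius 2 * r. Using the
  squared distance keeps it smooth at p, and 3 = 2^2 - 1 makes the step end at radius 2 * r.\<close>

definition plateau :: "complex \<Rightarrow> real \<Rightarrow> complex \<Rightarrow> real" where
  "plateau p r z = step (((cmod (z - p))\<^sup>2 / r\<^sup>2 - 1) / 3)"

lemma Cinf_norm_sq: "Cinf UNIV (\<lambda>z. (cmod (z - p))\<^sup>2)"
proof -
  have i: "Cinf UNIV (\<lambda>z::complex. z)" by (rule Cinf_holomorphic) auto
  have "Cinf UNIV (\<lambda>z. (Re z - Re p) * (Re z - Re p) + (Im z - Im p) * (Im z - Im p))"
    by (intro Cinf_add Cinf_mult Cinf_diff Cinf_const Cinf_Re Cinf_Im i open_UNIV)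
  then show ?thesis by (simp add: cmod_def power2_eq_square)
qed

lemma has_derivative_norm_sq:
  "((\<lambda>z. (cmod (z - p))\<^sup>2) has_derivative (\<lambda>v. 2 * (Re (z - p) * Re v + Im (z - p) * Im v))) (at z)"
proof -
  have "((\<lambda>z. (Re z - Re p)\<^sup>2 + (Im z - Im p)\<^sup>2) has_derivative
     (\<lambda>v. 2 * (Re (z - p) * Re v + Im (z - p) * Im v))) (at z)"
    by (auto intro!: derivative_eq_intros ext simp: algebra_simps)
  then show ?thesis by (simp add: cmod_def)
qed

lemma plateau_Cinf: "Cinf UNIV (plateau p r)"
proof -
  have "Cinf UNIV (\<lambda>z. ((cmod (z - p))\<^sup>2 * (1 / r\<^sup>2) - 1) * (1 / 3))"
    by (intro Cinf_mult Cinf_diff Cinf_const Cinf_norm_sq open_UNIV)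
  from Cinf_step(1)[OF open_UNIV this] show ?thesis unfolding plateau_def by simp
qed

lemma plateau_px_py:
  shows "px (plateau p r) z = step' (((cmod (z - p))\<^sup>2 / r\<^sup>2 - 1) / 3) * (2 * Re (z - p) / (3 * r\<^sup>2))"
    and "py (plateau p r) z = step' (((cmod (z - p))\<^sup>2 / r\<^sup>2 - 1) / 3) * (2 * Im (z - p) / (3 * r\<^sup>2))"
proof -
  have "((\<lambda>z. (g z * c - 1) * (1 / 3)) has_derivative (\<lambda>v. G v * c * (1 / 3))) (at z)"
    if "(g has_derivative G) (at z)" for g :: "complex \<Rightarrow> real" and G c
    using that by (auto intro!: derivative_eq_intros)
  from this[OF has_derivative_norm_sq, of p "1 / r\<^sup>2"]
  have "((\<lambda>z. ((cmod (z - p))\<^sup>2 / r\<^sup>2 - 1) / 3) has_derivative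
      (\<lambda>v. (2 * (Re (z - p) * Re v + Im (z - p) * Im v) / r\<^sup>2) / 3)) (at z)"
    by simp
  from has_derivative_compose[OF this step_DERIV[unfolded has_field_derivative_def]]
  have d: "(plateau p r has_derivative
      (\<lambda>v. step' (((cmod (z - p))\<^sup>2 / r\<^sup>2 - 1) / 3) * ((2 * (Re (z - p) * Re v + Im (z - p) * Im v) / r\<^sup>2) / 3))) (at z)"
    unfolding plateau_def .
  show "px (plateau p r) z = step' (((cmod (z - p))\<^sup>2 / r\<^sup>2 - 1) / 3) * (2 * Re (z - p) / (3 * r\<^sup>2))"
    "py (plateau p r) z = step' (((cmod (z - p))\<^sup>2 / r\<^sup>2 - 1) / 3) * (2 * Im (z - p) / (3 * r\<^sup>2))"
    using px_eq[OF d] py_eq[OF d] by auto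
qed

lemma plateau_bounds: "0 \<le> plateau p r z" "plateau p r z \<le> 1"
  unfolding plateau_def by (rule step_bounds)+

lemma plateau_eq_1: "r > 0 \<Longrightarrow> cmod (z - p) \<le> r \<Longrightarrow> plateau p r z = 1"
  unfolding plateau_def by (rule step_eq_1) (simp add: power_mono)

lemma far_ratio: "r > 0 \<Longrightarrow> 2 * r \<le> cmod (z - p) \<Longrightarrow> 1 \<le> ((cmod (z - p))\<^sup>2 / r\<^sup>2 - 1) / 3"
  using power_mono[of "2 * r" "cmod (z - p)" 2] by (simp add: field_simps)

lemma plateau_eq_0: "r > 0 \<Longrightarrow> 2 * r \<le> cmod (z - p) \<Longrightarrow> plateau p r z = 0"
  unfolding plateau_def by (rule step_eq_0) (rule far_ratio)

lemma plateau_gradient_0: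
  assumes "r > 0" "cmod (z - p) \<le> r \<or> 2 * r \<le> cmod (z - p)"
  shows "px (plateau p r) z = 0" "py (plateau p r) z = 0"
proof -
  have "((cmod (z - p))\<^sup>2 / r\<^sup>2 - 1) / 3 \<le> 0 \<or> 1 \<le> ((cmod (z - p))\<^sup>2 / r\<^sup>2 - 1) / 3"
    using assms far_ratio[of r z p] by (auto simp: power_mono)
  then have "step' (((cmod (z - p))\<^sup>2 / r\<^sup>2 - 1) / 3) = 0" by (rule step'_eq_0)
  then show "px (plateau p r) z = 0" "py (plateau p r) z = 0"
    unfolding plateau_px_py by simp_all
qed

text \<open>By scaling, the squared gradient is O(1/r^2) on a disc of area O(r^2), so the Dirichlet
  energy is bounded uniformly in r. If |step'| \<le> M, the constant is M^2 * 4 * 2^2 / 9.\<close>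

lemma plateau_gradient_bound:
  "\<exists>c\<ge>0. \<forall>p r z. r > 0 \<longrightarrow> (px (plateau p r) z)\<^sup>2 + (py (plateau p r) z)\<^sup>2 \<le> c / r\<^sup>2"
proof -
  obtain M where M: "\<And>x. \<bar>step' x\<bar> \<le> M" "0 \<le> M" using step'_bounded by auto
  have "(px (plateau p r) z)\<^sup>2 + (py (plateau p r) z)\<^sup>2 \<le> (16 / 9 * M\<^sup>2) / r\<^sup>2" if r: "r > 0" for p r z
  proof (cases "2 * r \<le> cmod (z - p)")
    case True
    then show ?thesis using plateau_gradient_0[OF r] by simp
  next
    case False
    let ?s = "step' (((cmod (z - p))\<^sup>2 / r\<^sup>2 - 1) / 3)"
    have "(px (plateau p r) z)\<^sup>2 + (py (plateau p r) z)\<^sup>2 = ?s\<^sup>2 * (4 * (cmod (z - p))\<^sup>2 / (9 * (r\<^sup>2)\<^sup>2))"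
    proof -
      have "(s * (2 * a / (3 * q)))\<^sup>2 + (s * (2 * b / (3 * q)))\<^sup>2 = s\<^sup>2 * (4 * (a\<^sup>2 + b\<^sup>2) / (9 * q\<^sup>2))"
        for s a b q :: real
        by (simp add: power_mult_distrib power_divide add_divide_distrib algebra_simps)
      from this[of ?s "Re (z - p)" "r\<^sup>2" "Im (z - p)"] show ?thesis
        unfolding plateau_px_py cmod_power2[of "z - p", symmetric] .
    qed
    also have "\<dots> \<le> M\<^sup>2 * (4 * (2 * r)\<^sup>2 / (9 * (r\<^sup>2)\<^sup>2))"
    proof (rule mult_mono)
      show "?s\<^sup>2 \<le> M\<^sup>2" using M abs_le_square_iff[of ?s M] by simp
      show "4 * (cmod (z - p))\<^sup>2 / (9 * (r\<^sup>2)\<^sup>2) \<le> 4 * (2 * r)\<^sup>2 / (9 * (r\<^sup>2)\<^sup>2)"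
        using False power_mono[of "cmod (z - p)" "2 * r" 2] by (intro divide_right_mono) auto
    qed auto
    also have "\<dots> = (16 / 9 * M\<^sup>2) / r\<^sup>2" using r by (simp add: field_simps power2_eq_square)
    finally show ?thesis .
  qed
  then show ?thesis by (intro exI[of _ "16 / 9 * M\<^sup>2"]) auto
qed


section \<open>Vanishing capacity of a point\<close>

lemma integral_le_disc:
  fixes f :: "complex \<Rightarrow> real"
  assumes "compact \<Omega>" "continuous_on \<Omega> f" "0 \<le> M" "0 \<le> r"
    and "\<And>z. z \<in> \<Omega> \<Longrightarrow> cmod (z - p) \<le> r \<Longrightarrow> f z \<le> M"
    and "\<And>z. z \<in> \<Omega> \<Longrightarrow> r < cmod (z - p) \<Longrightarrow> f z \<le> 0"
  shows "integral \<Omega> f \<le> M * (pi * r\<^sup>2)"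
proof -
  have 1: "(\<lambda>z. if z \<in> cball p r then M else 0) integrable_on UNIV"
    unfolding integrable_restrict_UNIV by (rule compact_integrable) auto
  have 2: "(\<lambda>z. if z \<in> \<Omega> then f z else 0) integrable_on UNIV"
    unfolding integrable_restrict_UNIV by (rule compact_integrable) (use assms in auto)
  have "integral \<Omega> f = integral UNIV (\<lambda>z. if z \<in> \<Omega> then f z else 0)"
    by (simp add: integral_restrict_UNIV)
  also have "\<dots> \<le> integral UNIV (\<lambda>z. if z \<in> cball p r then M else 0)"
    using assms(3,5,6) by (intro integral_le 1 2) (auto simp: dist_norm norm_minus_commute not_le)
  also have "\<dots> = integral (cball p r) (\<lambda>z. M * 1)" by (simp only: integral_restrict_UNIV mult_1_right)
  also have "\<dots> = M * integral (cball p r) (\<lambda>z. 1)" by (rule integral_mult_right)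
  also have "integral (cball p r) (\<lambda>z. 1::real) = measure lebesgue (cball p r)"
    by (rule lmeasure_integral[symmetric]) simp
  also have "\<dots> = pi * r\<^sup>2" using assms(4) by (simp add: content_cball unit_ball_vol_2)
  finally show ?thesis .
qed

text \<open>For gradients with disjoint supports the mixed products vanish, so the energy of a sum
  is the sum of the energies.\<close>

lemma square_sum_orthogonal:
  fixes x :: "'i \<Rightarrow> real"
  assumes "finite I" "\<And>i j. i \<in> I \<Longrightarrow> j \<in> I \<Longrightarrow> i \<noteq> j \<Longrightarrow> x i * x j = 0"
  shows "(\<Sum>i\<in>I. x i)\<^sup>2 = (\<Sum>i\<in>I. (x i)\<^sup>2)"
  using assms
proof (induction I rule: finite_induct)
  case (insert a I)
  have "x a * (\<Sum>i\<in>I. x i) = (\<Sum>i\<in>I. x a * x i)" by (rule sum_distrib_left)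
  also have "\<dots> = 0" using insert by (intro sum.neutral) auto
  finally show ?case using insert by (simp add: power2_sum)
qed simp

lemma px_py_sum:
  fixes f :: "'i \<Rightarrow> complex \<Rightarrow> real"
  assumes "finite I" "\<And>i. i \<in> I \<Longrightarrow> f i differentiable (at z)"
  shows "px (\<lambda>z. \<Sum>i\<in>I. f i z) z = (\<Sum>i\<in>I. px (f i) z)" "py (\<lambda>z. \<Sum>i\<in>I. f i z) z = (\<Sum>i\<in>I. py (f i) z)"
proof -
  have d: "((\<lambda>z. \<Sum>i\<in>I. f i z) has_derivative (\<lambda>v. \<Sum>i\<in>I. Re v *\<^sub>R px (f i) z + Im v *\<^sub>R py (f i) z)) (at z)"
    by (intro has_derivative_sum has_derivative_px_py assms)
  show "px (\<lambda>z. \<Sum>i\<in>I. f i z) z = (\<Sum>i\<in>I. px (f i) z)" "py (\<lambda>z. \<Sum>i\<in>I. f i z) z = (\<Sum>i\<in>I. py (f i) z)"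
    using px_eq[OF d] py_eq[OF d] by simp_all
qed

text \<open>A point of the plane has capacity zero: average the scale invariant cutoffs over many
  dyadic annuli.\<close>

lemma point_cutoff:
  fixes \<delta> \<epsilon> :: real
  assumes "\<delta> > 0" "\<epsilon> > 0"
  shows "\<exists>\<beta> r. 0 < r \<and> r < \<delta> \<and> Cinf UNIV \<beta> \<and> (\<forall>z. 0 \<le> \<beta> z \<and> \<beta> z \<le> 1) \<and>
     (\<forall>z. cmod (z - p) \<le> r \<longrightarrow> \<beta> z = 1) \<and> (\<forall>z. \<delta> \<le> cmod (z - p) \<longrightarrow> \<beta> z = 0) \<and>
     (\<forall>\<Omega>. compact \<Omega> \<longrightarrow> integral \<Omega> (\<lambda>z. (px \<beta> z)\<^sup>2 + (py \<beta> z)\<^sup>2) \<le> \<epsilon>)"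
proof -
  obtain c where c: "c \<ge> 0" "\<And>p r z. r > 0 \<Longrightarrow> (px (plateau p r) z)\<^sup>2 + (py (plateau p r) z)\<^sup>2 \<le> c / r\<^sup>2"
    using plateau_gradient_bound by auto
  \<comment> \<open>One plateau has energy at most (c / \<rho>^2) * pi * (2 \<rho>)^2 = 4 pi c. The
    average of n of them with disjoint gradients has energy at most 4 pi c / n.\<close>
  obtain K :: nat where K: "4 * pi * c / \<epsilon> < real K" using reals_Archimedean2 by blast
  define n where "n = Suc K"
  have n: "n > 0" "4 * pi * c / \<epsilon> \<le> real n" using K unfolding n_def by auto
  \<comment> \<open>The ratio 4 between consecutive radii makes the annuli from \<rho> k to 2 *
    \<rho> k disjoint, and the outermost one ends at \<delta>.\<close>
  define \<rho> where "\<rho> k = \<delta> / 2 / 4 ^ k" for k :: nat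
  have \<rho>: "\<rho> k > 0" "2 * \<rho> k \<le> \<delta>" for k
    using assms(1) unfolding \<rho>_def by (auto simp: field_simps)
  have \<rho>less: "2 * \<rho> k \<le> \<rho> j" if "j < k" for j k
  proof -
    have "(4::real) ^ Suc j \<le> 4 ^ k" using that by (intro power_increasing) auto
    moreover have "(0::real) < 4 ^ j" by simp
    ultimately have "2 * 4 ^ j \<le> (4::real) ^ k" unfolding power_Suc by linarith
    then show ?thesis unfolding \<rho>_def using assms(1) by (simp add: field_simps)
  qed
  define f where "f k = plateau p (\<rho> k)" for k
  define \<beta> where "\<beta> z = (\<Sum>k<n. 1 / real n * f k z)" for z
  have fC: "Cinf UNIV (f k)" for k unfolding f_def by (rule plateau_Cinf)
  have \<beta>C: "Cinf UNIV \<beta>" unfolding \<beta>_def by (intro Cinf_sum Cinf_mult Cinf_const fC open_UNIV)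
  have fd: "f k differentiable (at z)" for k z using Cinf_differentiable[OF fC] by simp
  have "0 \<le> \<beta> z" for z unfolding \<beta>_def f_def by (intro sum_nonneg) (simp add: plateau_bounds)
  moreover have "\<beta> z \<le> 1" for z
  proof -
    have "\<beta> z \<le> (\<Sum>k<n. 1 / real n * 1)" unfolding \<beta>_def f_def
      by (intro sum_mono mult_left_mono) (auto simp: plateau_bounds)
    then show ?thesis using n by simp
  qed
  moreover have "\<beta> z = 1" if "cmod (z - p) \<le> \<rho> n" for z
  proof -
    have "f k z = 1" if "k < n" for k
      unfolding f_def using \<rho>[of k] \<rho>[of n] \<rho>less[OF that] \<open>cmod (z - p) \<le> \<rho> n\<close> by (intro plateau_eq_1) auto
    then show ?thesis unfolding \<beta>_def using n by simp
  qed
  moreover have "\<beta> z = 0" if "\<delta> \<le> cmod (z - p)" for z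
  proof -
    have "f k z = 0" for k unfolding f_def using \<rho>[of k] that by (intro plateau_eq_0) auto
    then show ?thesis unfolding \<beta>_def by simp
  qed
  moreover have "integral \<Omega> (\<lambda>z. (px \<beta> z)\<^sup>2 + (py \<beta> z)\<^sup>2) \<le> \<epsilon>" if \<Omega>: "compact \<Omega>" for \<Omega>
  proof -
    let ?g = "\<lambda>k z. (px (f k) z)\<^sup>2 + (py (f k) z)\<^sup>2"
    have orth: "px (f j) z * px (f k) z = 0 \<and> py (f j) z * py (f k) z = 0" if "j < k" for j k z
    proof (cases "cmod (z - p) \<le> \<rho> j")
      case True
      then show ?thesis unfolding f_def using plateau_gradient_0[OF \<rho>(1)[of j]] by simp
    next
      case False
      then have "2 * \<rho> k \<le> cmod (z - p)" using \<rho>less[OF that] by simp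
      then show ?thesis unfolding f_def using plateau_gradient_0[OF \<rho>(1)[of k]] by simp
    qed
    have orth': "px (f j) z * px (f k) z = 0" "py (f j) z * py (f k) z = 0" if "j \<noteq> k" for j k z
      using orth[of j k z] orth[of k j z] that by (cases j k rule: linorder_cases; simp add: mult.commute)+
    have eq: "(px \<beta> z)\<^sup>2 + (py \<beta> z)\<^sup>2 = (1 / real n)\<^sup>2 * (\<Sum>k<n. ?g k z)" for z
    proof -
      have d: "(\<lambda>z. 1 / real n * f k z) differentiable (at z)" for k
        by (rule Cinf_differentiable[of UNIV]) (intro Cinf_mult Cinf_const fC open_UNIV, simp)
      have "px \<beta> z = 1 / real n * (\<Sum>k<n. px (f k) z)" "py \<beta> z = 1 / real n * (\<Sum>k<n. py (f k) z)"
        unfolding \<beta>_def px_py_sum[of "{..<n}" "\<lambda>k z. 1 / real n * f k z" z, OF finite_lessThan d]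
        by (simp_all only: px_py_cmult[OF fd] sum_distrib_left)
      then show ?thesis
        using square_sum_orthogonal[of "{..<n}" "\<lambda>k. px (f k) z"] square_sum_orthogonal[of "{..<n}" "\<lambda>k. py (f k) z"] orth'
        by (simp add: power_mult_distrib sum.distrib algebra_simps power_divide add_divide_distrib)
    qed
    have cont: "continuous_on \<Omega> (?g k)" for k
      using Cinf_continuous[OF Cinf_px[OF fC[of k]]] Cinf_continuous[OF Cinf_py[OF fC[of k]]]
      by (auto intro!: continuous_intros elim: continuous_on_subset)
    have gk: "integral \<Omega> (?g k) \<le> 4 * pi * c" for k
    proof -
      have "integral \<Omega> (?g k) \<le> (c / (\<rho> k)\<^sup>2) * (pi * (2 * \<rho> k)\<^sup>2)"
      proof (rule integral_le_disc[OF \<Omega> cont])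
        show "?g k z \<le> c / (\<rho> k)\<^sup>2" for z unfolding f_def by (rule c(2)[OF \<rho>(1)])
        show "?g k z \<le> 0" if "2 * \<rho> k < cmod (z - p)" for z
          unfolding f_def using plateau_gradient_0[OF \<rho>(1)[of k], of z] that by simp
      qed (use c(1) \<rho>(1)[of k] in auto)
      also have "\<dots> = 4 * pi * c" using \<rho>(1)[of k] by (simp add: field_simps)
      finally show ?thesis .
    qed
    have "integral \<Omega> (\<lambda>z. (px \<beta> z)\<^sup>2 + (py \<beta> z)\<^sup>2) = (1 / real n)\<^sup>2 * (\<Sum>k<n. integral \<Omega> (?g k))"
      unfolding eq by (simp only: integral_mult_right integral_sum[OF finite_lessThan compact_integrable[OF \<Omega> cont]])
    also have "\<dots> \<le> (1 / real n)\<^sup>2 * (\<Sum>k<n. 4 * pi * c)"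
      by (intro mult_left_mono sum_mono gk) auto
    also have "\<dots> = 4 * pi * c / real n" using n by (simp add: field_simps power2_eq_square)
    also have "\<dots> \<le> \<epsilon>" using n assms(2) by (simp add: field_simps)
    finally show ?thesis .
  qed
  moreover have "0 < \<rho> n" "\<rho> n < \<delta>" using \<rho>[of n] by auto
  ultimately show ?thesis using \<beta>C by (intro exI[of _ \<beta>] exI[of _ "\<rho> n"]) simp
qed

section \<open>Exhaustion by perforated discs\<close>

text \<open>A defining function for a boundary circle: s = 1 for the outer circle and s = -1 for a
  hole. Its derivative in the radial direction is 2 s |z - p|^2.\<close>

lemma smooth_circle:
  assumes "z \<noteq> p"
  shows "Cinf UNIV (\<lambda>w. s * ((cmod (w - p))\<^sup>2 - c))"
    and "s \<noteq> 0 \<Longrightarrow> frechet_derivative (\<lambda>w. s * ((cmod (w - p))\<^sup>2 - c)) (at z) (z - p) \<noteq> 0"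
proof -
  show "Cinf UNIV (\<lambda>w. s * ((cmod (w - p))\<^sup>2 - c))"
    by (intro Cinf_mult Cinf_diff Cinf_const Cinf_norm_sq open_UNIV)
  have "((\<lambda>w. s * (g w - c)) has_derivative (\<lambda>v. s * G v)) (at z)"
    if "(g has_derivative G) (at z)" for g :: "complex \<Rightarrow> real" and G
    using that by (auto intro!: derivative_eq_intros)
  from frechet_derivative_at[OF this[OF has_derivative_norm_sq], of p, symmetric]
  have "frechet_derivative (\<lambda>w. s * ((cmod (w - p))\<^sup>2 - c)) (at z) (z - p) = s * (2 * (cmod (z - p))\<^sup>2)"
    unfolding cmod_power2 by (simp add: power2_eq_square)
  then show "s \<noteq> 0 \<Longrightarrow> frechet_derivative (\<lambda>w. s * ((cmod (w - p))\<^sup>2 - c)) (at z) (z - p) \<noteq> 0"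
    using assms by simp
qed

text \<open>The boundary circles are finitely many and disjoint. Removing the other discs from V
  leaves a neighborhood in which \<Omega> is one side of a single circle.\<close>

lemma perforated_disc:
  assumes Q: "finite Q" and r: "\<And>p. p \<in> Q \<Longrightarrow> 0 < r p \<and> cball p (r p) \<subseteq> ball 0 R"
    and disj: "\<And>p q. p \<in> Q \<Longrightarrow> q \<in> Q \<Longrightarrow> p \<noteq> q \<Longrightarrow> cball p (r p) \<inter> cball q (r q) = {}"
    and R: "R > 0" and \<Omega>: "\<Omega> = cball 0 R - (\<Union>p\<in>Q. ball p (r p))" and S: "\<Omega> \<subseteq> S"
  shows "compact_smooth_domain S \<Omega>"
    and "z \<in> frontier \<Omega> \<Longrightarrow> cmod z = R \<or> (\<exists>p\<in>Q. cmod (z - p) = r p)"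
proof -
  have c: "compact \<Omega>" unfolding \<Omega> by (intro compact_diff) auto
  have fr: "cmod z = R \<or> (\<exists>p\<in>Q. cmod (z - p) = r p)" if z: "z \<in> frontier \<Omega>" for z
  proof (rule ccontr)
    assume no: "\<not> (cmod z = R \<or> (\<exists>p\<in>Q. cmod (z - p) = r p))"
    let ?U = "ball 0 R - (\<Union>p\<in>Q. cball p (r p))"
    have "open ?U" using Q by (intro open_Diff closed_UN) auto
    have zO: "z \<in> \<Omega>" using z compact_imp_closed[OF c] by (auto simp: frontier_def)
    have "z \<in> ?U"
    proof -
      have "cmod z < R" using zO no unfolding \<Omega> by (auto simp: less_le)
      moreover have "r p < dist p z" if "p \<in> Q" for p
        using zO no that unfolding \<Omega> by (force simp: dist_norm norm_minus_commute not_less)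
      ultimately show ?thesis by (auto simp: not_le)
    qed
    moreover have "?U \<subseteq> \<Omega>" unfolding \<Omega> by (auto simp: not_less not_le less_imp_le)
    ultimately have "z \<in> interior \<Omega>" using \<open>open ?U\<close> interiorI by blast
    then show False using z by (simp add: frontier_def)
  qed
  then show "z \<in> frontier \<Omega> \<Longrightarrow> cmod z = R \<or> (\<exists>p\<in>Q. cmod (z - p) = r p)" by blast
  have "\<exists>V (\<phi>::complex \<Rightarrow> real). open V \<and> z \<in> V \<and> Cinf V \<phi> \<and>
        (\<exists>v. frechet_derivative \<phi> (at z) v \<noteq> 0) \<and> \<Omega> \<inter> V = {z\<in>V. \<phi> z \<le> 0}"
    if z: "z \<in> frontier \<Omega>" for z
    using fr[OF z]
  proof (elim disjE bexE)
    assume zR: "cmod z = R"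
    define V where "V = - (\<Union>p\<in>Q. cball p (r p))"
    have "open V" unfolding V_def using Q by (intro open_Compl closed_UN) auto
    moreover have "z \<in> V" using r zR unfolding V_def by fastforce
    moreover have "\<Omega> \<inter> V = {w \<in> V. 1 * ((cmod (w - 0))\<^sup>2 - R\<^sup>2) \<le> 0}"
    proof -
      have "(cmod w)\<^sup>2 \<le> R\<^sup>2 \<longleftrightarrow> cmod w \<le> R" for w using R by (simp add: abs_le_square_iff[symmetric])
      then show ?thesis unfolding \<Omega> V_def by (auto simp: not_le less_imp_le)
    qed
    ultimately show ?thesis
      using Cinf_subset[OF smooth_circle(1)[of z 0 1 "R\<^sup>2"] subset_UNIV, of V]
        smooth_circle(2)[of z 0 1 "R\<^sup>2"] zR R
      by (intro exI[of _ V] exI[of _ "\<lambda>w. 1 * ((cmod (w - 0))\<^sup>2 - R\<^sup>2)"]) auto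
  next
    fix p assume p: "p \<in> Q" "cmod (z - p) = r p"
    define V where "V = ball 0 R - (\<Union>q\<in>Q-{p}. cball q (r q))"
    have zp: "z \<in> cball p (r p)" using p by (simp add: dist_norm norm_minus_commute)
    have "open V" unfolding V_def using Q by (intro open_Diff closed_UN) auto
    moreover have "z \<in> V" using r[OF p(1)] zp disj[OF p(1)] unfolding V_def by blast
    moreover have "\<Omega> \<inter> V = {w \<in> V. - 1 * ((cmod (w - p))\<^sup>2 - (r p)\<^sup>2) \<le> 0}"
    proof -
      have "(r p)\<^sup>2 \<le> (cmod (w - p))\<^sup>2 \<longleftrightarrow> w \<notin> ball p (r p)" for w
        using r[OF p(1)] abs_le_square_iff[of "r p" "cmod (w - p)"] by (auto simp: dist_norm norm_minus_commute)
      note sq = this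
      have "w \<in> \<Omega> \<longleftrightarrow> w \<notin> ball p (r p)" if "w \<in> V" for w
      proof -
        have "w \<notin> ball q (r q)" if "q \<in> Q - {p}" for q
        proof -
          have "w \<notin> cball q (r q)" using \<open>w \<in> V\<close> that unfolding V_def by blast
          then show ?thesis by simp
        qed
        moreover have "w \<in> cball 0 R" using that unfolding V_def by simp
        ultimately show ?thesis unfolding \<Omega> using p(1) by blast
      qed
      then show ?thesis using sq by auto
    qed
    moreover have "z \<noteq> p" using p r by force
    ultimately show ?thesis
      using Cinf_subset[OF smooth_circle(1)[of z p "-1" "(r p)\<^sup>2"] subset_UNIV, of V]
        smooth_circle(2)[of z p "-1" "(r p)\<^sup>2"]
      by (intro exI[of _ V] exI[of _ "\<lambda>w. - 1 * ((cmod (w - p))\<^sup>2 - (r p)\<^sup>2)"]) auto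
  qed
  then show "compact_smooth_domain S \<Omega>" unfolding compact_smooth_domain_def using c S by blast
qed


lemma separated_radius:
  assumes Q: "finite Q" and D: "compact D" "D \<inter> Q = {}" and QR: "\<And>p. p \<in> Q \<Longrightarrow> cmod p < R"
  shows "\<exists>\<delta>>0. \<forall>p\<in>Q. cball p \<delta> \<subseteq> ball 0 R \<and> cball p \<delta> \<inter> D = {} \<and>
    (\<forall>q\<in>Q. q \<noteq> p \<longrightarrow> cball p \<delta> \<inter> cball q \<delta> = {})"
proof -
  have "\<exists>e>0. ball p e \<subseteq> ball 0 R \<inter> - D \<inter> - (Q - {p})" if "p \<in> Q" for p
  proof -
    have "open (ball 0 R \<inter> - D \<inter> - (Q - {p}))"
      using D(1) Q by (intro open_Int open_ball open_Compl compact_imp_closed finite_imp_closed) auto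
    moreover have "p \<in> ball 0 R \<inter> - D \<inter> - (Q - {p})" using that QR D(2) by auto
    ultimately show ?thesis using open_contains_ball by blast
  qed
  then obtain e where e: "\<And>p. p \<in> Q \<Longrightarrow> e p > 0 \<and> ball p (e p) \<subseteq> ball 0 R \<inter> - D \<inter> - (Q - {p})"
    by metis
  define m where "m = Min (insert 1 (e ` Q))"
  have m: "m > 0" "\<And>p. p \<in> Q \<Longrightarrow> m \<le> e p" unfolding m_def using Q e by auto
  \<comment> \<open>A common point of two closed discs of radius \<delta> would give dist p q \<le>
    2 * \<delta> and put q into the disc of radius 3 * \<delta> about p, which contains no other
    point of Q.\<close>
  define \<delta> where "\<delta> = m / 3"
  have sub: "ball p (3 * \<delta>) \<subseteq> ball 0 R \<inter> - D \<inter> - (Q - {p})" if "p \<in> Q" for p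
  proof -
    have "ball p (3 * \<delta>) \<subseteq> ball p (e p)" using m(2)[OF that] unfolding \<delta>_def by (intro subset_ball) simp
    then show ?thesis using e[OF that] by blast
  qed
  have \<delta>: "\<delta> > 0" using m unfolding \<delta>_def by simp
  have c: "cball p \<delta> \<subseteq> ball p (3 * \<delta>)" for p :: complex using \<delta> by auto
  have "cball p \<delta> \<inter> cball q \<delta> = {}" if "p \<in> Q" "q \<in> Q" "q \<noteq> p" for p q
  proof (rule ccontr)
    assume "cball p \<delta> \<inter> cball q \<delta> \<noteq> {}"
    then obtain x where "dist p x \<le> \<delta>" "dist q x \<le> \<delta>" by auto
    then have "dist p q \<le> 2 * \<delta>" using dist_triangle2[of p q x] by simp
    then have "q \<in> ball p (3 * \<delta>)" using \<delta> by simp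
    then show False using sub[OF that(1)] that by blast
  qed
  then show ?thesis using \<delta> sub c by (intro exI[of _ \<delta>]) blast
qed

text \<open>The weight w stands for the squared size of the test field. Boundedness of w makes the
  cutoffs at the points of P cheap, since points have capacity zero; the decay of w like 1 / |z|^2
  makes a single plateau of large radius cheap, its weighted energy being O(1 / R0^2).\<close>

lemma exhaustion_cutoff:
  fixes C \<epsilon> :: real and w :: "complex \<Rightarrow> real"
  assumes P: "P sparse_in UNIV" and D: "compact D" "D \<subseteq> - P"
    and w: "continuous_on (- P) w" "\<And>z. z \<in> - P \<Longrightarrow> 0 \<le> w z \<and> w z \<le> C"
      "\<And>z. z \<in> - P \<Longrightarrow> (cmod z)\<^sup>2 * w z \<le> C" and \<epsilon>: "\<epsilon> > 0"
  shows "\<exists>\<Omega> \<eta> G. compact_smooth_domain (- P) \<Omega> \<and> open G \<and> D \<subseteq> G \<and> G \<subseteq> \<Omega> \<and> Cinf UNIV \<eta> \<and>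
    (\<forall>z\<in>frontier \<Omega>. \<eta> z = 0) \<and> (\<forall>z\<in>G. \<eta> z = (1::real)) \<and>
    integral \<Omega> (\<lambda>z. ((px \<eta> z)\<^sup>2 + (py \<eta> z)\<^sup>2) * w z) \<le> \<epsilon>"
proof -
  obtain c where c: "c \<ge> 0" "\<And>p r z. r > 0 \<Longrightarrow> (px (plateau p r) z)\<^sup>2 + (py (plateau p r) z)\<^sup>2 \<le> c / r\<^sup>2"
    using plateau_gradient_bound by auto
  obtain R1 where R1: "\<And>z. z \<in> D \<Longrightarrow> cmod z \<le> R1"
    using compact_imp_bounded[OF D(1)] unfolding bounded_iff by auto
  have cP: "countable P" using sparse_imp_countable[of UNIV P] P by simp
  \<comment> \<open>R0 > R1 puts D inside the disc where the outer plateau is 1. The last lower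
    bound, with R0 \<ge> 1, makes 4 pi c C / R0^2 at most \<epsilon> / 4. As P is countable, some
    circle of radius 2 * R0 avoids it.\<close>
  obtain R0 where R0: "R0 > R1" "R0 \<ge> 1" "R0 \<ge> 16 * pi * c * C / \<epsilon>" "\<And>p. p \<in> P \<Longrightarrow> cmod p \<noteq> 2 * R0"
  proof -
    define m where "m = \<bar>R1\<bar> + 1 + \<bar>16 * pi * c * C / \<epsilon>\<bar>"
    have "uncountable {m<..<m + 1}" by (simp add: uncountable_open_interval)
    moreover have "countable ((\<lambda>p. cmod p / 2) ` P)" using cP by simp
    ultimately have "\<not> {m<..<m + 1} \<subseteq> (\<lambda>p. cmod p / 2) ` P"
      using countable_subset by metis
    then obtain x where x: "x \<in> {m<..<m + 1}" "x \<notin> (\<lambda>p. cmod p / 2) ` P"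
      unfolding subset_iff by metis
    note abs_ge_self[of R1] abs_ge_zero[of R1] abs_ge_self[of "16 * pi * c * C / \<epsilon>"]
      abs_ge_zero[of "16 * pi * c * C / \<epsilon>"]
    moreover have "m < x" using x(1) by simp
    ultimately have "R1 < x" "1 \<le> x" "16 * pi * c * C / \<epsilon> \<le> x" unfolding m_def by linarith+
    moreover have "cmod p \<noteq> 2 * x" if "p \<in> P" for p
    proof
      assume "cmod p = 2 * x"
      then have "x = cmod p / 2" by simp
      then show False using x(2) that by blast
    qed
    ultimately show ?thesis by (rule that)
  qed
  have R0p: "0 < R0" using R0 by simp
  define Q where "Q = P \<inter> cball 0 (2 * R0)"
  have fQ: "finite Q" unfolding Q_def
    using sparse_in_compact_finite[of P "cball 0 (2 * R0)"] sparse_in_subset[OF P] by (simp add: Int_commute)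
  have QR: "cmod p < 2 * R0" if "p \<in> Q" for p
    using that R0(4)[of p] unfolding Q_def by auto
  have DQ: "D \<inter> Q = {}" using D unfolding Q_def by auto
  obtain \<delta> where \<delta>: "\<delta> > 0" and sep: "\<And>p. p \<in> Q \<Longrightarrow> cball p \<delta> \<subseteq> ball 0 (2 * R0)"
      "\<And>p. p \<in> Q \<Longrightarrow> cball p \<delta> \<inter> D = {}"
      "\<And>p q. p \<in> Q \<Longrightarrow> q \<in> Q \<Longrightarrow> q \<noteq> p \<Longrightarrow> cball p \<delta> \<inter> cball q \<delta> = {}"
    using separated_radius[OF fQ D(1) DQ QR] by auto
  have C0: "C \<ge> 0"
  proof -
    have "uncountable (UNIV :: complex set)" using uncountable_UNIV_complex .
    then have "P \<noteq> UNIV" using cP by metis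
    then obtain z where "z \<in> - P" by auto
    then show ?thesis using w(2)[of z] by linarith
  qed
  \<comment> \<open>The cutoffs at the points of Q cost 2 * C * card Q * \<epsilon>', at most
    \<epsilon> / 2; the outer one costs twice \<epsilon> / 4. The added ones keep the denominator
    positive.\<close>
  define \<epsilon>' where "\<epsilon>' = \<epsilon> / (4 * (C + 1) * (real (card Q) + 1))"
  have \<epsilon>': "\<epsilon>' > 0" unfolding \<epsilon>'_def using \<epsilon> C0 by simp
  obtain \<beta> r where \<beta>: "\<And>p. 0 < r p \<and> r p < \<delta>" "\<And>p. Cinf UNIV (\<beta> p)" "\<And>p z. 0 \<le> \<beta> p z \<and> \<beta> p z \<le> (1::real)"
     "\<And>p z. cmod (z - p) \<le> r p \<Longrightarrow> \<beta> p z = 1" "\<And>p z. \<delta> \<le> cmod (z - p) \<Longrightarrow> \<beta> p z = 0"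
     "\<And>p \<Omega>. compact \<Omega> \<Longrightarrow> integral \<Omega> (\<lambda>z. (px (\<beta> p) z)\<^sup>2 + (py (\<beta> p) z)\<^sup>2) \<le> \<epsilon>'"
  proof -
    define Pr where "Pr p b \<longleftrightarrow> 0 < snd b \<and> snd b < \<delta> \<and> Cinf UNIV (fst b) \<and> (\<forall>z. 0 \<le> fst b z \<and> fst b z \<le> 1) \<and>
     (\<forall>z. cmod (z - p) \<le> snd b \<longrightarrow> fst b z = 1) \<and> (\<forall>z. \<delta> \<le> cmod (z - p) \<longrightarrow> fst b z = 0) \<and>
     (\<forall>\<Omega>. compact \<Omega> \<longrightarrow> integral \<Omega> (\<lambda>z. (px (fst b) z)\<^sup>2 + (py (fst b) z)\<^sup>2) \<le> \<epsilon>')" for p and b :: "(complex \<Rightarrow> real) \<times> real"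
    have "\<exists>b. Pr p b" for p
      unfolding Pr_def split_paired_Ex fst_conv snd_conv by (rule point_cutoff[OF \<delta> \<epsilon>'])
    then obtain b where b: "\<And>p. Pr p (b p)" by metis
    show ?thesis
      by (rule that[of "\<lambda>p. snd (b p)" "\<lambda>p. fst (b p)"]) (use b in \<open>simp_all add: Pr_def\<close>)
  qed
  define \<Omega> where "\<Omega> = cball 0 (2 * R0) - (\<Union>p\<in>Q. ball p (r p))"
  have rsub: "cball p (r p) \<subseteq> cball p \<delta>" for p using \<beta>(1)[of p] by (intro subset_cball) simp
  have \<Omega>S: "\<Omega> \<subseteq> - P"
  proof
    fix z assume z: "z \<in> \<Omega>"
    show "z \<in> - P"
    proof
      assume "z \<in> P"
      then have "z \<in> Q" using z unfolding \<Omega>_def Q_def by auto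
      then show False using z \<beta>(1)[of z] unfolding \<Omega>_def by auto
    qed
  qed
  have dom\<Omega>: "compact_smooth_domain (- P) \<Omega>"
      "\<And>z. z \<in> frontier \<Omega> \<Longrightarrow> cmod z = 2 * R0 \<or> (\<exists>p\<in>Q. cmod (z - p) = r p)"
  proof -
    have 1: "0 < r p \<and> cball p (r p) \<subseteq> ball 0 (2 * R0)" if "p \<in> Q" for p
      using subset_trans[OF rsub sep(1)[OF that]] \<beta>(1)[of p] by simp
    have 2: "cball p (r p) \<inter> cball q (r q) = {}" if "p \<in> Q" "q \<in> Q" "p \<noteq> q" for p q
      using sep(3)[of p q] that rsub[of p] rsub[of q] by blast
    show "compact_smooth_domain (- P) \<Omega>"
      "\<And>z. z \<in> frontier \<Omega> \<Longrightarrow> cmod z = 2 * R0 \<or> (\<exists>p\<in>Q. cmod (z - p) = r p)"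
      using perforated_disc[OF fQ 1 2 _ \<Omega>_def \<Omega>S] R0p by auto
  qed
  have c\<Omega>: "compact \<Omega>" using dom\<Omega> unfolding compact_smooth_domain_def by blast
  define b where "b z = (\<Sum>p\<in>Q. \<beta> p z)" for z
  define h where "h = plateau 0 R0"
  \<comment> \<open>The factor h vanishes on the outer circle, and b is 1 on the inner
    circles.\<close>
  define \<eta> where "\<eta> z = h z * (1 - b z)" for z
  have bC: "Cinf UNIV b" unfolding b_def by (intro Cinf_sum \<beta> open_UNIV)
  have hC: "Cinf UNIV h" unfolding h_def by (rule plateau_Cinf)
  have b1C: "Cinf UNIV (\<lambda>z. 1 - b z)" by (intro Cinf_diff Cinf_const bC open_UNIV)
  have \<eta>C: "Cinf UNIV \<eta>" unfolding \<eta>_def by (intro Cinf_mult hC b1C open_UNIV)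
  have bin: "b z = \<beta> p z" if "p \<in> Q" "z \<in> cball p \<delta>" for p z
  proof -
    have "\<beta> q z = 0" if "q \<in> Q - {p}" for q
    proof -
      have "z \<notin> cball q \<delta>" using sep(3)[of p q] that \<open>p \<in> Q\<close> \<open>z \<in> cball p \<delta>\<close> by blast
      then show ?thesis using \<beta>(5)[of z q] by (simp add: dist_norm norm_minus_commute)
    qed
    then show ?thesis unfolding b_def using fQ that(1) by (simp add: sum.remove)
  qed
  have bout: "b z = 0" if "\<And>p. p \<in> Q \<Longrightarrow> z \<notin> cball p \<delta>" for z
    unfolding b_def using that \<beta>(5)[of z] by (intro sum.neutral) (force simp: dist_norm norm_minus_commute)
  have b01: "0 \<le> b z \<and> b z \<le> 1" for z
  proof (cases "\<exists>p\<in>Q. z \<in> cball p \<delta>")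
    case True
    then show ?thesis using bin \<beta>(3) by metis
  qed (use bout in force)
  define G where "G = ball 0 R0 - (\<Union>p\<in>Q. cball p \<delta>)"
  have "open G" unfolding G_def using fQ by (intro open_Diff closed_UN) auto
  moreover have "D \<subseteq> G" unfolding G_def using R1 R0(1) sep(2) by force
  moreover have "G \<subseteq> \<Omega>"
  proof
    fix z assume z: "z \<in> G"
    then have "z \<notin> ball p (r p)" if "p \<in> Q" for p using that rsub[of p] unfolding G_def by fastforce
    then show "z \<in> \<Omega>" using z R0p unfolding G_def \<Omega>_def by auto
  qed
  moreover have "\<eta> z = 0" if "z \<in> frontier \<Omega>" for z
    using dom\<Omega>(2)[OF that]
  proof (elim disjE bexE)
    assume "cmod z = 2 * R0"
    then have "h z = 0" unfolding h_def using R0p by (intro plateau_eq_0) auto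
    then show ?thesis unfolding \<eta>_def by simp
  next
    fix p assume p: "p \<in> Q" "cmod (z - p) = r p"
    then have "z \<in> cball p \<delta>" using \<beta>(1)[of p] by (simp add: dist_norm norm_minus_commute)
    then have "b z = 1" using bin[OF p(1)] \<beta>(4)[of z p] p(2) by simp
    then show ?thesis unfolding \<eta>_def by simp
  qed
  moreover have "\<eta> z = 1" if "z \<in> G" for z
  proof -
    have "b z = 0" using that unfolding G_def by (intro bout) auto
    moreover have "h z = 1" unfolding h_def using that R0p by (intro plateau_eq_1) (auto simp: G_def)
    ultimately show ?thesis unfolding \<eta>_def by simp
  qed
  moreover have "integral \<Omega> (\<lambda>z. ((px \<eta> z)\<^sup>2 + (py \<eta> z)\<^sup>2) * w z) \<le> \<epsilon>"
  proof -
    have d: "h differentiable (at z)" "b differentiable (at z)" "(\<lambda>z. 1 - b z) differentiable (at z)"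
       "\<beta> p differentiable (at z)" for p z
      using Cinf_differentiable[OF hC] Cinf_differentiable[OF bC] Cinf_differentiable[OF b1C] Cinf_differentiable[OF \<beta>(2)] by auto
    have cont: "continuous_on \<Omega> (px f)" "continuous_on \<Omega> (py f)" if "Cinf UNIV f" for f :: "complex \<Rightarrow> real"
      by (rule continuous_on_subset[OF Cinf_continuous[OF Cinf_px[OF that]] subset_UNIV],
          rule continuous_on_subset[OF Cinf_continuous[OF Cinf_py[OF that]] subset_UNIV])
    have cw: "continuous_on \<Omega> w" by (rule continuous_on_subset[OF w(1) \<Omega>S])
    let ?H = "\<lambda>z. ((px h z)\<^sup>2 + (py h z)\<^sup>2) * w z"
    let ?B = "\<lambda>p z. (px (\<beta> p) z)\<^sup>2 + (py (\<beta> p) z)\<^sup>2"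
    have cH: "continuous_on \<Omega> ?H" by (intro continuous_intros cont hC cw)
    have cB: "continuous_on \<Omega> (?B p)" for p by (intro continuous_intros cont \<beta>)
    have grad0: "px (\<beta> p) z = 0 \<and> py (\<beta> p) z = 0" if "z \<notin> cball p \<delta>" for p z
    proof -
      have o: "open (- cball p \<delta>)" "z \<in> - cball p \<delta>" using that by auto
      have "\<beta> p y = 0" if "y \<in> - cball p \<delta>" for y
        using \<beta>(5)[of y p] that by (simp add: dist_norm norm_minus_commute)
      then have "px (\<beta> p) z = px (\<lambda>z. 0) z" "py (\<beta> p) z = py (\<lambda>z. 0) z"
        by (rule px_cong[OF o], simp, rule py_cong[OF o], simp)
      then show ?thesis by (simp add: px_def py_def)
    qed
    have pb: "(px b z)\<^sup>2 + (py b z)\<^sup>2 = (\<Sum>p\<in>Q. ?B p z)" for z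
    proof -
      have "px (\<beta> p) z * px (\<beta> q) z = 0 \<and> py (\<beta> p) z * py (\<beta> q) z = 0" if "p \<in> Q" "q \<in> Q" "p \<noteq> q" for p q
      proof (cases "z \<in> cball p \<delta>")
        case True
        then have "z \<notin> cball q \<delta>" using sep(3)[of p q] that by blast
        then show ?thesis using grad0[of z q] by simp
      qed (use grad0[of z p] in simp)
      then have "(\<Sum>p\<in>Q. px (\<beta> p) z)\<^sup>2 = (\<Sum>p\<in>Q. (px (\<beta> p) z)\<^sup>2)" "(\<Sum>p\<in>Q. py (\<beta> p) z)\<^sup>2 = (\<Sum>p\<in>Q. (py (\<beta> p) z)\<^sup>2)"
        by (auto intro!: square_sum_orthogonal fQ)
      then show ?thesis unfolding b_def px_py_sum[OF fQ d(4)] by (simp add: sum.distrib)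
    qed
    have le: "((px \<eta> z)\<^sup>2 + (py \<eta> z)\<^sup>2) * w z \<le> 2 * ?H z + 2 * C * (\<Sum>p\<in>Q. ?B p z)" if z: "z \<in> \<Omega>" for z
    proof -
      have wz: "0 \<le> w z" "w z \<le> C" using w(2) z \<Omega>S by auto
      have h01: "0 \<le> h z" "h z \<le> 1" unfolding h_def by (rule plateau_bounds)+
      have e: "px \<eta> z = px h z * (1 - b z) - h z * px b z" "py \<eta> z = py h z * (1 - b z) - h z * py b z"
        unfolding \<eta>_def px_py_mult[OF d(1,3)] px_py_diff[OF differentiable_const d(2)] by simp_all
      have sq: "(x * s - t * y)\<^sup>2 \<le> 2 * x\<^sup>2 + 2 * y\<^sup>2" if "0 \<le> s" "s \<le> 1" "0 \<le> t" "t \<le> 1" for x y s t :: real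
      proof -
        have "(x * s - t * y)\<^sup>2 \<le> 2 * (x * s)\<^sup>2 + 2 * (t * y)\<^sup>2"
          using zero_le_power2[of "x * s + t * y"] by (simp add: power2_sum power2_diff)
        moreover have "(x * s)\<^sup>2 \<le> x\<^sup>2" "(t * y)\<^sup>2 \<le> y\<^sup>2"
          using that by (simp_all add: power_mult_distrib mult_left_le mult_left_le_one_le power_le_one)
        ultimately show ?thesis by linarith
      qed
      have "(px \<eta> z)\<^sup>2 + (py \<eta> z)\<^sup>2 \<le> 2 * ((px h z)\<^sup>2 + (py h z)\<^sup>2) + 2 * ((px b z)\<^sup>2 + (py b z)\<^sup>2)"
        unfolding e using sq[of "1 - b z" "h z" "px h z" "px b z"] sq[of "1 - b z" "h z" "py h z" "py b z"] b01[of z] h01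
        by auto
      then have "((px \<eta> z)\<^sup>2 + (py \<eta> z)\<^sup>2) * w z \<le> (2 * ((px h z)\<^sup>2 + (py h z)\<^sup>2) + 2 * ((px b z)\<^sup>2 + (py b z)\<^sup>2)) * w z"
        using wz by (intro mult_right_mono) auto
      also have "\<dots> = 2 * ?H z + 2 * ((px b z)\<^sup>2 + (py b z)\<^sup>2) * w z" by (simp add: algebra_simps)
      also have "\<dots> \<le> 2 * ?H z + 2 * ((px b z)\<^sup>2 + (py b z)\<^sup>2) * C"
        using wz by (intro add_left_mono mult_left_mono) auto
      finally show ?thesis unfolding pb by (simp add: mult_ac)
    qed
    have iH: "integral \<Omega> ?H \<le> \<epsilon> / 4"
    proof -
      have "integral \<Omega> ?H \<le> (c / R0\<^sup>2 * (C / R0\<^sup>2)) * (pi * (2 * R0)\<^sup>2)"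
      proof (rule integral_le_disc[OF c\<Omega> cH, where p = 0])
        fix z assume z: "z \<in> \<Omega>"
        have wz: "0 \<le> w z" "(cmod z)\<^sup>2 * w z \<le> C" using w z \<Omega>S by auto
        show "?H z \<le> c / R0\<^sup>2 * (C / R0\<^sup>2)"
        proof (cases "cmod z \<le> R0")
          case True
          then show ?thesis unfolding h_def using plateau_gradient_0[OF R0p, of z 0] c(1) C0 by simp
        next
          case False
          have "R0\<^sup>2 * w z \<le> (cmod z)\<^sup>2 * w z" using False R0p wz by (intro mult_right_mono power_mono) auto
          then have "w z \<le> C / R0\<^sup>2" using wz R0p by (simp add: field_simps)
          then show ?thesis unfolding h_def using c(2)[OF R0p, of 0 z] wz c(1) by (intro mult_mono) auto
        qed
        show "?H z \<le> 0" if "2 * R0 < cmod (z - 0)"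
          unfolding h_def using plateau_gradient_0[OF R0p, of z 0] that by simp
      qed (use c C0 R0p in auto)
      also have "\<dots> = 4 * pi * c * C / R0\<^sup>2" using R0p by (simp add: field_simps power2_eq_square)
      also have "\<dots> \<le> \<epsilon> / 4"
      proof -
        have "16 * pi * c * C \<le> R0 * \<epsilon>" using R0(3) \<epsilon> by (simp add: field_simps)
        also have "\<dots> \<le> R0\<^sup>2 * \<epsilon>" using R0(2) \<epsilon> by (simp add: power2_eq_square)
        finally show ?thesis using R0p by (simp add: field_simps)
      qed
      finally show ?thesis .
    qed
    have iB: "integral \<Omega> (?B p) \<le> \<epsilon>'" for p by (rule \<beta>(6)[OF c\<Omega>])
    have iS: "integral \<Omega> (\<lambda>z. 2 * ?H z + 2 * C * (\<Sum>p\<in>Q. ?B p z)) = 2 * integral \<Omega> ?H + 2 * C * (\<Sum>p\<in>Q. integral \<Omega> (?B p))"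
      by (subst integral_add)
         (auto intro!: compact_integrable[OF c\<Omega>] continuous_intros cH cB cont hC cw \<beta>
           simp: integral_sum[OF fQ compact_integrable[OF c\<Omega> cB]])
    have "integral \<Omega> (\<lambda>z. ((px \<eta> z)\<^sup>2 + (py \<eta> z)\<^sup>2) * w z) \<le> integral \<Omega> (\<lambda>z. 2 * ?H z + 2 * C * (\<Sum>p\<in>Q. ?B p z))"
      by (rule integral_le) (auto intro!: compact_integrable[OF c\<Omega>] continuous_intros cH cB cont hC cw \<eta>C \<beta> le)
    also have "\<dots> \<le> 2 * (\<epsilon> / 4) + 2 * C * (\<Sum>p\<in>Q. \<epsilon>')"
      unfolding iS using C0 by (intro add_mono mult_left_mono iH sum_mono iB) auto
    also have "\<dots> \<le> \<epsilon>"
    proof -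
      have "C * (real (card Q) * \<epsilon>') \<le> (C + 1) * ((real (card Q) + 1) * \<epsilon>')"
        using C0 \<epsilon>' by (intro mult_mono) auto
      also have "\<dots> = \<epsilon> / 4"
      proof -
        have "a * (b * (\<epsilon> / (4 * a * b))) = \<epsilon> / 4" if "a \<noteq> 0" "b \<noteq> 0" for a b :: real
          using that by simp
        moreover have "C + 1 \<noteq> 0" "real (card Q) + 1 \<noteq> 0" using C0 by linarith+
        ultimately show ?thesis unfolding \<epsilon>'_def by blast
      qed
      finally show ?thesis by simp
    qed
    finally show ?thesis .
  qed
  ultimately show ?thesis using dom\<Omega>(1) \<eta>C by (intro exI[of _ \<Omega>] exI[of _ \<eta>] exI[of _ G]) blast
qed

section \<open>The second variation of area\<close>

text \<open>Reverse Cauchy-Schwarz inequality for the Lorentzian form \<open>e\<^sup>2 - h1\<^sup>2 - h2\<^sup>2\<close>, with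
  \<open>1 / sqrt (1 - s)\<close> replaced by a polynomial upper bound.\<close>

lemma area_pointwise_bound:
  fixes e h1 h2 m1 m2 s :: real
  assumes s: "s = m1\<^sup>2 + m2\<^sup>2" "s \<le> 1 / 2" and e: "0 \<le> e" "h1\<^sup>2 + h2\<^sup>2 \<le> e\<^sup>2"
  shows "sqrt (e\<^sup>2 - h1\<^sup>2 - h2\<^sup>2) \<le> (e - (m1 * h1 + m2 * h2)) * (1 + s / 2 + s\<^sup>2)"
proof -
  let ?X = "e\<^sup>2 - h1\<^sup>2 - h2\<^sup>2" and ?d = "e - (m1 * h1 + m2 * h2)" and ?k = "1 + s / 2 + s\<^sup>2"
  have s0: "0 \<le> s" using s by simp
  have cs: "(m1 * h1 + m2 * h2)\<^sup>2 \<le> s * (h1\<^sup>2 + h2\<^sup>2)"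
  proof -
    have "s * (h1\<^sup>2 + h2\<^sup>2) - (m1 * h1 + m2 * h2)\<^sup>2 = (m1 * h2 - m2 * h1)\<^sup>2"
      unfolding s(1) by (simp add: power2_eq_square algebra_simps)
    then show ?thesis by (metis diff_ge_0_iff_ge zero_le_power2)
  qed
  have d0: "0 \<le> ?d"
  proof -
    have "s * (h1\<^sup>2 + h2\<^sup>2) \<le> 1 * e\<^sup>2" using s s0 e by (intro mult_mono) auto
    then have "(m1 * h1 + m2 * h2)\<^sup>2 \<le> e\<^sup>2" using cs by simp
    then show ?thesis using e(1) abs_le_square_iff[of "m1 * h1 + m2 * h2" e] by simp
  qed
  have "(1 - s) * ?X \<le> ?d\<^sup>2"
  proof -
    \<comment> \<open>For (h1, h2) = e (m1, m2) the inequality is an equality; p and q measure the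
      deviation from that case.\<close>
    define p q where "p = h1 - e * m1" and "q = h2 - e * m2"
    have "?d\<^sup>2 - (1 - s) * ?X = (p\<^sup>2 + q\<^sup>2) - (m1 * q - m2 * p)\<^sup>2"
      unfolding s(1) p_def q_def by (simp add: power2_eq_square algebra_simps)
    moreover have "s * (p\<^sup>2 + q\<^sup>2) - (m1 * q - m2 * p)\<^sup>2 = (m1 * p + m2 * q)\<^sup>2"
      unfolding s(1) by (simp add: power2_eq_square algebra_simps)
    moreover have "s * (p\<^sup>2 + q\<^sup>2) \<le> 1 * (p\<^sup>2 + q\<^sup>2)" using s by (intro mult_right_mono) auto
    moreover note zero_le_power2[of "m1 * p + m2 * q"]
    ultimately show ?thesis by (metis (no_types, lifting) diff_ge_0_iff_ge mult_1 order_trans)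
  qed
  \<comment> \<open>The series of 1 / sqrt (1 - s) starts with 1 + s/2 + 3 s^2 / 8; the larger
    coefficient 1 of s^2 absorbs the remainder for s \<le> 1/2.\<close>
  moreover have "1 \<le> (1 - s) * ?k\<^sup>2"
  proof -
    have "(1 - s) * ?k\<^sup>2 = 1 + s * s * (5 / 4 * (1 - s) - s * s * s)"
      by (simp add: power2_eq_square field_simps)
    moreover have "s * s * s \<le> (1 / 2) * (1 / 2) * (1 / 2)" using s s0 by (intro mult_mono) auto
    then have "0 \<le> 5 / 4 * (1 - s) - s * s * s" using s by simp
    ultimately show ?thesis using s0 by simp
  qed
  moreover have X0: "0 \<le> ?X" using e by simp
  ultimately have "?X \<le> (?d * ?k)\<^sup>2"
  proof -
    assume 1: "(1 - s) * ?X \<le> ?d\<^sup>2" and 2: "1 \<le> (1 - s) * ?k\<^sup>2"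
    have "?X * 1 \<le> ?X * ((1 - s) * ?k\<^sup>2)" using 2 X0 by (intro mult_left_mono)
    also have "\<dots> = ((1 - s) * ?X) * ?k\<^sup>2" by (simp add: mult_ac)
    also have "\<dots> \<le> ?d\<^sup>2 * ?k\<^sup>2" using 1 by (intro mult_right_mono) auto
    finally show ?thesis by (simp add: power_mult_distrib)
  qed
  then have "sqrt ?X \<le> sqrt ((?d * ?k)\<^sup>2)" by (rule real_sqrt_le_mono)
  also have "\<dots> = ?d * ?k" using d0 s0 by simp
  finally show ?thesis .
qed

text \<open>Here a, b stand for F_x, F_y at one point and x, y for W_x, W_y. The pointwise bound is
  applied with t m in place of m, so the conformal structure moves at the same order as the map.
  Adding the bounds for t and - t cancels the odd powers of t and leaves c + M (a . a) / 2 as the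
  coefficient of 2 t^2. Nothing is divided by a . a, so a = b = 0 is allowed.\<close>

lemma area_second_difference_bound:
  fixes a b x y :: "'a::real_inner" and t m1 m2 :: real
  assumes conf: "a \<bullet> a = b \<bullet> b" "a \<bullet> b = 0" and t: "t\<^sup>2 * (m1\<^sup>2 + m2\<^sup>2) \<le> 1 / 2" "t\<^sup>2 \<le> 1"
  defines "S \<equiv> \<lambda>t. sqrt (((a + t *\<^sub>R x) \<bullet> (a + t *\<^sub>R x)) * ((b + t *\<^sub>R y) \<bullet> (b + t *\<^sub>R y)) - ((a + t *\<^sub>R x) \<bullet> (b + t *\<^sub>R y))\<^sup>2)"
    and "M \<equiv> m1\<^sup>2 + m2\<^sup>2"
    and "c \<equiv> (x \<bullet> x + y \<bullet> y) / 2 - (m1 * (a \<bullet> x - b \<bullet> y) + m2 * (a \<bullet> y + b \<bullet> x))"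
  shows "S t + S (- t) - 2 * (a \<bullet> a) \<le> 2 * t\<^sup>2 * (c + M * (a \<bullet> a) / 2) + t ^ 4 * (2 * (\<bar>c\<bar> * (M / 2 + M\<^sup>2) + (a \<bullet> a) * M\<^sup>2))"
proof -
  define k where "k = 1 + t\<^sup>2 * M / 2 + (t\<^sup>2 * M)\<^sup>2"
  define e1 where "e1 = a \<bullet> x + b \<bullet> y"
  define l where "l = m1 * (x \<bullet> x - y \<bullet> y) / 2 + m2 * (x \<bullet> y)"
  have bound: "S t \<le> (a \<bullet> a + t * e1 + t\<^sup>2 * c - t ^ 3 * l) * k" if t: "t\<^sup>2 * M \<le> 1 / 2" "k = 1 + t\<^sup>2 * M / 2 + (t\<^sup>2 * M)\<^sup>2" for t
  proof -
    define u v where "u = a + t *\<^sub>R x" and "v = b + t *\<^sub>R y"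
    define e h1 h2 where "e = (u \<bullet> u + v \<bullet> v) / 2" and "h1 = (u \<bullet> u - v \<bullet> v) / 2" and "h2 = u \<bullet> v"
    have "(u \<bullet> u) * (v \<bullet> v) - (u \<bullet> v)\<^sup>2 = e\<^sup>2 - h1\<^sup>2 - h2\<^sup>2"
      unfolding e_def h1_def h2_def by (simp add: power2_eq_square field_simps)
    then have St: "S t = sqrt (e\<^sup>2 - h1\<^sup>2 - h2\<^sup>2)" unfolding S_def u_def v_def by simp
    have "(u \<bullet> v)\<^sup>2 \<le> (u \<bullet> u) * (v \<bullet> v)" by (rule Cauchy_Schwarz_ineq)
    then have le: "h1\<^sup>2 + h2\<^sup>2 \<le> e\<^sup>2"
      unfolding e_def h1_def h2_def by (simp add: power2_eq_square field_simps)
    have "S t \<le> (e - (t * m1 * h1 + t * m2 * h2)) * (1 + t\<^sup>2 * M / 2 + (t\<^sup>2 * M)\<^sup>2)"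
      unfolding St
    proof (rule area_pointwise_bound)
      show "t\<^sup>2 * M = (t * m1)\<^sup>2 + (t * m2)\<^sup>2" unfolding M_def by (simp add: power_mult_distrib distrib_left)
      show "0 \<le> e" unfolding e_def by simp
    qed (use t le in auto)
    moreover have "e - (t * m1 * h1 + t * m2 * h2) = a \<bullet> a + t * e1 + t\<^sup>2 * c - t ^ 3 * l"
    proof -
      have E1: "e = a \<bullet> a + t * e1 + t\<^sup>2 * ((x \<bullet> x + y \<bullet> y) / 2)"
        unfolding e_def u_def v_def e1_def using conf
        by (simp add: inner_add_left inner_add_right inner_commute power2_eq_square field_simps)
      have E2: "h1 = t * (a \<bullet> x - b \<bullet> y) + t\<^sup>2 * ((x \<bullet> x - y \<bullet> y) / 2)"
        unfolding h1_def u_def v_def using conf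
        by (simp add: inner_add_left inner_add_right inner_commute power2_eq_square field_simps)
      have E3: "h2 = t * (a \<bullet> y + b \<bullet> x) + t\<^sup>2 * (x \<bullet> y)"
        unfolding h2_def u_def v_def using conf
        by (simp add: inner_add_left inner_add_right inner_commute power2_eq_square algebra_simps)
      show ?thesis unfolding E1 E2 E3 c_def l_def
        by (simp add: power2_eq_square power3_eq_cube field_simps)
    qed
    ultimately show ?thesis using t by simp
  qed
  have "S t + S (- t) \<le> (a \<bullet> a + t * e1 + t\<^sup>2 * c - t ^ 3 * l) * k + (a \<bullet> a + (- t) * e1 + (- t)\<^sup>2 * c - (- t) ^ 3 * l) * k"
    by (intro add_mono bound) (use t in \<open>auto simp: M_def k_def\<close>)
  also have "\<dots> = 2 * (a \<bullet> a + t\<^sup>2 * c) * k" by (simp add: algebra_simps)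
  also have "\<dots> = 2 * (a \<bullet> a) + 2 * t\<^sup>2 * (c + M * (a \<bullet> a) / 2) + t ^ 4 * (2 * (c * (M / 2 + t\<^sup>2 * M\<^sup>2) + (a \<bullet> a) * M\<^sup>2))"
    unfolding k_def by (simp add: algebra_simps power2_eq_square power4_eq_xxxx)
  also have "\<dots> \<le> 2 * (a \<bullet> a) + 2 * t\<^sup>2 * (c + M * (a \<bullet> a) / 2) + t ^ 4 * (2 * (\<bar>c\<bar> * (M / 2 + M\<^sup>2) + (a \<bullet> a) * M\<^sup>2))"
  proof -
    have M0: "0 \<le> M" unfolding M_def by simp
    have "c * (M / 2 + t\<^sup>2 * M\<^sup>2) \<le> \<bar>c\<bar> * (M / 2 + 1 * M\<^sup>2)"
      using t M0 by (intro mult_mono add_left_mono mult_right_mono) auto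
    then show ?thesis by (intro add_left_mono mult_left_mono) auto
  qed
  finally show ?thesis by simp
qed

lemma px_py_variation:
  fixes F W :: "complex \<Rightarrow> real^'n"
  assumes "F differentiable (at z)" "W differentiable (at z)"
  shows "px (\<lambda>z. F z + t *\<^sub>R W z) z = px F z + t *\<^sub>R px W z" "py (\<lambda>z. F z + t *\<^sub>R W z) z = py F z + t *\<^sub>R py W z"
proof -
  have d: "((\<lambda>z. F z + t *\<^sub>R W z) has_derivative (\<lambda>v. (Re v *\<^sub>R px F z + Im v *\<^sub>R py F z) + t *\<^sub>R (Re v *\<^sub>R px W z + Im v *\<^sub>R py W z))) (at z)"
    by (intro has_derivative_add has_derivative_scaleR_right has_derivative_px_py assms)
  show "px (\<lambda>z. F z + t *\<^sub>R W z) z = px F z + t *\<^sub>R px W z" "py (\<lambda>z. F z + t *\<^sub>R W z) z = py F z + t *\<^sub>R py W z"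
    using px_eq[OF d] py_eq[OF d] by simp_all
qed

lemma area_density_variation:
  fixes F W :: "complex \<Rightarrow> real^'n"
  assumes "Cinf S F" "Cinf S W" "z \<in> S"
  shows "area_density (\<lambda>z. F z + t *\<^sub>R W z) z =
    sqrt (((px F z + t *\<^sub>R px W z) \<bullet> (px F z + t *\<^sub>R px W z)) * ((py F z + t *\<^sub>R py W z) \<bullet> (py F z + t *\<^sub>R py W z))
      - ((px F z + t *\<^sub>R px W z) \<bullet> (py F z + t *\<^sub>R py W z))\<^sup>2)"
  unfolding area_density_def metE_def metF_def metG_def
  using px_py_variation[OF Cinf_differentiable[OF assms(1,3)] Cinf_differentiable[OF assms(2,3)]] by simp

text \<open>For every choice of m1, m2 the t^2 coefficient of the pointwise bound, once integrated,
  dominates the second derivative of the area, which is nonnegative by stability. The t^4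
  coefficient is continuous and disappears in the limit.\<close>

lemma stability_inequality:
  fixes F W :: "complex \<Rightarrow> real^'n" and m1 m2 :: "complex \<Rightarrow> real"
  assumes F: "branched_minimal_immersion S F" and stable: "stable_on S F"
    and \<Omega>: "compact_smooth_domain S \<Omega>" and W: "Cinf S W" "\<And>z. z \<in> frontier \<Omega> \<Longrightarrow> W z = 0"
    and m: "continuous_on S m1" "continuous_on S m2"
  shows "0 \<le> integral \<Omega> (\<lambda>z. (px W z \<bullet> px W z + py W z \<bullet> py W z) / 2
      - (m1 z * (px F z \<bullet> px W z - py F z \<bullet> py W z) + m2 z * (px F z \<bullet> py W z + py F z \<bullet> px W z))
      + ((m1 z)\<^sup>2 + (m2 z)\<^sup>2) * (px F z \<bullet> px F z) / 2)"
proof -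
  let ?c = "\<lambda>z. (px W z \<bullet> px W z + py W z \<bullet> py W z) / 2
      - (m1 z * (px F z \<bullet> px W z - py F z \<bullet> py W z) + m2 z * (px F z \<bullet> py W z + py F z \<bullet> px W z))"
  let ?M = "\<lambda>z. (m1 z)\<^sup>2 + (m2 z)\<^sup>2"
  let ?q = "\<lambda>z. ?c z + ?M z * (px F z \<bullet> px F z) / 2"
  let ?K = "\<lambda>z. 2 * (\<bar>?c z\<bar> * (?M z / 2 + (?M z)\<^sup>2) + (px F z \<bullet> px F z) * (?M z)\<^sup>2)"
  have cO: "compact \<Omega>" and OS: "\<Omega> \<subseteq> S" using \<Omega> unfolding compact_smooth_domain_def by auto
  have FC: "Cinf S F" using F unfolding branched_minimal_immersion_def by auto
  have conf: "px F z \<bullet> px F z = py F z \<bullet> py F z" "px F z \<bullet> py F z = 0" if "z \<in> \<Omega>" for z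
    using F OS that unfolding branched_minimal_immersion_def by auto
  have cont: "continuous_on \<Omega> (px F)" "continuous_on \<Omega> (py F)" "continuous_on \<Omega> (px W)" "continuous_on \<Omega> (py W)"
      "continuous_on \<Omega> m1" "continuous_on \<Omega> m2"
    by (rule continuous_on_subset[OF _ OS]; intro Cinf_continuous Cinf_px Cinf_py FC W m)+
  define s where "s t z = area_density (\<lambda>z. F z + t *\<^sub>R W z) z" for t z
  have s: "s t z = sqrt (((px F z + t *\<^sub>R px W z) \<bullet> (px F z + t *\<^sub>R px W z)) * ((py F z + t *\<^sub>R py W z) \<bullet> (py F z + t *\<^sub>R py W z))
      - ((px F z + t *\<^sub>R px W z) \<bullet> (py F z + t *\<^sub>R py W z))\<^sup>2)" if "z \<in> \<Omega>" for t z
    unfolding s_def by (rule area_density_variation[OF FC W(1)]) (use that OS in auto)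
  have si: "s t integrable_on \<Omega>" for t
  proof (rule compact_integrable[OF cO])
    have "continuous_on \<Omega> (\<lambda>z. sqrt (((px F z + t *\<^sub>R px W z) \<bullet> (px F z + t *\<^sub>R px W z)) * ((py F z + t *\<^sub>R py W z) \<bullet> (py F z + t *\<^sub>R py W z))
      - ((px F z + t *\<^sub>R px W z) \<bullet> (py F z + t *\<^sub>R py W z))\<^sup>2))"
      by (intro continuous_intros cont)
    then show "continuous_on \<Omega> (s t)" using s by (simp cong: continuous_on_cong)
  qed
  have s0: "s 0 z = px F z \<bullet> px F z" if "z \<in> \<Omega>" for z
    using s[OF that, of 0] conf[OF that] by (simp add: real_sqrt_mult_self)
  have qi: "?q integrable_on \<Omega>" "?K integrable_on \<Omega>"
    by (rule compact_integrable[OF cO]; auto intro!: continuous_intros cont)+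
  define a where "a t = area_on \<Omega> (\<lambda>z. F z + t *\<^sub>R W z)" for t
  have a: "a t = integral \<Omega> (s t)" for t unfolding a_def area_on_def s_def ..
  obtain a2 where a2: "has_second_deriv_at a a2 0" "a2 \<ge> 0"
    using stable \<Omega> W unfolding stable_on_def a_def by blast
  have "compact (?M ` \<Omega>)" by (intro compact_continuous_image cO continuous_intros cont)
  then obtain B where B: "\<forall>z\<in>\<Omega>. \<bar>?M z\<bar> \<le> B"
    using compact_imp_bounded[of "?M ` \<Omega>"] unfolding bounded_iff by auto
  \<comment> \<open>B' bounds |m|^2 on \<Omega>, so t^2 < 1 / (2 * B') makes the smallness condition
    on t uniform in z; B' \<ge> 1 also gives t^2 \<le> 1.\<close>
  define B' where "B' = max B 1"
  have B': "B' \<ge> 1" "\<And>z. z \<in> \<Omega> \<Longrightarrow> ?M z \<le> B'" using B unfolding B'_def by fastforce+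
  have ev: "eventually (\<lambda>t::real. (a t + a (- t) - 2 * a 0) / t\<^sup>2 \<le> 2 * integral \<Omega> ?q + t\<^sup>2 * integral \<Omega> ?K) (at 0)"
  proof -
    have "((\<lambda>t::real. t\<^sup>2) \<longlongrightarrow> 0\<^sup>2) (at 0)" by (intro tendsto_intros)
    moreover have "1 / (2 * B') > 0\<^sup>2" using B' by simp
    ultimately have "eventually (\<lambda>t::real. t\<^sup>2 < 1 / (2 * B')) (at 0)"
      by (rule order_tendstoD(2))
    moreover have "eventually (\<lambda>t::real. t \<noteq> 0) (at 0)" by (simp add: eventually_at_filter)
    ultimately show ?thesis
    proof eventually_elim
      case (elim t)
      have tB: "t\<^sup>2 * B' \<le> 1 / 2" using elim B' by (simp add: field_simps)
      have t1: "t\<^sup>2 \<le> 1" using tB B' mult_left_mono[of 1 B' "t\<^sup>2"] by simp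
      have pw: "s t z + s (- t) z - 2 * s 0 z \<le> 2 * t\<^sup>2 * ?q z + t ^ 4 * ?K z" if z: "z \<in> \<Omega>" for z
      proof -
        have "t\<^sup>2 * ?M z \<le> t\<^sup>2 * B'" using B'(2)[OF z] by (intro mult_left_mono) auto
        then have "t\<^sup>2 * ?M z \<le> 1 / 2" using tB by linarith
        from area_second_difference_bound[OF conf[OF z] this t1, of "px W z" "py W z"]
        show ?thesis unfolding s[OF z, of t] s[OF z, of "- t"] s0[OF z] by simp
      qed
      have "a t + a (- t) - 2 * a 0 = integral \<Omega> (\<lambda>z. s t z + s (- t) z - 2 * s 0 z)"
        unfolding a by (simp add: integral_diff integral_add si integrable_add integrable_on_mult_right)
      also have "\<dots> \<le> integral \<Omega> (\<lambda>z. 2 * t\<^sup>2 * ?q z + t ^ 4 * ?K z)"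
        by (intro integral_le integrable_diff integrable_add integrable_on_mult_right si qi pw)
      also have "\<dots> = 2 * t\<^sup>2 * integral \<Omega> ?q + t ^ 4 * integral \<Omega> ?K"
        unfolding integral_add[OF integrable_on_mult_right[OF qi(1)] integrable_on_mult_right[OF qi(2)]]
          integral_mult_right ..
      finally have "a t + a (- t) - 2 * a 0 \<le> t\<^sup>2 * (2 * integral \<Omega> ?q + t\<^sup>2 * integral \<Omega> ?K)"
        by (simp only: distrib_left mult_ac power4_eq_xxxx power2_eq_square)
      then show ?case using elim by (simp add: pos_divide_le_eq mult.commute)
    qed
  qed
  have "((\<lambda>t::real. 2 * integral \<Omega> ?q + t\<^sup>2 * integral \<Omega> ?K) \<longlongrightarrow> 2 * integral \<Omega> ?q + 0\<^sup>2 * integral \<Omega> ?K) (at 0)"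
    by (intro tendsto_intros)
  then have "a2 \<le> 2 * integral \<Omega> ?q + 0\<^sup>2 * integral \<Omega> ?K"
    by (intro tendsto_le[OF _ _ second_deriv_symmetric_quotient[OF a2(1)] ev]) auto
  then show ?thesis using a2(2) by simp
qed

text \<open>With \<open>u = a + i b\<close> and \<open>A + i B = u_x + i u_y\<close>, the integrand of the second variation at
  the truncated field \<open>\<eta> a\<close> is a divergence plus a term that depends on \<open>\<eta>\<close> only through its
  gradient.\<close>

lemma second_variation_divergence:
  fixes a b A B \<eta> :: "complex \<Rightarrow> real"
  assumes S: "open S" and C: "Cinf S a" "Cinf S b" "Cinf S A" "Cinf S B" "Cinf S \<eta>"
    and A: "\<And>z. z \<in> S \<Longrightarrow> A z = px a z - py b z" and B: "\<And>z. z \<in> S \<Longrightarrow> B z = py a z + px b z"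
    and G: "open G" "\<And>z. z \<in> G \<Longrightarrow> \<eta> z = 1" and N: "open N" "\<And>z. z \<in> N \<inter> S \<Longrightarrow> A z = 0 \<and> B z = 0" "S \<subseteq> G \<union> N"
    and z: "z \<in> S"
  shows "(px (\<lambda>z. \<eta> z * a z) z)\<^sup>2 / 2 + (py (\<lambda>z. \<eta> z * a z) z)\<^sup>2 / 2
      - (A z * px (\<lambda>z. \<eta> z * a z) z + B z * py (\<lambda>z. \<eta> z * a z) z) + ((A z)\<^sup>2 + (B z)\<^sup>2) / 4
    = ((px \<eta> z)\<^sup>2 + (py \<eta> z)\<^sup>2) * (a z)\<^sup>2 / 2
      + (a z * (px A z + py B z) - b z * (px B z - py A z)) / 4
      + px (\<lambda>z. (\<eta> z * \<eta> z) * (a z * px a z) / 2 - 3 / 4 * (a z * A z) + b z * B z / 4) z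
      + py (\<lambda>z. (\<eta> z * \<eta> z) * (a z * py a z) / 2 - 3 / 4 * (a z * B z) - b z * A z / 4) z"
proof -
  note d = Cinf_differentiable[OF C(1) z] Cinf_differentiable[OF C(2) z] Cinf_differentiable[OF C(3) z]
    Cinf_differentiable[OF C(4) z] Cinf_differentiable[OF C(5) z]
    Cinf_differentiable[OF Cinf_px[OF C(1)] z] Cinf_differentiable[OF Cinf_py[OF C(1)] z]
    Cinf_differentiable[OF Cinf_px[OF C(2)] z] Cinf_differentiable[OF Cinf_py[OF C(2)] z]
  have dm: "(\<lambda>z. f z * g z) differentiable (at z)" if "f differentiable (at z)" "g differentiable (at z)"
    for f g :: "complex \<Rightarrow> real" using that by (rule differentiable_mult)
  have half: "px (\<lambda>z. f z / c) z = px f z / c" "py (\<lambda>z. f z / c) z = py f z / c"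
     "px (\<lambda>z. c * f z) z = c * px f z" "py (\<lambda>z. c * f z) z = c * py f z"
     "(\<lambda>z. f z / c) differentiable (at z)" "(\<lambda>z. c * f z) differentiable (at z)"
    if "f differentiable (at z)" for f :: "complex \<Rightarrow> real" and c
    using px_py_cmult[OF that, of "1 / c"] px_py_cmult[OF that, of c] that
      differentiable_mult[OF that differentiable_const, of "1 / c"] by auto
  have px0: "px (\<lambda>z. c) z = 0" "py (\<lambda>z. c) z = 0" for c :: real by (simp_all add: px_def py_def)
  have X: "px (\<lambda>z. (\<eta> z * \<eta> z) * (a z * px a z) / 2 - 3 / 4 * (a z * A z) + b z * B z / 4) z
    = \<eta> z * px \<eta> z * a z * px a z + (\<eta> z)\<^sup>2 * ((px a z)\<^sup>2 + a z * px (px a) z) / 2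
      - 3 / 4 * (px a z * A z + a z * px A z) + (px b z * B z + b z * px B z) / 4"
    using d by (simp add: px_py_add px_py_diff px_py_mult half dm px0 power2_eq_square field_simps)
  have Y: "py (\<lambda>z. (\<eta> z * \<eta> z) * (a z * py a z) / 2 - 3 / 4 * (a z * B z) - b z * A z / 4) z
    = \<eta> z * py \<eta> z * a z * py a z + (\<eta> z)\<^sup>2 * ((py a z)\<^sup>2 + a z * py (py a) z) / 2
      - 3 / 4 * (py a z * B z + a z * py B z) - (py b z * A z + b z * py A z) / 4"
    using d by (simp add: px_py_add px_py_diff px_py_mult half dm px0 power2_eq_square field_simps)
  have W: "px (\<lambda>z. \<eta> z * a z) z = px \<eta> z * a z + \<eta> z * px a z" "py (\<lambda>z. \<eta> z * a z) z = py \<eta> z * a z + \<eta> z * py a z"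
    using px_py_mult d by auto
  have Ax: "px A z = px (px a) z - px (py b) z"
    using px_cong[OF S z, of A "\<lambda>z. px a z - py b z"] A d by (simp add: px_py_diff)
  have By: "py B z = py (py a) z + py (px b) z"
    using py_cong[OF S z, of B "\<lambda>z. py a z + px b z"] B d by (simp add: px_py_add)
  \<comment> \<open>The mixed derivatives of b cancel, so the Laplacian of a is the real part of (px
    - i py)(A + i B).\<close>
  have lap: "px A z + py B z = px (px a) z + py (py a) z"
    unfolding Ax By using py_px_eq_px_py[OF S C(2) z] by simp
  have cases: "(\<eta> z = 1 \<and> px \<eta> z = 0 \<and> py \<eta> z = 0) \<or> (A z = 0 \<and> B z = 0 \<and> px A z = 0 \<and> py B z = 0)"
  proof (cases "z \<in> G")
    case True
    have "px \<eta> z = px (\<lambda>z. 1) z" "py \<eta> z = py (\<lambda>z. 1) z"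
      by (rule px_cong[OF G(1) True], simp add: G, rule py_cong[OF G(1) True], simp add: G)
    then show ?thesis using G(2)[OF True] by (simp add: px_def py_def)
  next
    case False
    then have o: "open (N \<inter> S)" "z \<in> N \<inter> S" using z N S by auto
    have "px A z = px (\<lambda>z. 0) z" "py B z = py (\<lambda>z. 0) z"
      by (rule px_cong[OF o], simp add: N, rule py_cong[OF o], simp add: N)
    then show ?thesis using N(2)[OF o(2)] by (simp add: px_def py_def)
  qed
  have e1: "A z * (px \<eta> z * a z + \<eta> z * px a z) = A z * px a z" "B z * (py \<eta> z * a z + \<eta> z * py a z) = B z * py a z"
    and e2: "(\<eta> z)\<^sup>2 * (px (px a) z + py (py a) z) = px (px a) z + py (py a) z"
    using cases lap by auto
  have bx: "px b z = B z - py a z" "py b z = px a z - A z" using A[OF z] B[OF z] by auto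
  have e2': "(\<eta> z)\<^sup>2 * (a z * px (px a) z) + (\<eta> z)\<^sup>2 * (a z * py (py a) z) = a z * (px A z + py B z)"
  proof -
    have "(\<eta> z)\<^sup>2 * (a z * px (px a) z) + (\<eta> z)\<^sup>2 * (a z * py (py a) z) = a z * ((\<eta> z)\<^sup>2 * (px (px a) z + py (py a) z))"
      by (simp add: algebra_simps)
    then show ?thesis unfolding e2 lap .
  qed
  show ?thesis
    unfolding X Y W distrib_left[of "(\<eta> z)\<^sup>2"] e1 bx
    using e2' by (simp add: power2_eq_square field_simps)
qed


lemma Cinf_divide_real:
  fixes f :: "complex \<Rightarrow> real"
  shows "open S \<Longrightarrow> Cinf S f \<Longrightarrow> Cinf S (\<lambda>z. f z / c)"
  using Cinf_mult[of S f "\<lambda>z. 1 / c"] Cinf_const[of S "1 / c"] by simp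

text \<open>The divergence identity is summed over the coordinates of W = \<eta> Re u. The fields
  \<open>X i\<close> and \<open>Y i\<close> vanish on the frontier, so their derivatives integrate
  to 0; the bounds on u and on z u supply the weight for the cutoff.\<close>

proposition stability_pairing_nonneg:
  fixes F :: "complex \<Rightarrow> real^'n" and u g :: "'n \<Rightarrow> complex \<Rightarrow> complex" and m :: "complex \<Rightarrow> complex"
  assumes P: "P sparse_in UNIV" and F: "branched_minimal_immersion (- P) F" and stable: "stable_on (- P) F"
    and D: "compact D" "D \<subseteq> - P" and u: "\<And>i. Cinf (- P) (u i)" and m: "Cinf (- P) m"
    and m0: "\<And>z. z \<in> - P \<Longrightarrow> z \<notin> D \<Longrightarrow> m z = 0"
    and g: "\<And>i z. g i z = m z * Complex (px F z $ i) (- (py F z $ i))"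
    and eq: "\<And>i z. z \<in> - P \<Longrightarrow> px (u i) z + \<i> * py (u i) z = g i z"
    and bound: "\<And>z. z \<in> - P \<Longrightarrow> (\<Sum>i\<in>UNIV. (cmod (u i z))\<^sup>2) \<le> C"
      "\<And>z. z \<in> - P \<Longrightarrow> (cmod z)\<^sup>2 * (\<Sum>i\<in>UNIV. (cmod (u i z))\<^sup>2) \<le> C"
  shows "0 \<le> Re (integral D (\<lambda>z. \<Sum>i\<in>UNIV. u i z * (px (g i) z - \<i> * py (g i) z)))"
proof -
  have S: "open (- P)" and FC: "Cinf (- P) F"
    and conf: "\<And>z. z \<in> - P \<Longrightarrow> px F z \<bullet> px F z = py F z \<bullet> py F z"
    using F unfolding branched_minimal_immersion_def by auto
  define a b A B where "a i z = Re (u i z)" and "b i z = Im (u i z)"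
    and "A i z = Re (g i z)" and "B i z = Im (g i z)" for i z
  have Fi: "Cinf (- P) (\<lambda>z. px F z $ i)" "Cinf (- P) (\<lambda>z. py F z $ i)" for i
    by (intro Cinf_nth[OF S] Cinf_px Cinf_py FC)+
  have gC: "Cinf (- P) (g i)" for i
  proof -
    have "Cinf (- P) (\<lambda>z. m z * (of_real (px F z $ i) - \<i> * of_real (py F z $ i)))"
      by (intro Cinf_mult Cinf_diff Cinf_const Cinf_of_real Fi m S)
    moreover have "(\<lambda>z. m z * (of_real (px F z $ i) - \<i> * of_real (py F z $ i))) = g i"
      unfolding g by (auto simp: complex_eq_iff)
    ultimately show ?thesis by simp
  qed
  have aC: "Cinf (- P) (a i)" and bC: "Cinf (- P) (b i)" and AC: "Cinf (- P) (A i)" and BC: "Cinf (- P) (B i)" for i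
    unfolding a_def b_def A_def B_def by (intro Cinf_Re Cinf_Im S u gC)+
  have pa: "px (a i) z = Re (px (u i) z)" "py (a i) z = Re (py (u i) z)"
    "px (b i) z = Im (px (u i) z)" "py (b i) z = Im (py (u i) z)"
    "px (A i) z = Re (px (g i) z)" "py (A i) z = Re (py (g i) z)"
    "px (B i) z = Im (px (g i) z)" "py (B i) z = Im (py (g i) z)" if "z \<in> - P" for i z
    unfolding a_def b_def A_def B_def
    using px_py_Re[OF Cinf_differentiable[OF u that]] px_py_Im[OF Cinf_differentiable[OF u that]]
      px_py_Re[OF Cinf_differentiable[OF gC that]] px_py_Im[OF Cinf_differentiable[OF gC that]] by auto
  have Aeq: "A i z = px (a i) z - py (b i) z" and Beq: "B i z = py (a i) z + px (b i) z" if "z \<in> - P" for i z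
    unfolding pa[OF that] unfolding A_def B_def eq[OF that, symmetric] by auto
  have AB0: "A i z = 0 \<and> B i z = 0" if "z \<in> - P" "z \<notin> D" for i z
    unfolding A_def B_def g using m0[OF that] by simp
  define w where "w z = (\<Sum>i\<in>UNIV. (a i z)\<^sup>2)" for z
  have wle: "0 \<le> w z" "w z \<le> (\<Sum>i\<in>UNIV. (cmod (u i z))\<^sup>2)" for z
    unfolding w_def a_def by (auto intro!: sum_nonneg sum_mono simp: cmod_power2)
  have wc: "continuous_on (- P) w" unfolding w_def by (intro continuous_intros Cinf_continuous aC)
  define L where "L i z = px (g i) z - \<i> * py (g i) z" for i z
  define f where "f z = (\<Sum>i\<in>UNIV. u i z * L i z)" for z
  have fc: "continuous_on (- P) f" unfolding f_def L_def
    by (intro continuous_intros Cinf_continuous Cinf_px Cinf_py gC u)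
  have f0: "f z = 0" if "z \<in> - P" "z \<notin> D" for z
  proof -
    have o: "open (- P \<inter> - D)" "z \<in> - P \<inter> - D" using that S D(1) compact_imp_closed by auto
    have "px (g i) z = px (\<lambda>z. 0) z" "py (g i) z = py (\<lambda>z. 0) z" for i
      by (rule px_cong[OF o], use m0 g in simp, rule py_cong[OF o], use m0 g in simp)
    then show ?thesis unfolding f_def L_def by (simp add: px_def py_def)
  qed
  \<comment> \<open>The cutoff contributes at most \<epsilon> / 2 to the integrated inequality and
    the pairing enters with the factor 1/4; hence the 2.\<close>
  have main: "- 2 * \<epsilon> \<le> Re (integral D f)" if \<epsilon>: "\<epsilon> > 0" for \<epsilon>
  proof -
    have "\<exists>\<Omega> \<eta> G. compact_smooth_domain (- P) \<Omega> \<and> open G \<and> D \<subseteq> G \<and> G \<subseteq> \<Omega> \<and> Cinf UNIV \<eta> \<and>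
      (\<forall>z\<in>frontier \<Omega>. \<eta> z = 0) \<and> (\<forall>z\<in>G. \<eta> z = (1::real)) \<and>
      integral \<Omega> (\<lambda>z. ((px \<eta> z)\<^sup>2 + (py \<eta> z)\<^sup>2) * w z) \<le> \<epsilon>"
    proof (rule exhaustion_cutoff[OF P D wc _ _ \<epsilon>])
      show "0 \<le> w z \<and> w z \<le> C" if "z \<in> - P" for z using wle[of z] bound(1)[OF that] by linarith
      show "(cmod z)\<^sup>2 * w z \<le> C" if "z \<in> - P" for z
        using mult_left_mono[OF wle(2)[of z], of "(cmod z)\<^sup>2"] bound(2)[OF that] by simp
    qed
    then obtain \<Omega> \<eta> G where \<Omega>: "compact_smooth_domain (- P) \<Omega>" and G: "open G" "D \<subseteq> G" "G \<subseteq> \<Omega>"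
      and \<eta>: "Cinf UNIV \<eta>" "\<And>z. z \<in> frontier \<Omega> \<Longrightarrow> \<eta> z = 0" "\<And>z. z \<in> G \<Longrightarrow> \<eta> z = (1::real)"
      and small: "integral \<Omega> (\<lambda>z. ((px \<eta> z)\<^sup>2 + (py \<eta> z)\<^sup>2) * w z) \<le> \<epsilon>" by blast
    have cO: "compact \<Omega>" and OS: "\<Omega> \<subseteq> - P" using \<Omega> unfolding compact_smooth_domain_def by auto
    have \<eta>C: "Cinf (- P) \<eta>" using Cinf_subset[OF \<eta>(1)] by simp
    \<comment> \<open>D lies in the open set G and so in the interior of \<Omega>. On the frontier
      \<eta>, A and B all vanish.\<close>
    have front: "\<eta> z = 0 \<and> A i z = 0 \<and> B i z = 0" if z: "z \<in> frontier \<Omega>" for z i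
    proof -
      have "z \<in> - P" using z OS cO compact_imp_closed frontier_subset_closed by blast
      moreover have "z \<notin> D" using z G interior_maximal[OF G(3,1)] by (auto simp: frontier_def)
      ultimately show ?thesis using AB0 \<eta>(2)[OF z] by simp
    qed
    define W where "W z = (\<chi> i. \<eta> z * a i z)" for z
    have WC: "Cinf (- P) W" by (rule Cinf_vec[OF S]) (simp add: W_def Cinf_mult[OF S \<eta>C aC])
    have Wi: "px W z $ i = px (\<lambda>z. \<eta> z * a i z) z" "py W z $ i = py (\<lambda>z. \<eta> z * a i z) z" if "z \<in> - P" for z i
      using px_py_nth[OF Cinf_differentiable[OF WC that], of i] by (simp_all add: W_def)
    define X Y where "X i z = (\<eta> z * \<eta> z) * (a i z * px (a i) z) / 2 - 3 / 4 * (a i z * A i z) + b i z * B i z / 4"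
      and "Y i z = (\<eta> z * \<eta> z) * (a i z * py (a i) z) / 2 - 3 / 4 * (a i z * B i z) - b i z * A i z / 4" for i z
    have XC: "Cinf (- P) (X i)" and YC: "Cinf (- P) (Y i)" for i
      unfolding X_def Y_def by (intro Cinf_add Cinf_diff Cinf_divide_real Cinf_mult Cinf_const Cinf_px Cinf_py S \<eta>C aC bC AC BC)+
    have X0: "integral \<Omega> (px (X i)) = 0" and Y0: "integral \<Omega> (py (Y i)) = 0" for i
    proof -
      show "integral \<Omega> (px (X i)) = 0"
        by (rule integral_px_py_eq_0(1)[OF S XC cO OS]) (use front in \<open>simp add: X_def\<close>)
      show "integral \<Omega> (py (Y i)) = 0"
        by (rule integral_px_py_eq_0(2)[OF S YC cO OS]) (use front in \<open>simp add: Y_def\<close>)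
    qed
    let ?q = "\<lambda>z. (px W z \<bullet> px W z + py W z \<bullet> py W z) / 2
      - (Re (m z) * (px F z \<bullet> px W z - py F z \<bullet> py W z) + Im (m z) * (px F z \<bullet> py W z + py F z \<bullet> px W z))
      + ((Re (m z))\<^sup>2 + (Im (m z))\<^sup>2) * (px F z \<bullet> px F z) / 2"
    have q0: "0 \<le> integral \<Omega> ?q"
      by (rule stability_inequality[OF F stable \<Omega> WC])
         (use \<eta>(2) in \<open>auto simp: W_def vec_eq_iff intro!: Cinf_continuous Cinf_Re Cinf_Im S m\<close>)
    have q: "?q z = ((px \<eta> z)\<^sup>2 + (py \<eta> z)\<^sup>2) * w z / 2 + Re (f z) / 4 + (\<Sum>i\<in>UNIV. px (X i) z) + (\<Sum>i\<in>UNIV. py (Y i) z)"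
      if z: "z \<in> \<Omega>" for z
    proof -
      have zS: "z \<in> - P" using z OS by blast
      \<comment> \<open>Conformality distributes the term evenly over F_x and F_y, so that it
        becomes a quarter of the sum of |g i|^2 and the integrand splits into coordinates.\<close>
      have FF: "M * (px F z \<bullet> px F z) / 2 = M * (px F z \<bullet> px F z + py F z \<bullet> py F z) / 4" for M
        using conf[OF zS] by simp
      have "?q z = (\<Sum>i\<in>UNIV. (px W z $ i)\<^sup>2 / 2 + (py W z $ i)\<^sup>2 / 2
          - (A i z * px W z $ i + B i z * py W z $ i) + ((A i z)\<^sup>2 + (B i z)\<^sup>2) / 4)"
        unfolding FF unfolding A_def B_def g inner_vec_def
        by (simp add: sum.distrib sum_subtractf sum_distrib_left sum_divide_distrib power2_eq_square algebra_simps add_divide_distrib diff_divide_distrib)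
      also have "\<dots> = (\<Sum>i\<in>UNIV. ((px \<eta> z)\<^sup>2 + (py \<eta> z)\<^sup>2) * (a i z)\<^sup>2 / 2
        + (a i z * (px (A i) z + py (B i) z) - b i z * (px (B i) z - py (A i) z)) / 4 + px (X i) z + py (Y i) z)"
      proof (rule sum.cong[OF refl])
        fix i
        show "(px W z $ i)\<^sup>2 / 2 + (py W z $ i)\<^sup>2 / 2
          - (A i z * px W z $ i + B i z * py W z $ i) + ((A i z)\<^sup>2 + (B i z)\<^sup>2) / 4
          = ((px \<eta> z)\<^sup>2 + (py \<eta> z)\<^sup>2) * (a i z)\<^sup>2 / 2
            + (a i z * (px (A i) z + py (B i) z) - b i z * (px (B i) z - py (A i) z)) / 4 + px (X i) z + py (Y i) z"
          unfolding Wi[OF zS] X_def Y_def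
          by (rule second_variation_divergence[OF S aC bC AC BC \<eta>C Aeq Beq G(1) \<eta>(3), of "- D"])
             (use AB0 zS G compact_imp_closed[OF D(1)] in auto)
      qed
      also have "\<dots> = ((px \<eta> z)\<^sup>2 + (py \<eta> z)\<^sup>2) * w z / 2 + Re (f z) / 4 + (\<Sum>i\<in>UNIV. px (X i) z) + (\<Sum>i\<in>UNIV. py (Y i) z)"
        unfolding f_def L_def w_def pa[OF zS] a_def b_def
        by (simp add: sum.distrib sum_subtractf sum_negf sum_distrib_left sum_divide_distrib algebra_simps add_divide_distrib diff_divide_distrib)
      finally show ?thesis .
    qed
    have c: "continuous_on \<Omega> h" if "continuous_on (- P) h" for h :: "complex \<Rightarrow> real"
      by (rule continuous_on_subset[OF that OS])
    let ?h1 = "\<lambda>z. ((px \<eta> z)\<^sup>2 + (py \<eta> z)\<^sup>2) * w z / 2" and ?h2 = "\<lambda>z. Re (f z) / 4"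
    have i1: "?h1 integrable_on \<Omega>" "?h2 integrable_on \<Omega>" "px (X i) integrable_on \<Omega>" "py (Y i) integrable_on \<Omega>" for i
      by (rule compact_integrable[OF cO c]; intro continuous_intros Cinf_continuous Cinf_px Cinf_py XC YC \<eta>C wc fc; simp)+
    have "integral \<Omega> ?q = integral \<Omega> (\<lambda>z. ?h1 z + ?h2 z + (\<Sum>i\<in>UNIV. px (X i) z) + (\<Sum>i\<in>UNIV. py (Y i) z))"
      by (rule integral_cong) (rule q)
    also have "\<dots> = integral \<Omega> ?h1 + integral \<Omega> ?h2"
      by (simp add: integral_add i1 integrable_add integrable_sum integral_sum X0 Y0)
    also have "\<dots> = integral \<Omega> (\<lambda>z. ((px \<eta> z)\<^sup>2 + (py \<eta> z)\<^sup>2) * w z) / 2 + integral \<Omega> (\<lambda>z. Re (f z)) / 4"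
      by simp
    finally have "0 \<le> 2 * \<epsilon> + integral \<Omega> (\<lambda>z. Re (f z))" using q0 small by simp
    also have "integral \<Omega> (\<lambda>z. Re (f z)) = integral D (\<lambda>z. Re (f z))"
    proof -
      have "integral \<Omega> (\<lambda>z. Re (f z)) = integral \<Omega> (\<lambda>z. if z \<in> D then Re (f z) else 0)"
        by (rule integral_cong) (use f0 OS in auto)
      also have "\<dots> = integral (\<Omega> \<inter> D) (\<lambda>z. Re (f z))" by (simp add: integral_restrict_Int Int_commute)
      also have "\<Omega> \<inter> D = D" using G by blast
      finally show ?thesis .
    qed
    also have "\<dots> = Re (integral D f)"
      using integral_linear[OF compact_integrable[OF D(1) continuous_on_subset[OF fc D(2)]] bounded_linear_Re]
      by (simp add: o_def)
    finally show ?thesis by simp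
  qed
  have "0 \<le> Re (integral D f)"
  proof (rule ccontr)
    assume "\<not> 0 \<le> Re (integral D f)"
    then show False using main[of "- Re (integral D f) / 4"] by simp
  qed
  then show ?thesis unfolding f_def L_def .
qed

section \<open>Test fields and isotropy of the Gauss map\<close>

lemma integral_px_py_eq_0_complex:
  fixes h :: "complex \<Rightarrow> complex"
  assumes S: "open S" and h: "Cinf S h" and \<Omega>: "compact \<Omega>" "\<Omega> \<subseteq> S" and zero: "\<And>z. z \<in> frontier \<Omega> \<Longrightarrow> h z = 0"
  shows "integral \<Omega> (px h) = 0" "integral \<Omega> (py h) = 0"
proof -
  have RI: "Cinf S (\<lambda>z. Re (h z))" "Cinf S (\<lambda>z. Im (h z))" by (intro Cinf_Re Cinf_Im S h)+
  have i: "px h integrable_on \<Omega>" "py h integrable_on \<Omega>"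
    by (rule compact_integrable[OF \<Omega>(1) continuous_on_subset[OF _ \<Omega>(2)]]; intro Cinf_continuous Cinf_px Cinf_py h)+
  have e: "Re (px h z) = px (\<lambda>z. Re (h z)) z" "Im (px h z) = px (\<lambda>z. Im (h z)) z"
    "Re (py h z) = py (\<lambda>z. Re (h z)) z" "Im (py h z) = py (\<lambda>z. Im (h z)) z" if "z \<in> \<Omega>" for z
    using px_py_Re[OF Cinf_differentiable[OF h]] px_py_Im[OF Cinf_differentiable[OF h]] that \<Omega> by auto
  have RR: "Re (integral \<Omega> k) = integral \<Omega> (\<lambda>z. Re (k z))" "Im (integral \<Omega> k) = integral \<Omega> (\<lambda>z. Im (k z))"
    if "k integrable_on \<Omega>" for k
    using integral_linear[OF that bounded_linear_Re] integral_linear[OF that bounded_linear_Im] by (simp_all add: o_def)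
  show "integral \<Omega> (px h) = 0"
    using integral_px_py_eq_0(1)[OF S RI(1) \<Omega>] integral_px_py_eq_0(1)[OF S RI(2) \<Omega>] zero
    by (simp add: complex_eq_iff RR i e cong: integral_cong)
  show "integral \<Omega> (py h) = 0"
    using integral_px_py_eq_0(2)[OF S RI(1) \<Omega>] integral_px_py_eq_0(2)[OF S RI(2) \<Omega>] zero
    by (simp add: complex_eq_iff RR i e cong: integral_cong)
qed

lemma holomorphic_if_Cauchy_Riemann:
  assumes S: "open S" and d: "\<And>z. z \<in> S \<Longrightarrow> f differentiable (at z)" and cr: "\<And>z. z \<in> S \<Longrightarrow> py f z = \<i> * px f z"
  shows "f holomorphic_on S"
proof -
  have "f field_differentiable (at z)" if "z \<in> S" for z
  proof -
    have "(f has_derivative (\<lambda>v. Re v *\<^sub>R px f z + Im v *\<^sub>R py f z)) (at z)"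
      by (rule has_derivative_px_py[OF d[OF that]])
    moreover have "(\<lambda>v. Re v *\<^sub>R px f z + Im v *\<^sub>R py f z) = (\<lambda>v. px f z * v)"
      unfolding cr[OF that] by (auto simp: complex_eq_iff algebra_simps)
    ultimately show ?thesis unfolding field_differentiable_def has_field_derivative_def by auto
  qed
  then show ?thesis using S by (simp add: holomorphic_on_open field_differentiable_def)
qed

text \<open>The coordinates of \<Phi>, that is, twice the Wirtinger derivative of F with respect to
  z.\<close>

definition gauss_map :: "(complex \<Rightarrow> real^'n) \<Rightarrow> 'n \<Rightarrow> complex \<Rightarrow> complex" where
  "gauss_map F i z = Complex (px F z $ i) (- (py F z $ i))"

text \<open>One Cauchy-Riemann equation is the harmonicity of F, the other the symmetry of its mixed
  derivatives.\<close>

lemma gauss_map_holomorphic: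
  fixes F :: "complex \<Rightarrow> real^'n"
  assumes "branched_minimal_immersion S F"
  shows "gauss_map F i holomorphic_on S"
proof -
  have S: "open S" and FC: "Cinf S F" and harm: "\<And>z. z \<in> S \<Longrightarrow> px (px F) z + py (py F) z = 0"
    using assms unfolding branched_minimal_immersion_def by auto
  have fi: "Cinf S (\<lambda>z. F z $ i)" by (rule Cinf_nth[OF S FC])
  have pF: "px F z $ i = px (\<lambda>z. F z $ i) z" "py F z $ i = py (\<lambda>z. F z $ i) z" if "z \<in> S" for z
    using px_py_nth[OF Cinf_differentiable[OF FC that], of i] by auto
  let ?x = "px (\<lambda>z. F z $ i)" and ?y = "py (\<lambda>z. F z $ i)"
  have xC: "Cinf S ?x" and yC: "Cinf S ?y" by (intro Cinf_px Cinf_py fi)+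
  have gm: "gauss_map F i z = of_real (?x z) - \<i> * of_real (?y z)" if "z \<in> S" for z
    unfolding gauss_map_def pF[OF that] by (simp add: complex_eq_iff)
  have d: "((\<lambda>z. of_real (?x z) - \<i> * of_real (?y z)) has_derivative
     (\<lambda>v. of_real (Re v *\<^sub>R px ?x z + Im v *\<^sub>R py ?x z) - \<i> * of_real (Re v *\<^sub>R px ?y z + Im v *\<^sub>R py ?y z))) (at z)"
    if "z \<in> S" for z
    by (intro has_derivative_diff has_derivative_mult_right has_derivative_of_real has_derivative_px_py
        Cinf_differentiable[OF xC that] Cinf_differentiable[OF yC that])
  have hol: "(\<lambda>z. of_real (?x z) - \<i> * of_real (?y z)) holomorphic_on S"
  proof (rule holomorphic_if_Cauchy_Riemann[OF S])
    fix z assume z: "z \<in> S"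
    show "(\<lambda>z. of_real (?x z) - \<i> * of_real (?y z) :: complex) differentiable at z"
      using d[OF z] by (rule differentiableI)
    have "px ?x z + py ?y z = 0"
    proof -
      have "px ?x z = px (px F) z $ i"
        using px_cong[OF S z, of ?x "\<lambda>z. px F z $ i"] pF px_py_nth(1)[OF Cinf_differentiable[OF Cinf_px[OF FC] z], of i] by simp
      moreover have "py ?y z = py (py F) z $ i"
        using py_cong[OF S z, of ?y "\<lambda>z. py F z $ i"] pF px_py_nth(2)[OF Cinf_differentiable[OF Cinf_py[OF FC] z], of i] by simp
      ultimately show ?thesis using harm[OF z] by (metis vector_add_component zero_index)
    qed
    moreover have "py ?x z = px ?y z" by (rule py_px_eq_px_py[OF S fi z])
    ultimately show "py (\<lambda>z. of_real (?x z) - \<i> * of_real (?y z) :: complex) z = \<i> * px (\<lambda>z. of_real (?x z) - \<i> * of_real (?y z)) z"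
      unfolding px_eq[OF d[OF z]] py_eq[OF d[OF z]] by (simp add: complex_eq_iff)
  qed
  then show ?thesis by (rule holomorphic_transform) (simp add: gm)
qed

text \<open>The radial factor of the gradient of \<open>plateau\<close>: (px + i py) applied to the
  plateau is this function times z - p. The factor z - p later cancels the pole of the test
  field.\<close>

definition bump :: "complex \<Rightarrow> real \<Rightarrow> complex \<Rightarrow> real" where
  "bump p r z = step' (((cmod (z - p))\<^sup>2 / r\<^sup>2 - 1) / 3) * (2 / (3 * r\<^sup>2))"

lemma bump_Cinf: "Cinf UNIV (bump p r)"
proof -
  have "Cinf UNIV (\<lambda>z. ((cmod (z - p))\<^sup>2 * (1 / r\<^sup>2) - 1) * (1 / 3))"
    by (intro Cinf_mult Cinf_diff Cinf_const Cinf_norm_sq open_UNIV)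
  from Cinf_mult[OF open_UNIV Cinf_step(2)[OF open_UNIV this] Cinf_const[of UNIV "2 / (3 * r\<^sup>2)"]]
  show ?thesis unfolding bump_def by simp
qed

lemma bump_eq_0: "r > 0 \<Longrightarrow> cmod (z - p) \<le> r \<or> 2 * r \<le> cmod (z - p) \<Longrightarrow> bump p r z = 0"
proof -
  assume r: "r > 0" and "cmod (z - p) \<le> r \<or> 2 * r \<le> cmod (z - p)"
  then have "((cmod (z - p))\<^sup>2 / r\<^sup>2 - 1) / 3 \<le> 0 \<or> 1 \<le> ((cmod (z - p))\<^sup>2 / r\<^sup>2 - 1) / 3"
    using far_ratio[of r z p] by (auto simp: power_mono)
  then have "step' (((cmod (z - p))\<^sup>2 / r\<^sup>2 - 1) / 3) = 0" by (rule step'_eq_0)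
  then show ?thesis unfolding bump_def by simp
qed

lemma plateau_dbar: "of_real (px (plateau p r) z) + \<i> * of_real (py (plateau p r) z) = of_real (bump p r z) * (z - p)"
  unfolding plateau_px_py bump_def by (simp add: complex_eq_iff algebra_simps)

text \<open>The bump is nonpositive and strictly negative at distance 3 r / 2, where the argument of
  \<open>step'\<close> is (9/4 - 1) / 3 = 5/12. The disc is replaced by a box in order to conclude
  that a continuous function of one sign with integral 0 vanishes.\<close>

lemma bump_integral_neg:
  assumes r: "r > 0"
  shows "integral (cball p (2 * r)) (bump p r) < 0"
proof -
  define a b where "a = p - Complex (2 * r) (2 * r)" and "b = p + Complex (2 * r) (2 * r)"
  have cb: "z \<in> cbox a b \<longleftrightarrow> \<bar>Re (z - p)\<bar> \<le> 2 * r \<and> \<bar>Im (z - p)\<bar> \<le> 2 * r" for z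
    unfolding a_def b_def by (auto simp: in_cbox_complex_iff abs_le_iff)
  have sub: "cball p (2 * r) \<subseteq> cbox a b"
  proof
    fix z assume "z \<in> cball p (2 * r)"
    then have "cmod (z - p) \<le> 2 * r" by (simp add: dist_norm norm_minus_commute)
    then show "z \<in> cbox a b" unfolding cb using abs_Re_le_cmod[of "z - p"] abs_Im_le_cmod[of "z - p"] by linarith
  qed
  have c: "continuous_on X (bump p r)" for X
    using continuous_on_subset[OF Cinf_continuous[OF bump_Cinf] subset_UNIV] .
  have "integral (cball p (2 * r)) (bump p r) = integral (cbox a b) (\<lambda>z. if z \<in> cball p (2 * r) then bump p r z else 0)"
    using sub by (simp only: integral_restrict_Int inf.absorb2 inf.absorb1)
  also have "\<dots> = integral (cbox a b) (bump p r)"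
    by (rule integral_cong) (use bump_eq_0[OF r] in \<open>auto simp: dist_norm norm_minus_commute\<close>)
  finally have eq: "integral (cball p (2 * r)) (bump p r) = integral (cbox a b) (bump p r)" .
  have neg: "bump p r z \<le> 0" for z
    unfolding bump_def using step'_nonpos r by (intro mult_nonpos_nonneg) auto
  have i: "bump p r integrable_on cbox a b" by (rule integrable_continuous[OF c])
  have le: "integral (cbox a b) (bump p r) \<le> 0" using integral_le[OF i integrable_0] neg by simp
  moreover have "integral (cbox a b) (bump p r) \<noteq> 0"
  proof
    assume "integral (cbox a b) (bump p r) = 0"
    then have "((\<lambda>z. - bump p r z) has_integral 0) (cbox a b)"
      using has_integral_neg[OF integrable_integral[OF i]] by simp
    moreover have "continuous_on (cbox a b) (\<lambda>z. - bump p r z)" by (intro continuous_intros c)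
    moreover have "0 \<le> - bump p r z" for z using neg by simp
    moreover have "p \<in> box a b" unfolding a_def b_def using r by (auto simp: in_box_complex_iff)
    moreover have "p + of_real (3 / 2 * r) \<in> cbox a b" unfolding cb using r by simp
    ultimately have "- bump p r (p + of_real (3 / 2 * r)) = 0"
      using has_integral_0_cbox_imp_0[of a b "\<lambda>z. - bump p r z" "p + of_real (3 / 2 * r)"] by blast
    moreover have "((cmod (p + of_real (3 / 2 * r) - p))\<^sup>2 / r\<^sup>2 - 1) / 3 = 5 / 12"
      using r by (simp add: power2_eq_square field_simps)
    moreover have "step' (5 / 12) < 0" by (rule step'_neg) auto
    ultimately show False unfolding bump_def using r by (metis less_irrefl mult_eq_0_iff neg_equal_0_iff_equal
        divide_eq_0_iff zero_neq_numeral zero_eq_power2)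
  qed
  ultimately show ?thesis unfolding eq by simp
qed


text \<open>The solution of \<open>u_x + i u_y = bump p r * f\<close> that equals \<open>- f p / (z - p)\<close> outside
  the disc of radius \<open>2 * r\<close>.\<close>

definition pole_field :: "complex \<Rightarrow> real \<Rightarrow> (complex \<Rightarrow> complex) \<Rightarrow> complex \<Rightarrow> complex" where
  "pole_field p r f z = (if z = p then deriv f p else (of_real (plateau p r z) * f z - f p) / (z - p))"

lemma pole_field_near:
  assumes "r > 0" "z \<in> ball p r"
  shows "pole_field p r f z = (if z = p then deriv f p else (f z - f p) / (z - p))"
  using assms plateau_eq_1[of r z p] unfolding pole_field_def by (simp add: dist_norm norm_minus_commute)

lemma pole_field_far:
  assumes "r > 0" "2 * r \<le> cmod (z - p)"
  shows "pole_field p r f z = - f p / (z - p)"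
  using assms plateau_eq_0[of r z p] unfolding pole_field_def by auto

text \<open>Near p the plateau is 1 and the field is the difference quotient of f, whose singularity
  is removable; away from p it is a smooth function divided by z - p.\<close>

lemma pole_field_Cinf:
  assumes S: "open S" and f: "f holomorphic_on S" and r: "r > 0"
  shows "Cinf S (pole_field p r f)"
proof -
  have "(\<lambda>z. if z = p then deriv f p else (f z - f p) / (z - p)) holomorphic_on S"
    by (rule pole_lemma_open[OF f S])
  then have "(\<lambda>z. if z = p then deriv f p else (f z - f p) / (z - p)) holomorphic_on S \<inter> ball p r"
    by (rule holomorphic_on_subset) auto
  then have "Cinf (S \<inter> ball p r) (\<lambda>z. if z = p then deriv f p else (f z - f p) / (z - p))"
    by (intro Cinf_holomorphic open_Int S open_ball)
  then have 1: "Cinf (S \<inter> ball p r) (pole_field p r f)"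
    by (rule Cinf_cong[rotated 2]) (use S pole_field_near[OF r] in auto)
  have o: "open (S - {p})" using S by (rule open_delete)
  have c: "Cinf (S - {p}) (\<lambda>z. (of_real (plateau p r z) * f z - f p) * (1 / (z - p)))"
    by (intro Cinf_mult Cinf_diff Cinf_of_real Cinf_const o Cinf_subset[OF plateau_Cinf]
        Cinf_holomorphic holomorphic_intros holomorphic_on_subset[OF f]) auto
  have 2: "Cinf (S - {p}) (pole_field p r f)"
    by (rule Cinf_cong[OF o _ c]) (auto simp: pole_field_def)
  have "S = (S \<inter> ball p r) \<union> (S - {p})" using r by auto
  then show ?thesis using Cinf_Un[OF open_Int[OF S open_ball] o 1 2] by simp
qed

lemma holomorphic_dbar_0: "f field_differentiable (at z) \<Longrightarrow> px f z + \<i> * py f z = 0"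
  by (simp add: px_holomorphic py_holomorphic)

text \<open>Off p the field is the plateau times f / (z - p) plus the holomorphic function - f p /
  (z - p), so px + i py differentiates the plateau alone.\<close>

lemma pole_field_dbar:
  assumes S: "open S" and f: "f holomorphic_on S" and r: "r > 0" and z: "z \<in> S"
  shows "px (pole_field p r f) z + \<i> * py (pole_field p r f) z = of_real (bump p r z) * f z"
proof (cases "z = p")
  case True
  let ?h = "\<lambda>z. if z = p then deriv f p else (f z - f p) / (z - p)"
  have "?h holomorphic_on S" by (rule pole_lemma_open[OF f S])
  then have "?h field_differentiable (at z)" using holomorphic_on_imp_differentiable_at S z by blast
  from holomorphic_dbar_0[OF this] have "px ?h z + \<i> * py ?h z = 0" .
  moreover have "px (pole_field p r f) z = px ?h z" "py (pole_field p r f) z = py ?h z"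
    using True r by (intro px_cong[of "ball p r"] py_cong[of "ball p r"] pole_field_near; simp)+
  moreover have "bump p r z = 0" using bump_eq_0[OF r] True r by simp
  ultimately show ?thesis by simp
next
  case False
  define h where "h z = f z / (z - p)" for z
  define k where "k z = - f p / (z - p)" for z
  have o: "open (S - {p})" "z \<in> S - {p}" using S z False by auto
  have hh: "h holomorphic_on S - {p}" and kh: "k holomorphic_on S - {p}"
    unfolding h_def k_def by (intro holomorphic_intros holomorphic_on_subset[OF f]; auto)+
  have hd: "h field_differentiable (at z)" and kd: "k field_differentiable (at z)"
    using holomorphic_on_imp_differentiable_at[OF hh o] holomorphic_on_imp_differentiable_at[OF kh o] by auto
  note hd' = field_differentiable_imp_differentiable[OF hd] and kd' = field_differentiable_imp_differentiable[OF kd]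
  have pd: "plateau p r differentiable (at z)" using Cinf_differentiable[OF plateau_Cinf] by simp
  have cd: "(\<lambda>z. complex_of_real (plateau p r z)) differentiable (at z)"
    by (rule Cinf_differentiable[OF Cinf_of_real[OF open_UNIV plateau_Cinf] UNIV_I])
  have md: "(\<lambda>z. complex_of_real (plateau p r z) * h z) differentiable (at z)" by (rule differentiable_mult[OF cd hd'])
  have e: "pole_field p r f w = of_real (plateau p r w) * h w + k w" if "w \<in> S - {p}" for w
    using that unfolding pole_field_def h_def k_def by (simp add: diff_divide_distrib)
  have pc: "px (\<lambda>z. complex_of_real (plateau p r z)) z = of_real (px (plateau p r) z)"
    "py (\<lambda>z. complex_of_real (plateau p r z)) z = of_real (py (plateau p r) z)"
    using px_py_linear[OF bounded_linear_of_real pd] by auto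
  have pp: "px (pole_field p r f) z = px (\<lambda>w. of_real (plateau p r w) * h w + k w) z"
    "py (pole_field p r f) z = py (\<lambda>w. of_real (plateau p r w) * h w + k w) z"
    by (rule px_cong[OF o e], assumption, rule py_cong[OF o e], assumption)
  have "px (pole_field p r f) z + \<i> * py (pole_field p r f) z
     = (of_real (px (plateau p r) z) + \<i> * of_real (py (plateau p r) z)) * h z
       + of_real (plateau p r z) * (px h z + \<i> * py h z) + (px k z + \<i> * py k z)"
    unfolding pp px_py_add[OF md kd'] px_py_mult[OF cd hd'] pc by (simp add: algebra_simps)
  also have "\<dots> = of_real (bump p r z) * (z - p) * h z"
    unfolding plateau_dbar holomorphic_dbar_0[OF hd] holomorphic_dbar_0[OF kd] by simp
  finally show ?thesis using False unfolding h_def by simp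
qed

text \<open>On the closed disc the field is bounded by compactness; elsewhere it is - f p / (z - p),
  which is controlled by f p and r up to the boundary of S and up to infinity. C is the sum of the
  bounds from the two regions.\<close>

lemma pole_field_bounded:
  assumes S: "open S" and f: "f holomorphic_on S" and r: "r > 0" and p: "cball p (2 * r) \<subseteq> S"
  shows "\<exists>C. \<forall>z\<in>S. cmod (pole_field p r f z) \<le> C \<and> cmod z * cmod (pole_field p r f z) \<le> C"
proof -
  let ?u = "pole_field p r f"
  have "continuous_on (cball p (2 * r)) ?u"
    by (rule continuous_on_subset[OF Cinf_continuous[OF pole_field_Cinf[OF S f r]] p])
  then have "compact (?u ` cball p (2 * r))" by (intro compact_continuous_image) auto
  then obtain A where A: "\<forall>z\<in>cball p (2 * r). cmod (?u z) \<le> A"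
    using compact_imp_bounded[of "?u ` cball p (2 * r)"] unfolding bounded_iff by auto
  define N where "N = cmod (f p)"
  define B where "B = N / (2 * r)"
  have B: "0 \<le> B" "0 \<le> N" unfolding B_def N_def using r by auto
  define C where "C = (1 + cmod p + 2 * r) * \<bar>A\<bar> + B + N + cmod p * B"
  have "cmod (?u z) \<le> C \<and> cmod z * cmod (?u z) \<le> C" for z
  proof (cases "z \<in> cball p (2 * r)")
    case True
    then have uA: "cmod (?u z) \<le> \<bar>A\<bar>" using A by force
    have "cmod z \<le> cmod p + cmod (z - p)" by (metis add.commute diff_add_cancel norm_triangle_ineq)
    then have "cmod z \<le> cmod p + 2 * r" using True by (simp add: dist_norm norm_minus_commute)
    then have "cmod z * cmod (?u z) \<le> (cmod p + 2 * r) * \<bar>A\<bar>" using uA r by (intro mult_mono) auto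
    moreover have "0 \<le> (cmod p + 2 * r) * \<bar>A\<bar>" "0 \<le> cmod p * B" using r B by auto
    ultimately show ?thesis using uA B unfolding C_def distrib_right by (intro conjI) linarith+
  next
    case False
    then have far: "2 * r \<le> cmod (z - p)" by (simp add: dist_norm norm_minus_commute)
    have pos: "0 < cmod (z - p)" using far r by linarith
    have u: "cmod (?u z) = N / cmod (z - p)" unfolding pole_field_far[OF r far] N_def by (simp add: norm_divide)
    have uB: "cmod (?u z) \<le> B" unfolding u B_def using far r B pos by (intro divide_left_mono) auto
    have "cmod z \<le> cmod (z - p) + cmod p" by (metis diff_add_cancel norm_triangle_ineq)
    then have "cmod z * cmod (?u z) \<le> (cmod (z - p) + cmod p) * cmod (?u z)" by (intro mult_right_mono) auto
    also have "\<dots> = N + cmod p * cmod (?u z)" unfolding u using pos by (simp add: field_simps)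
    also have "\<dots> \<le> N + cmod p * B" using uB by (intro add_left_mono mult_left_mono) auto
    finally have "cmod z * cmod (?u z) \<le> N + cmod p * B" .
    moreover have "0 \<le> (1 + cmod p + 2 * r) * \<bar>A\<bar>" "0 \<le> cmod p * B" using r B by auto
    ultimately show ?thesis using uB B unfolding C_def by (intro conjI) linarith+
  qed
  then show ?thesis by blast
qed

text \<open>The mean value property for a radial weight, obtained from the divergence theorem: with
  Q the difference quotient of f at p, bump * (f - f p) is (px + i py) of plateau * Q, which
  vanishes on the boundary circle.\<close>

lemma bump_mean_value:
  assumes S: "open S" and f: "f holomorphic_on S" and r: "r > 0" and p: "cball p (2 * r) \<subseteq> S"
  shows "integral (cball p (2 * r)) (\<lambda>z. of_real (bump p r z) * f z) = f p * of_real (integral (cball p (2 * r)) (bump p r))"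
proof -
  let ?K = "cball p (2 * r)"
  define Q where "Q z = (if z = p then deriv f p else (f z - f p) / (z - p))" for z
  have Q: "Q holomorphic_on S" unfolding Q_def by (rule pole_lemma_open[OF f S])
  define h where "h z = of_real (plateau p r z) * Q z" for z
  have hC: "Cinf S h" unfolding h_def
    by (intro Cinf_mult Cinf_of_real S Cinf_subset[OF plateau_Cinf] Cinf_holomorphic Q) auto
  have h0: "h z = 0" if "z \<in> frontier ?K" for z
  proof -
    have "cmod (z - p) = 2 * r" using that r by (simp add: dist_norm norm_minus_commute)
    then show ?thesis unfolding h_def using plateau_eq_0[OF r, of z p] by simp
  qed
  have db: "px h z + \<i> * py h z = of_real (bump p r z) * f z - f p * of_real (bump p r z)" if z: "z \<in> ?K" for z
  proof -
    have zS: "z \<in> S" using z p by blast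
    have Qd: "Q field_differentiable (at z)" using holomorphic_on_imp_differentiable_at[OF Q S zS] .
    note Qd' = field_differentiable_imp_differentiable[OF Qd]
    have pd: "plateau p r differentiable (at z)" using Cinf_differentiable[OF plateau_Cinf] by simp
    have cd: "(\<lambda>z. complex_of_real (plateau p r z)) differentiable (at z)"
      by (rule Cinf_differentiable[OF Cinf_of_real[OF open_UNIV plateau_Cinf] UNIV_I])
    have pc: "px (\<lambda>z. complex_of_real (plateau p r z)) z = of_real (px (plateau p r) z)"
      "py (\<lambda>z. complex_of_real (plateau p r z)) z = of_real (py (plateau p r) z)"
      using px_py_linear[OF bounded_linear_of_real pd] by auto
    have "px h z + \<i> * py h z = (of_real (px (plateau p r) z) + \<i> * of_real (py (plateau p r) z)) * Q z
       + of_real (plateau p r z) * (px Q z + \<i> * py Q z)"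
      unfolding h_def px_py_mult[OF cd Qd'] pc by (simp add: algebra_simps)
    also have "\<dots> = of_real (bump p r z) * ((z - p) * Q z)"
      unfolding plateau_dbar holomorphic_dbar_0[OF Qd] by simp
    also have "(z - p) * Q z = f z - f p" unfolding Q_def by simp
    finally show ?thesis by (simp add: algebra_simps)
  qed
  have c: "continuous_on ?K (bump p r)" "continuous_on ?K f"
    using continuous_on_subset[OF Cinf_continuous[OF bump_Cinf] subset_UNIV]
      continuous_on_subset[OF holomorphic_on_imp_continuous_on[OF f] p] by auto
  have i: "(\<lambda>z. of_real (bump p r z) * f z) integrable_on ?K" "(\<lambda>z. f p * of_real (bump p r z)) integrable_on ?K"
    by (rule compact_integrable; auto intro!: continuous_intros c)+
  have ih: "px h integrable_on ?K" "py h integrable_on ?K"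
    by (rule compact_integrable[OF compact_cball continuous_on_subset[OF _ p]]; intro Cinf_continuous Cinf_px Cinf_py hC)+
  have "integral ?K (\<lambda>z. px h z + \<i> * py h z) = integral ?K (px h) + \<i> * integral ?K (py h)"
    using ih by (simp add: integral_add integrable_on_mult_right)
  also have "\<dots> = 0" using integral_px_py_eq_0_complex[OF S hC compact_cball p h0] by simp
  finally have "integral ?K (\<lambda>z. px h z + \<i> * py h z) = 0" .
  then have "integral ?K (\<lambda>z. of_real (bump p r z) * f z - f p * of_real (bump p r z)) = 0"
    using integral_cong[of ?K, OF db] by simp
  then have "integral ?K (\<lambda>z. of_real (bump p r z) * f z) = integral ?K (\<lambda>z. f p * of_real (bump p r z))"
    using i by (simp add: integral_diff)
  also have "\<dots> = f p * integral ?K (\<lambda>z. of_real (bump p r z))" by (rule integral_mult_right)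
  also have "integral ?K (\<lambda>z. of_real (bump p r z)) = complex_of_real (integral ?K (bump p r))"
    using integral_linear[OF compact_integrable[OF compact_cball c(1)] bounded_linear_of_real[where 'a = complex]]
    by (simp add: o_def)
  finally show ?thesis .
qed

text \<open>Near q the field of p is the holomorphic function H = - f p / (z - p). Integration by
  parts moves px - i py from g to H, where it gives 2 H' = 2 f p / (z - p)^2; the mean value
  property then evaluates the integral at q.\<close>

lemma pole_field_pairing:
  assumes S: "open S" and f: "f holomorphic_on S" and r: "r > 0"
    and D: "compact D" "D \<subseteq> S" "cball q (2 * r) \<subseteq> D" and disj: "cball p (2 * r) \<inter> cball q (2 * r) = {}"
  defines "g \<equiv> \<lambda>z. of_real (bump q r z) * f z"
  shows "integral D (\<lambda>z. pole_field p r f z * (px g z - \<i> * py g z))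
    = - 2 * (f p * f q / (q - p)\<^sup>2) * of_real (integral (cball q (2 * r)) (bump q r))"
proof -
  let ?K = "cball q (2 * r)"
  define S' where "S' = S - cball p (2 * r)"
  have S': "open S'" "?K \<subseteq> S'" unfolding S'_def using S D disj by auto
  have fS': "f holomorphic_on S'" using holomorphic_on_subset[OF f] unfolding S'_def by auto
  have gC: "Cinf S g" unfolding g_def
    by (intro Cinf_mult S Cinf_of_real Cinf_subset[OF bump_Cinf] Cinf_holomorphic f) auto
  have gC': "Cinf S' g" by (rule Cinf_subset[OF gC]) (auto simp: S'_def)
  have uC: "Cinf S (pole_field p r f)" by (rule pole_field_Cinf[OF S f r])
  let ?h = "\<lambda>z. pole_field p r f z * (px g z - \<i> * py g z)"
  have h0: "?h z = 0" if z: "z \<in> D - ?K" for z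
  proof -
    have o: "open (- ?K)" "z \<in> - ?K" using z by auto
    have "g w = 0" if "w \<in> - ?K" for w
      unfolding g_def using bump_eq_0[OF r, of w q] that by (simp add: dist_norm norm_minus_commute)
    then have "px g z = px (\<lambda>z. 0) z" "py g z = py (\<lambda>z. 0) z"
      by (intro px_cong[OF o] py_cong[OF o]; simp)+
    then show ?thesis by (simp add: px_def py_def)
  qed
  define H where "H z = - f p / (z - p)" for z
  have H: "H holomorphic_on S'" unfolding H_def S'_def using r by (intro holomorphic_intros) auto
  have far: "2 * r \<le> cmod (z - p)" if "z \<in> S'" for z
    using that unfolding S'_def by (simp add: dist_norm norm_minus_commute)
  have H': "deriv H z = f p / (z - p)\<^sup>2" if "z \<in> S'" for z
  proof -
    have "z - p \<noteq> 0" using far[OF that] r by auto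
    then show ?thesis unfolding H_def
      by (intro DERIV_imp_deriv) (auto intro!: derivative_eq_intros simp: power2_eq_square field_simps)
  qed
  define \<Gamma> where "\<Gamma> z = f p * f z / (z - p)\<^sup>2" for z
  have \<Gamma>: "\<Gamma> holomorphic_on S'" unfolding \<Gamma>_def
    by (intro holomorphic_intros fS') (use far r in force)
  define k where "k z = H z * g z" for z
  have kC: "Cinf S' k" unfolding k_def by (intro Cinf_mult S' Cinf_holomorphic H gC')
  have k0: "k z = 0" if "z \<in> frontier ?K" for z
  proof -
    have "cmod (z - q) = 2 * r" using that r by (simp add: dist_norm norm_minus_commute)
    then show ?thesis unfolding k_def g_def using bump_eq_0[OF r, of z q] by simp
  qed
  have he: "?h z = (px k z - \<i> * py k z) - 2 * (of_real (bump q r z) * \<Gamma> z)" if z: "z \<in> ?K" for z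
  proof -
    have zS': "z \<in> S'" using z S' by blast
    have Hd: "H field_differentiable (at z)" using holomorphic_on_imp_differentiable_at[OF H S'(1) zS'] .
    have gd: "g differentiable (at z)" by (rule Cinf_differentiable[OF gC' zS'])
    have "pole_field p r f z = H z" unfolding H_def by (rule pole_field_far[OF r far[OF zS']])
    moreover have "px k z = f p / (z - p)\<^sup>2 * g z + H z * px g z" "py k z = \<i> * (f p / (z - p)\<^sup>2) * g z + H z * py g z"
      unfolding k_def px_py_mult[OF field_differentiable_imp_differentiable[OF Hd] gd]
        px_holomorphic[OF Hd] py_holomorphic[OF Hd] H'[OF zS'] by simp_all
    moreover have "of_real (bump q r z) * \<Gamma> z = f p / (z - p)\<^sup>2 * g z" unfolding \<Gamma>_def g_def by simp
    ultimately show ?thesis by (simp add: algebra_simps)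
  qed
  have ik: "px k integrable_on ?K" "py k integrable_on ?K"
    by (rule compact_integrable[OF compact_cball continuous_on_subset[OF _ S'(2)]]; intro Cinf_continuous Cinf_px Cinf_py kC)+
  have ib: "(\<lambda>z. of_real (bump q r z) * \<Gamma> z) integrable_on ?K"
    by (rule compact_integrable; intro compact_cball continuous_intros continuous_on_subset[OF Cinf_continuous[OF bump_Cinf] subset_UNIV]
        continuous_on_subset[OF holomorphic_on_imp_continuous_on[OF \<Gamma>] S'(2)])
  have "integral D ?h = integral D (\<lambda>z. if z \<in> ?K then ?h z else 0)"
    by (rule integral_cong) (use h0 in auto)
  also have "\<dots> = integral (?K \<inter> D) ?h" by (rule integral_restrict_Int)
  also have "?K \<inter> D = ?K" using D by blast
  also have "integral ?K ?h = integral ?K (\<lambda>z. (px k z - \<i> * py k z) - 2 * (of_real (bump q r z) * \<Gamma> z))"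
    by (rule integral_cong[OF he])
  also have "\<dots> = (integral ?K (px k) - \<i> * integral ?K (py k)) - 2 * integral ?K (\<lambda>z. of_real (bump q r z) * \<Gamma> z)"
    using ik ib by (simp add: integral_diff integrable_diff integrable_on_mult_right)
  also have "\<dots> = - 2 * (\<Gamma> q * of_real (integral ?K (bump q r)))"
    using integral_px_py_eq_0_complex[OF S'(1) kC compact_cball S'(2) k0] bump_mean_value[OF S'(1) \<Gamma> r S'(2)] by simp
  finally show ?thesis unfolding \<Gamma>_def by simp
qed

text \<open>Stability makes the real part of a complex quadratic form in the coefficients \<open>s\<close>, \<open>t\<close>
  nonnegative, so the form vanishes; its mixed coefficient is the pairing of the Gauss map at
  the two points.\<close>

proposition stable_imp_isotropic:
  fixes F :: "complex \<Rightarrow> real^'n"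
  assumes P: "P sparse_in UNIV" and F: "branched_minimal_immersion (- P) F" and stable: "stable_on (- P) F"
    and p: "p \<in> - P" and q: "q \<in> - P" and pq: "p \<noteq> q"
  shows "(\<Sum>i\<in>UNIV. gauss_map F i p * gauss_map F i q) = 0"
proof -
  have S: "open (- P)" using F unfolding branched_minimal_immersion_def by auto
  define \<phi> where "\<phi> = gauss_map F"
  have \<phi>: "\<phi> i holomorphic_on - P" for i unfolding \<phi>_def by (rule gauss_map_holomorphic[OF F])
  obtain e1 e2 where e: "e1 > 0" "cball p e1 \<subseteq> - P" "e2 > 0" "cball q e2 \<subseteq> - P"
    using open_contains_cball[of "- P"] S p q by metis
  \<comment> \<open>The discs of radius 2 * r lie in the complement of P, and a common point would
    give dist p q \<le> 4 * r although dist p q \<ge> 6 * r.\<close>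
  define r where "r = min (min e1 e2) (dist p q / 3) / 2"
  have r: "r > 0" "2 * r \<le> e1" "2 * r \<le> e2" "3 * (2 * r) \<le> dist p q" unfolding r_def using e pq by auto
  let ?Kp = "cball p (2 * r)" and ?Kq = "cball q (2 * r)"
  have K: "?Kp \<subseteq> - P" "?Kq \<subseteq> - P"
    using subset_trans[OF subset_cball[OF r(2)] e(2)] subset_trans[OF subset_cball[OF r(3)] e(4)] by auto
  have disj: "?Kp \<inter> ?Kq = {}"
  proof (rule ccontr)
    assume "?Kp \<inter> ?Kq \<noteq> {}"
    then obtain x where "dist p x \<le> 2 * r" "dist q x \<le> 2 * r" by auto
    then have "dist p q \<le> 4 * r" using dist_triangle2[of p q x] by simp
    then show False using r by simp
  qed
  define D where "D = ?Kp \<union> ?Kq"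
  have D: "compact D" "D \<subseteq> - P" "?Kp \<subseteq> D" "?Kq \<subseteq> D" unfolding D_def using K by (auto intro: compact_Un)
  define u1 u2 where "u1 i = pole_field p r (\<phi> i)" and "u2 i = pole_field q r (\<phi> i)" for i
  define g1 g2 where "g1 i z = complex_of_real (bump p r z) * \<phi> i z" and "g2 i z = complex_of_real (bump q r z) * \<phi> i z" for i z
  have uC: "Cinf (- P) (u1 i)" "Cinf (- P) (u2 i)" for i
    unfolding u1_def u2_def by (intro pole_field_Cinf S \<phi> r)+
  have bC: "Cinf (- P) (\<lambda>z. complex_of_real (bump c r z))" for c
    by (intro Cinf_of_real S Cinf_subset[OF bump_Cinf]) auto
  have gC: "Cinf (- P) (g1 i)" "Cinf (- P) (g2 i)" for i
    unfolding g1_def g2_def by (intro Cinf_mult S bC Cinf_holomorphic \<phi>)+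
  define L where "L g z = px g z - \<i> * py g z" for g :: "complex \<Rightarrow> complex" and z
  define T where "T u g = integral D (\<lambda>z. \<Sum>i\<in>UNIV. u i z * L (g i) z)" for u g :: "'n \<Rightarrow> complex \<Rightarrow> complex"
  have ci: "(\<lambda>z. u z * L g z) integrable_on D" if "Cinf (- P) u" "Cinf (- P) g" for u g
    unfolding L_def by (rule compact_integrable[OF D(1) continuous_on_subset[OF _ D(2)]])
      (intro continuous_intros Cinf_continuous Cinf_px Cinf_py that)
  have Tsum: "T u g = (\<Sum>i\<in>UNIV. integral D (\<lambda>z. u i z * L (g i) z))"
    if "\<And>i. Cinf (- P) (u i)" "\<And>i. Cinf (- P) (g i)" for u g
    unfolding T_def by (rule integral_sum) (auto intro: ci that)
  have quad: "s\<^sup>2 * T u1 g1 + s * t * (T u1 g2 + T u2 g1) + t\<^sup>2 * T u2 g2 = 0" (is "?Q s t = 0") for s t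
  proof -
    have nonneg: "0 \<le> Re (?Q s t)" for s t
    proof -
      let ?u = "\<lambda>i z. s * u1 i z + t * u2 i z" and ?g = "\<lambda>i z. s * g1 i z + t * g2 i z"
      have usC: "Cinf (- P) (?u i)" for i by (intro Cinf_add Cinf_mult S Cinf_const uC)
      have gsC: "Cinf (- P) (?g i)" for i by (intro Cinf_add Cinf_mult S Cinf_const gC)
      have pl: "px (\<lambda>z. s * f z + t * h z) z = s * px f z + t * px h z \<and> py (\<lambda>z. s * f z + t * h z) z = s * py f z + t * py h z"
        if "Cinf (- P) f" "Cinf (- P) h" "z \<in> - P" for f h z
      proof -
        have d: "f differentiable (at z)" "h differentiable (at z)"
          using Cinf_differentiable that by auto
        have dd: "(\<lambda>z. s * f z) differentiable (at z)" "(\<lambda>z. t * h z) differentiable (at z)"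
          using d by (auto intro: differentiable_mult)
        show ?thesis
          unfolding px_py_add[OF dd]
          using px_py_linear[OF bounded_linear_mult_right d(1), of s] px_py_linear[OF bounded_linear_mult_right d(2), of t] by simp
      qed
      have "\<exists>C. \<forall>z\<in>- P. cmod (u1 i z) \<le> C \<and> cmod z * cmod (u1 i z) \<le> C" for i
        unfolding u1_def by (rule pole_field_bounded[OF S \<phi> r(1) K(1)])
      then obtain C1 where C1: "\<And>i z. z \<in> - P \<Longrightarrow> cmod (u1 i z) \<le> C1 i \<and> cmod z * cmod (u1 i z) \<le> C1 i" by metis
      have "\<exists>C. \<forall>z\<in>- P. cmod (u2 i z) \<le> C \<and> cmod z * cmod (u2 i z) \<le> C" for i
        unfolding u2_def by (rule pole_field_bounded[OF S \<phi> r(1) K(2)])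
      then obtain C2 where C2: "\<And>i z. z \<in> - P \<Longrightarrow> cmod (u2 i z) \<le> C2 i \<and> cmod z * cmod (u2 i z) \<le> C2 i" by metis
      define c where "c i = cmod s * C1 i + cmod t * C2 i" for i
      have b: "cmod (?u i z) \<le> c i" "cmod z * cmod (?u i z) \<le> c i" if z: "z \<in> - P" for i z
      proof -
        have n: "cmod (?u i z) \<le> cmod s * cmod (u1 i z) + cmod t * cmod (u2 i z)"
          by (metis norm_mult norm_triangle_ineq)
        also have "\<dots> \<le> c i" unfolding c_def using C1[OF z, of i] C2[OF z, of i] by (intro add_mono mult_left_mono) auto
        finally show "cmod (?u i z) \<le> c i" .
        have "cmod z * cmod (?u i z) \<le> cmod z * (cmod s * cmod (u1 i z) + cmod t * cmod (u2 i z))"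
          using n by (intro mult_left_mono) auto
        also have "\<dots> = cmod s * (cmod z * cmod (u1 i z)) + cmod t * (cmod z * cmod (u2 i z))" by (simp add: algebra_simps)
        also have "\<dots> \<le> c i" unfolding c_def using C1[OF z, of i] C2[OF z, of i] by (intro add_mono mult_left_mono) auto
        finally show "cmod z * cmod (?u i z) \<le> c i" .
      qed
      have "0 \<le> Re (integral D (\<lambda>z. \<Sum>i\<in>UNIV. ?u i z * (px (?g i) z - \<i> * py (?g i) z)))"
      proof (rule stability_pairing_nonneg[OF P F stable D(1,2) usC])
        show "Cinf (- P) (\<lambda>z. s * complex_of_real (bump p r z) + t * complex_of_real (bump q r z))"
          by (intro Cinf_add Cinf_mult S Cinf_const bC)
        show "s * complex_of_real (bump p r z) + t * complex_of_real (bump q r z) = 0" if "z \<in> - P" "z \<notin> D" for z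
          using that bump_eq_0[OF r(1), of z p] bump_eq_0[OF r(1), of z q] unfolding D_def
          by (simp add: dist_norm norm_minus_commute)
        show "s * g1 i z + t * g2 i z = (s * complex_of_real (bump p r z) + t * complex_of_real (bump q r z)) * Complex (px F z $ i) (- (py F z $ i))" for i z
          unfolding g1_def g2_def \<phi>_def gauss_map_def by (simp add: algebra_simps)
        show "px (?u i) z + \<i> * py (?u i) z = s * g1 i z + t * g2 i z" if z: "z \<in> - P" for i z
        proof -
          have 1: "px (u1 i) z + \<i> * py (u1 i) z = g1 i z" "px (u2 i) z + \<i> * py (u2 i) z = g2 i z"
            unfolding u1_def g1_def u2_def g2_def by (rule pole_field_dbar[OF S \<phi> r(1) z])+
          have "px (?u i) z + \<i> * py (?u i) z
              = s * (px (u1 i) z + \<i> * py (u1 i) z) + t * (px (u2 i) z + \<i> * py (u2 i) z)"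
            using pl[OF uC(1)[of i] uC(2)[of i] z] by (simp add: algebra_simps)
          then show ?thesis unfolding 1 .
        qed
        show "(\<Sum>i\<in>UNIV. (cmod (?u i z))\<^sup>2) \<le> (\<Sum>i\<in>UNIV. (c i)\<^sup>2)" if "z \<in> - P" for z
          by (intro sum_mono power_mono b that) auto
        show "(cmod z)\<^sup>2 * (\<Sum>i\<in>UNIV. (cmod (?u i z))\<^sup>2) \<le> (\<Sum>i\<in>UNIV. (c i)\<^sup>2)" if "z \<in> - P" for z
          unfolding sum_distrib_left power_mult_distrib[symmetric] by (intro sum_mono power_mono b that) auto
      qed
      also have "integral D (\<lambda>z. \<Sum>i\<in>UNIV. ?u i z * (px (?g i) z - \<i> * py (?g i) z)) = T ?u ?g" unfolding T_def L_def ..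
      also have "T ?u ?g = ?Q s t"
      proof -
        have "integral D (\<lambda>z. ?u i z * L (?g i) z) = s\<^sup>2 * integral D (\<lambda>z. u1 i z * L (g1 i) z)
           + s * t * (integral D (\<lambda>z. u1 i z * L (g2 i) z) + integral D (\<lambda>z. u2 i z * L (g1 i) z))
           + t\<^sup>2 * integral D (\<lambda>z. u2 i z * L (g2 i) z)" for i
        proof -
          have "integral D (\<lambda>z. ?u i z * L (?g i) z) = integral D (\<lambda>z. s\<^sup>2 * (u1 i z * L (g1 i) z)
            + s * t * (u1 i z * L (g2 i) z + u2 i z * L (g1 i) z) + t\<^sup>2 * (u2 i z * L (g2 i) z))"
            by (rule integral_cong) (use pl[OF gC(1) gC(2)] D(2) in \<open>auto simp: L_def power2_eq_square algebra_simps\<close>)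
          also have "\<dots> = s\<^sup>2 * integral D (\<lambda>z. u1 i z * L (g1 i) z)
           + s * t * (integral D (\<lambda>z. u1 i z * L (g2 i) z) + integral D (\<lambda>z. u2 i z * L (g1 i) z))
           + t\<^sup>2 * integral D (\<lambda>z. u2 i z * L (g2 i) z)"
            by (simp only: integral_add integral_mult_right integrable_add integrable_on_mult_right ci uC gC)
          finally show ?thesis .
        qed
        then show ?thesis unfolding Tsum[OF usC gsC] Tsum[OF uC(1) gC(1)] Tsum[OF uC(1) gC(2)] Tsum[OF uC(2) gC(1)] Tsum[OF uC(2) gC(2)]
          by (simp add: sum.distrib flip: sum_distrib_left)
      qed
      finally show ?thesis .
    qed
    \<comment> \<open>With c^2 = - cnj (Q s t), scaling s and t by c turns the form into - |Q s
      t|^2, whose real part can be nonnegative only if Q s t = 0.\<close>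
    have csq: "(csqrt (- cnj x))\<^sup>2 * x = - of_real ((cmod x)\<^sup>2)" for x
      unfolding power2_csqrt complex_norm_square by simp
    define c where "c = csqrt (- cnj (?Q s t))"
    have "?Q (c * s) (c * t) = c\<^sup>2 * ?Q s t" by (simp add: power2_eq_square algebra_simps)
    also have "\<dots> = - of_real ((cmod (?Q s t))\<^sup>2)"
      unfolding c_def by (rule csq)
    finally have "0 \<le> - ((cmod (?Q s t))\<^sup>2)" using nonneg[of "c * s" "c * t"] by simp
    then show ?thesis by simp
  qed
  \<comment> \<open>The values at (1, 1) and (1, -1) isolate the mixed coefficient.\<close>
  have cross: "T u1 g2 + T u2 g1 = 0"
  proof -
    have "T u1 g1 + (T u1 g2 + T u2 g1) + T u2 g2 = 0" "T u1 g1 - (T u1 g2 + T u2 g1) + T u2 g2 = 0"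
      using quad[of 1 1] quad[of 1 "-1"] by (simp_all add: algebra_simps)
    then have "2 * (T u1 g2 + T u2 g1) = 0" by algebra
    then show ?thesis by (metis mult_eq_0_iff zero_neq_numeral)
  qed
  define \<kappa> where "\<kappa> c = integral (cball c (2 * r)) (bump c r)" for c
  define \<Gamma> where "\<Gamma> = (\<Sum>i\<in>UNIV. \<phi> i p * \<phi> i q) / (q - p)\<^sup>2"
  have "T u1 g2 = - 2 * \<Gamma> * of_real (\<kappa> q)"
    unfolding Tsum[OF uC(1) gC(2)] u1_def g2_def L_def \<kappa>_def \<Gamma>_def
      pole_field_pairing[OF S \<phi> r(1) D(1,2,4) disj]
    by (simp add: sum_distrib_left sum_distrib_right sum_divide_distrib)
  moreover have "T u2 g1 = - 2 * \<Gamma> * of_real (\<kappa> p)"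
    unfolding Tsum[OF uC(2) gC(1)] u2_def g1_def L_def \<kappa>_def \<Gamma>_def
      pole_field_pairing[OF S \<phi> r(1) D(1,2,3) disj[unfolded Int_commute[of ?Kp]]] power2_commute[of p q]
    by (simp add: sum_distrib_left sum_distrib_right sum_divide_distrib mult.commute)
  ultimately have "- 2 * \<Gamma> * of_real (\<kappa> q + \<kappa> p) = 0" using cross by (simp add: algebra_simps)
  \<comment> \<open>The two bump integrals have the same sign, so the mixed terms cannot cancel: the
    factor multiplying \<Gamma> is nonzero.\<close>
  moreover have "\<kappa> q + \<kappa> p < 0" unfolding \<kappa>_def using bump_integral_neg[OF r(1), of p] bump_integral_neg[OF r(1), of q] by simp
  ultimately have "\<Gamma> = 0"
    by (metis mult_eq_0_iff neg_equal_0_iff_equal of_real_eq_0_iff order_less_irrefl zero_neq_numeral)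
  then show ?thesis unfolding \<Gamma>_def \<phi>_def using pq by simp
qed

section \<open>The orthogonal complex structure\<close>

text \<open>J is skew on V, so w and J w are orthogonal, and the orthogonal complement of their span
  in V is again invariant under J. The dimension drops by 2.\<close>

lemma even_dim_orthogonal_complex_structure:
  fixes V :: "'a::euclidean_space set"
  assumes "subspace V" "\<And>v. v \<in> V \<Longrightarrow> J v \<in> V \<and> J (J v) = - v"
    "\<And>u v. u \<in> V \<Longrightarrow> v \<in> V \<Longrightarrow> J u \<bullet> J v = u \<bullet> v"
  shows "even (dim V)"
  using assms
proof (induction "dim V" arbitrary: V rule: less_induct)
  case less
  note V = less.prems
  have skew: "J u \<bullet> v = - (u \<bullet> J v)" if "u \<in> V" "v \<in> V" for u v
    using V(3)[of "J u" v] V(2)[OF that(1)] that by simp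
  show ?case
  proof (cases "V \<subseteq> {0}")
    case True
    then show ?thesis by (metis dim_eq_0 even_zero)
  next
    case False
    then obtain w where w: "w \<in> V" "w \<noteq> 0" by auto
    have Jw: "J w \<in> V" using V(2) w by blast
    have orth: "w \<bullet> J w = 0" using skew[OF w(1) w(1)] by (simp add: inner_commute)
    have Jw0: "J w \<noteq> 0" using V(3)[OF w(1) w(1)] w(2) by auto
    let ?A = "span {w, J w}"
    have A: "subspace ?A" "?A \<subseteq> V" using span_minimal[of "{w, J w}" V] w Jw V(1) by auto
    have "pairwise orthogonal {w, J w}" using orth by (auto simp: pairwise_def orthogonal_def inner_commute)
    then have "independent {w, J w}" using w Jw0 by (intro pairwise_orthogonal_independent) auto
    moreover have "w \<noteq> J w" using orth w by (metis inner_eq_zero_iff)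
    ultimately have dA: "dim ?A = 2" by (simp add: dim_eq_card_independent)
    define V' where "V' = {y \<in> V. \<forall>x\<in>?A. orthogonal x y}"
    have dim: "dim V' + 2 = dim V"
      using dim_subspace_orthogonal_to_vectors[OF A(1) V(1) A(2)] dA unfolding V'_def by simp
    have V'_iff: "y \<in> V' \<longleftrightarrow> y \<in> V \<and> w \<bullet> y = 0 \<and> J w \<bullet> y = 0" for y
    proof
      assume "y \<in> V'"
      then show "y \<in> V \<and> w \<bullet> y = 0 \<and> J w \<bullet> y = 0"
        unfolding V'_def orthogonal_def using span_base[of w "{w, J w}"] span_base[of "J w" "{w, J w}"] by auto
    next
      assume y: "y \<in> V \<and> w \<bullet> y = 0 \<and> J w \<bullet> y = 0"
      have "orthogonal y x" if "x \<in> ?A" for x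
        by (rule orthogonal_to_span[OF that]) (use y in \<open>auto simp: orthogonal_def inner_commute\<close>)
      then show "y \<in> V'" unfolding V'_def using y by (auto simp: orthogonal_commute)
    qed
    have "subspace V'" using V(1) by (auto simp: subspace_def V'_iff inner_add_right)
    moreover have "J v \<in> V' \<and> J (J v) = - v" if "v \<in> V'" for v
    proof -
      have v: "v \<in> V" "w \<bullet> v = 0" "J w \<bullet> v = 0" using that unfolding V'_iff by auto
      have "w \<bullet> J v = 0" using skew[OF w(1) v(1)] v by simp
      moreover have "J w \<bullet> J v = 0" using V(3)[OF w(1) v(1)] v by simp
      ultimately show ?thesis using V(2)[OF v(1)] unfolding V'_iff by blast
    qed
    moreover have "J u \<bullet> J v = u \<bullet> v" if "u \<in> V'" "v \<in> V'" for u v using V(3) that unfolding V'_iff by blast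
    ultimately have "even (dim V')" using dim by (intro less.hyps) auto
    then show ?thesis using dim by presburger
  qed
qed

text \<open>Identify a pair (a, b) with a - i b. Multiplication by i becomes (a, b) to (b, - a),
  \<Gamma> is the complex span of the values of \<Phi>, and Q says that the complex bilinear product
  of two vectors is 0. The graph of J is read off from \<Gamma>.\<close>

proposition isotropic_imp_holomorphic:
  fixes F :: "complex \<Rightarrow> real^'n"
  assumes S: "open S" "connected S" "S \<noteq> {}" and Fd: "\<And>z. z \<in> S \<Longrightarrow> F differentiable (at z)"
    and iso: "\<And>p q. p \<in> S \<Longrightarrow> q \<in> S \<Longrightarrow> px F p \<bullet> px F q = py F p \<bullet> py F q \<and> px F p \<bullet> py F q = - (py F p \<bullet> px F q)"
  shows "holomorphic_up_to_rigid_motion S F"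
proof -
  define G where "G = (\<Union>z\<in>S. {(px F z, py F z), (py F z, - px F z)})"
  define \<Gamma> where "\<Gamma> = span G"
  have sub\<Gamma>: "subspace \<Gamma>" unfolding \<Gamma>_def by simp
  define Q where "Q x y \<longleftrightarrow> fst x \<bullet> fst y = snd x \<bullet> snd y \<and> fst x \<bullet> snd y = - (snd x \<bullet> fst y)" for x y :: "(real^'n) \<times> (real^'n)"
  have QG: "Q x y" if xy: "x \<in> G" "y \<in> G" for x y
  proof -
    obtain p where p: "p \<in> S" "x = (px F p, py F p) \<or> x = (py F p, - px F p)" using xy(1) unfolding G_def by auto
    obtain q where q: "q \<in> S" "y = (px F q, py F q) \<or> y = (py F q, - px F q)" using xy(2) unfolding G_def by auto
    show ?thesis using p(2) q(2) iso[OF p(1) q(1)] unfolding Q_def by (elim disjE) simp_all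
  qed
  have Qsub: "subspace {x. Q x y}" for y
    unfolding subspace_def Q_def by (auto simp: inner_add_left algebra_simps)
  have Qsub': "subspace {y. Q x y}" for x
    unfolding subspace_def Q_def by (auto simp: inner_add_right algebra_simps)
  have Q\<Gamma>: "Q x y" if "x \<in> \<Gamma>" "y \<in> \<Gamma>" for x y
  proof -
    have "Q x y" if "y \<in> G" for y
    proof -
      have "G \<subseteq> {x. Q x y}" by (intro subsetI CollectI QG that)
      then have "\<Gamma> \<subseteq> {x. Q x y}" unfolding \<Gamma>_def by (rule span_minimal[OF _ Qsub])
      then show ?thesis using \<open>x \<in> \<Gamma>\<close> by blast
    qed
    then have "G \<subseteq> {y. Q x y}" by (intro subsetI CollectI)
    then have "\<Gamma> \<subseteq> {y. Q x y}" unfolding \<Gamma>_def by (rule span_minimal[OF _ Qsub'])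
    then show ?thesis using that by blast
  qed
  have rot: "(b, - a) \<in> \<Gamma>" if "(a, b) \<in> \<Gamma>" for a b
  proof -
    have l: "linear (\<lambda>x::(real^'n) \<times> (real^'n). (snd x, - fst x))" by (intro linearI) auto
    have "subspace {x. (snd x, - fst x) \<in> \<Gamma>}"
      using linear_subspace_vimage[OF l sub\<Gamma>] by (simp add: vimage_def)
    moreover have "G \<subseteq> {x. (snd x, - fst x) \<in> \<Gamma>}"
    proof
      fix x assume "x \<in> G"
      then obtain z where z: "z \<in> S" "x = (px F z, py F z) \<or> x = (py F z, - px F z)" unfolding G_def by auto
      have "(py F z, - px F z) \<in> \<Gamma>" "(px F z, py F z) \<in> \<Gamma>"
        unfolding \<Gamma>_def using z(1) by (auto intro!: span_base simp: G_def)
      moreover from this(2) have "- (px F z, py F z) \<in> \<Gamma>" by (rule subspace_neg[OF sub\<Gamma>])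
      ultimately show "x \<in> {x. (snd x, - fst x) \<in> \<Gamma>}" using z(2) by (elim disjE) simp_all
    qed
    ultimately have "\<Gamma> \<subseteq> {x. (snd x, - fst x) \<in> \<Gamma>}" unfolding \<Gamma>_def by (intro span_minimal)
    then show ?thesis using that by auto
  qed
  \<comment> \<open>For a pair (0, d) in \<Gamma>, isotropy against itself reads 0 = d . d; so
    \<Gamma> is a graph over its first projection.\<close>
  have uniq: "b = c" if "(a, b) \<in> \<Gamma>" "(a, c) \<in> \<Gamma>" for a b c
  proof -
    have "(0, b - c) \<in> \<Gamma>" using subspace_diff[OF sub\<Gamma> that] by simp
    from Q\<Gamma>[OF this this] show ?thesis unfolding Q_def by simp
  qed
  define V where "V = fst ` \<Gamma>"
  have subV: "subspace V" unfolding V_def by (rule linear_subspace_image[OF linear_fst sub\<Gamma>])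
  \<comment> \<open>J is prescribed on a basis of V by choosing partners in \<Gamma> and extended
    linearly; by uniqueness (v, J v) is the only pair of \<Gamma> over v.\<close>
  obtain B where B: "B \<subseteq> V" "independent B" "V \<subseteq> span B" using basis_exists[of V] by metis
  have "\<exists>c. (b, c) \<in> \<Gamma>" if "b \<in> B" for b using B(1) that unfolding V_def by force
  then obtain g where g: "\<And>b. b \<in> B \<Longrightarrow> (b, g b) \<in> \<Gamma>" by metis
  obtain J where J: "linear J" "\<And>b. b \<in> B \<Longrightarrow> J b = g b" using linear_independent_extend[OF B(2)] by metis
  have J\<Gamma>: "(v, J v) \<in> \<Gamma>" if "v \<in> V" for v
  proof -
    have l: "linear (\<lambda>v. (v, J v))" using J(1) by (intro linearI) (auto simp: linear_add linear_scale)
    have "subspace {v. (v, J v) \<in> \<Gamma>}"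
      using linear_subspace_vimage[OF l sub\<Gamma>] by (simp add: vimage_def)
    then have "span B \<subseteq> {v. (v, J v) \<in> \<Gamma>}" using g J(2) by (intro span_minimal) auto
    then show ?thesis using that B(3) by blast
  qed
  have J2: "J v \<in> V \<and> J (J v) = - v" if "v \<in> V" for v
  proof -
    have r: "(J v, - v) \<in> \<Gamma>" by (rule rot[OF J\<Gamma>[OF that]])
    then have "J v \<in> V" unfolding V_def by force
    then show ?thesis using uniq[OF J\<Gamma> r] by simp
  qed
  have Jiso: "J u \<bullet> J v = u \<bullet> v" if "u \<in> V" "v \<in> V" for u v
    using Q\<Gamma>[OF J\<Gamma>[OF that(1)] J\<Gamma>[OF that(2)]] unfolding Q_def by simp
  have XY: "(px F z, py F z) \<in> \<Gamma>" if "z \<in> S" for z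
    unfolding \<Gamma>_def using that by (auto intro!: span_base simp: G_def)
  have XV: "px F z \<in> V" "py F z \<in> V" if "z \<in> S" for z
    using XY[OF that] rot[OF XY[OF that]] unfolding V_def by force+
  have JX: "J (px F z) = py F z" "J (py F z) = - px F z" if "z \<in> S" for z
    using uniq[OF J\<Gamma>[OF XV(1)[OF that]] XY[OF that]] uniq[OF J\<Gamma>[OF XV(2)[OF that]] rot[OF XY[OF that]]] by auto
  have fd: "frechet_derivative F (at z) v = Re v *\<^sub>R px F z + Im v *\<^sub>R py F z" if "z \<in> S" for z v
    using frechet_derivative_at[OF has_derivative_px_py[OF Fd[OF that]]] by metis
  have cr: "frechet_derivative F (at z) (\<i> * v) = J (frechet_derivative F (at z) v)" if "z \<in> S" for z v
    unfolding fd[OF that] using J(1) JX[OF that] by (simp add: linear_add linear_scale)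
  obtain z0 where z0: "z0 \<in> S" using S by blast
  \<comment> \<open>All derivatives of F lie in V, so the product of F with a vector n orthogonal to
    V is constant on the connected set S. The normal component of F z - F z0 is then orthogonal to
    itself.\<close>
  have FV: "F z - F z0 \<in> V" if z: "z \<in> S" for z
  proof -
    obtain y n where yn: "y \<in> span V" "\<And>w. w \<in> span V \<Longrightarrow> orthogonal n w" "F z - F z0 = y + n"
      using orthogonal_subspace_decomp_exists[of V "F z - F z0"] by metis
    have "((\<lambda>w. F w \<bullet> n) has_derivative (\<lambda>v. 0)) (at w)" if "w \<in> S" for w
    proof -
      have "((\<lambda>w. F w \<bullet> n) has_derivative (\<lambda>v. (Re v *\<^sub>R px F w + Im v *\<^sub>R py F w) \<bullet> n)) (at w)"
        by (intro has_derivative_inner_left has_derivative_px_py Fd that)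
      moreover have "px F w \<bullet> n = 0" "py F w \<bullet> n = 0"
        using yn(2) XV[OF that] span_base unfolding orthogonal_def by (metis inner_commute)+
      ultimately show ?thesis by (simp add: inner_add_left)
    qed
    then have "F z \<bullet> n = F z0 \<bullet> n"
      by (rule has_derivative_zero_unique_connected[OF S(1,2)]) (use z z0 in auto)
    then have "(y + n) \<bullet> n = 0" using yn(3) by (metis inner_diff_left right_minus_eq)
    moreover have "y \<bullet> n = 0" using yn(1,2) unfolding orthogonal_def by (metis inner_commute)
    ultimately have "n = 0" by (simp add: inner_add_left)
    then show ?thesis using yn subV by (simp add: span_eq_iff[THEN iffD2])
  qed
  have "even (dim V)" by (rule even_dim_orthogonal_complex_structure[OF subV J2 Jiso])
  then show ?thesis unfolding holomorphic_up_to_rigid_motion_def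
    using subV FV J(1) J2 Jiso cr by (intro exI[of _ "F z0"] exI[of _ V] exI[of _ J]) blast
qed

section \<open>Stability of holomorphic immersions\<close>

text \<open>The Lipschitz bound compares with the value at t0 only, which already dominates the
  difference quotients there. This suits the second derivative, since the velocity of the density is
  controlled only against its value at t = 0. The exceptional null set may depend on t0.\<close>

lemma integral_has_real_derivative:
  fixes h :: "real \<Rightarrow> 'a::euclidean_space \<Rightarrow> real"
  assumes \<Omega>: "compact \<Omega>" and e: "e > 0" and hi: "\<And>t. \<bar>t - t0\<bar> < e \<Longrightarrow> h t integrable_on \<Omega>"
    and lip: "\<And>t z. z \<in> \<Omega> \<Longrightarrow> \<bar>t - t0\<bar> < e \<Longrightarrow> \<bar>h t z - h t0 z\<bar> \<le> C * \<bar>t - t0\<bar>"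
    and N: "negligible N" and d: "\<And>z. z \<in> \<Omega> \<Longrightarrow> z \<notin> N \<Longrightarrow> ((\<lambda>t. h t z) has_real_derivative d z) (at t0)"
  shows "d integrable_on \<Omega>" and "((\<lambda>t. integral \<Omega> (h t)) has_real_derivative integral \<Omega> d) (at t0)"
proof -
  have main: "d integrable_on \<Omega> \<and> (\<lambda>k. (integral \<Omega> (h (X k)) - integral \<Omega> (h t0)) / (X k - t0)) \<longlonglongrightarrow> integral \<Omega> d"
    if X: "\<And>k. X k \<noteq> t0" "X \<longlonglongrightarrow> t0" for X
  proof -
    have "eventually (\<lambda>k. dist (X k) t0 < e) sequentially" using X(2) e by (rule tendstoD)
    then obtain m where m: "\<And>k. k \<ge> m \<Longrightarrow> \<bar>X k - t0\<bar> < e" unfolding eventually_sequentially dist_real_def by auto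
    define Y where "Y k = X (k + m)" for k
    have Y: "Y k \<noteq> t0" "\<bar>Y k - t0\<bar> < e" for k unfolding Y_def using X(1) m by auto
    have Yl: "Y \<longlonglongrightarrow> t0" unfolding Y_def by (rule LIMSEQ_ignore_initial_segment[OF X(2)])
    define f where "f k z = (if z \<in> N then 0 else (h (Y k) z - h t0 z) / (Y k - t0))" for k z
    define d' where "d' z = (if z \<in> N then 0 else d z)" for z
    have h0: "h t0 integrable_on \<Omega>" by (rule hi) (use e in simp)
    have qi: "(\<lambda>z. (h (Y k) z - h t0 z) / (Y k - t0)) integrable_on \<Omega>" for k
      by (intro integrable_on_divide integrable_diff hi h0 Y)
    have fi: "f k integrable_on \<Omega>" for k
      by (rule integrable_spike[OF qi[of k] N]) (simp add: f_def)
    have C0: "0 \<le> C" if "z \<in> \<Omega>" for z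
    proof -
      have "0 \<le> C * \<bar>Y 0 - t0\<bar>" using lip[OF that Y(2)[of 0]] by linarith
      moreover have "0 < \<bar>Y 0 - t0\<bar>" using Y(1)[of 0] by simp
      ultimately show ?thesis by (simp add: zero_le_mult_iff)
    qed
    have fb: "norm (f k z) \<le> C" if "z \<in> \<Omega>" for k z
      using lip[OF that Y(2)[of k]] Y(1)[of k] C0[OF that] unfolding f_def by (auto simp: abs_divide pos_divide_le_eq)
    have fl: "(\<lambda>k. f k z) \<longlonglongrightarrow> d' z" if "z \<in> \<Omega>" for z
    proof (cases "z \<in> N")
      case False
      have "((\<lambda>t. (h t z - h t0 z) / (t - t0)) \<longlongrightarrow> d z) (at t0)"
        using d[OF that False] by (simp add: has_field_derivative_iff)
      then have "(\<lambda>k. (h (Y k) z - h t0 z) / (Y k - t0)) \<longlonglongrightarrow> d z"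
        by (rule filterlim_compose) (use Y(1) Yl in \<open>auto simp: filterlim_at\<close>)
      then show ?thesis using False unfolding f_def d'_def by simp
    qed (simp add: f_def d'_def)
    have ci: "(\<lambda>z. C) integrable_on \<Omega>" by (rule compact_integrable[OF \<Omega>]) simp
    note dc = dominated_convergence[of f \<Omega> "\<lambda>z. C" d', OF fi ci fb fl]
    have di: "d integrable_on \<Omega>" by (rule integrable_spike[OF dc(1) N]) (auto simp: d'_def)
    have "integral \<Omega> (f k) = (integral \<Omega> (h (Y k)) - integral \<Omega> (h t0)) / (Y k - t0)" for k
    proof -
      have "integral \<Omega> (f k) = integral \<Omega> (\<lambda>z. (h (Y k) z - h t0 z) / (Y k - t0))"
        by (rule integral_spike[OF N]) (simp add: f_def)
      then show ?thesis using hi[OF Y(2)] h0 by (simp add: integral_diff)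
    qed
    moreover have "integral \<Omega> d' = integral \<Omega> d" by (rule integral_spike[OF N]) (simp add: d'_def)
    ultimately have "(\<lambda>k. (integral \<Omega> (h (Y k)) - integral \<Omega> (h t0)) / (Y k - t0)) \<longlonglongrightarrow> integral \<Omega> d"
      using dc(2) by simp
    then have "(\<lambda>k. (integral \<Omega> (h (X k)) - integral \<Omega> (h t0)) / (X k - t0)) \<longlonglongrightarrow> integral \<Omega> d"
      unfolding Y_def by (rule LIMSEQ_offset[where k = m])
    with di show ?thesis ..
  qed
  define X where "X k = t0 + inverse (real (Suc k))" for k
  have "X \<longlonglongrightarrow> t0 + 0" unfolding X_def by (intro tendsto_intros LIMSEQ_inverse_real_of_nat)
  then have "X \<longlonglongrightarrow> t0" by simp
  then show "d integrable_on \<Omega>" using main[of X] by (simp add: X_def)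
  show "((\<lambda>t. integral \<Omega> (h t)) has_real_derivative integral \<Omega> d) (at t0)"
    unfolding has_field_derivative_iff tendsto_at_iff_sequentially o_def using main by auto
qed

text \<open>Away from 0 the direction of a vector changes at most at twice the relative rate of the
  vector. The value sgn 0 = 0 also obeys the bound.\<close>

lemma norm_sgn_diff_le:
  fixes x a :: "'a::real_normed_vector"
  assumes "a \<noteq> 0"
  shows "norm (sgn x - sgn a) \<le> 2 * norm (x - a) / norm a"
proof (cases "x = 0")
  case True
  then show ?thesis using assms by (simp add: norm_sgn)
next
  case False
  have "sgn x - sgn a = (1 / norm a) *\<^sub>R (x - a) + ((norm a - norm x) / norm a) *\<^sub>R sgn x"
    using assms False by (simp add: sgn_div_norm algebra_simps divide_inverse)
  then have "norm (sgn x - sgn a) \<le> norm ((1 / norm a) *\<^sub>R (x - a)) + norm (((norm a - norm x) / norm a) *\<^sub>R sgn x)"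
    using norm_triangle_ineq by metis
  also have "\<dots> = norm (x - a) / norm a + \<bar>norm a - norm x\<bar> / norm a" using False by (simp add: norm_sgn)
  also have "\<dots> \<le> norm (x - a) / norm a + norm (x - a) / norm a"
    by (intro add_left_mono divide_right_mono) (metis norm_minus_commute norm_triangle_ineq3, simp)
  finally show ?thesis by simp
qed

text \<open>At a fixed point of the surface the path is the bivector spanned by F_x + t W_x and F_y
  + t W_y, and its norm is the area density.\<close>

lemma norm_quadratic_path:
  fixes a b c :: "'a::real_inner"
  defines "v \<equiv> \<lambda>t::real. a + t *\<^sub>R b + t\<^sup>2 *\<^sub>R c"
  shows "v t \<noteq> 0 \<Longrightarrow> ((\<lambda>t. norm (v t)) has_real_derivative sgn (v t) \<bullet> (b + (2 * t) *\<^sub>R c)) (at t)"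
    and "a \<noteq> 0 \<Longrightarrow> \<exists>D. ((\<lambda>t. sgn (v t) \<bullet> (b + (2 * t) *\<^sub>R c)) has_real_derivative D) (at 0)"
proof -
  have vd: "(v has_derivative (\<lambda>h. h *\<^sub>R (b + (2 * t) *\<^sub>R c))) (at t)" for t
    unfolding v_def by (auto intro!: derivative_eq_intros simp: algebra_simps)
  have nd: "((\<lambda>t. norm (v t)) has_real_derivative sgn (v t) \<bullet> (b + (2 * t) *\<^sub>R c)) (at t)" if "v t \<noteq> 0" for t
    using has_derivative_compose[OF vd[of t] has_derivative_norm[OF that]]
    unfolding has_field_derivative_def by (simp add: inner_commute mult.commute mult_commute_abs)
  then show "v t \<noteq> 0 \<Longrightarrow> ((\<lambda>t. norm (v t)) has_real_derivative sgn (v t) \<bullet> (b + (2 * t) *\<^sub>R c)) (at t)" .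
  assume "a \<noteq> 0"
  then have v0: "v 0 \<noteq> 0" "norm (v 0) \<noteq> 0" unfolding v_def by auto
  have "((\<lambda>t. a \<bullet> b + t * (2 * (a \<bullet> c) + b \<bullet> b) + t\<^sup>2 * (3 * (b \<bullet> c)) + t ^ 3 * (2 * (c \<bullet> c))) has_real_derivative 2 * (a \<bullet> c) + b \<bullet> b) (at 0)"
    by (auto intro!: derivative_eq_intros)
  moreover have "(\<lambda>t. a \<bullet> b + t * (2 * (a \<bullet> c) + b \<bullet> b) + t\<^sup>2 * (3 * (b \<bullet> c)) + t ^ 3 * (2 * (c \<bullet> c))) = (\<lambda>t. v t \<bullet> (b + (2 * t) *\<^sub>R c))"
    unfolding v_def by (auto simp: inner_add_left inner_add_right inner_commute power2_eq_square power3_eq_cube algebra_simps)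
  ultimately have "((\<lambda>t. v t \<bullet> (b + (2 * t) *\<^sub>R c)) has_real_derivative 2 * (a \<bullet> c) + b \<bullet> b) (at 0)" by simp
  from DERIV_divide[OF this nd[OF v0(1)] v0(2)]
  have "\<exists>D. ((\<lambda>t. v t \<bullet> (b + (2 * t) *\<^sub>R c) / norm (v t)) has_real_derivative D) (at 0)" by blast
  moreover have "(\<lambda>t. v t \<bullet> (b + (2 * t) *\<^sub>R c) / norm (v t)) = (\<lambda>t. sgn (v t) \<bullet> (b + (2 * t) *\<^sub>R c))"
    by (auto simp: sgn_div_norm divide_inverse mult.commute)
  ultimately show "\<exists>D. ((\<lambda>t. sgn (v t) \<bullet> (b + (2 * t) *\<^sub>R c)) has_real_derivative D) (at 0)" by simp
qed

lemma norm_quadratic_path_lipschitz: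
  fixes a b c :: "'a::real_inner"
  assumes "norm b \<le> B" "norm c \<le> K" "\<bar>t\<bar> \<le> 1" "\<bar>t0\<bar> \<le> 1"
  shows "\<bar>norm (a + t *\<^sub>R b + t\<^sup>2 *\<^sub>R c) - norm (a + t0 *\<^sub>R b + t0\<^sup>2 *\<^sub>R c)\<bar> \<le> (B + 2 * K) * \<bar>t - t0\<bar>"
proof -
  have "\<bar>norm (a + t *\<^sub>R b + t\<^sup>2 *\<^sub>R c) - norm (a + t0 *\<^sub>R b + t0\<^sup>2 *\<^sub>R c)\<bar>
      \<le> norm ((a + t *\<^sub>R b + t\<^sup>2 *\<^sub>R c) - (a + t0 *\<^sub>R b + t0\<^sup>2 *\<^sub>R c))" by (rule norm_triangle_ineq3)
  also have "(a + t *\<^sub>R b + t\<^sup>2 *\<^sub>R c) - (a + t0 *\<^sub>R b + t0\<^sup>2 *\<^sub>R c) = (t - t0) *\<^sub>R (b + (t + t0) *\<^sub>R c)"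
    by (simp add: algebra_simps power2_eq_square)
  also have "norm \<dots> = \<bar>t - t0\<bar> * norm (b + (t + t0) *\<^sub>R c)" by simp
  also have "\<dots> \<le> \<bar>t - t0\<bar> * (B + 2 * K)"
  proof (rule mult_left_mono)
    have "norm ((t + t0) *\<^sub>R c) \<le> 2 * K" unfolding norm_scaleR using assms by (intro mult_mono) auto
    then show "norm (b + (t + t0) *\<^sub>R c) \<le> B + 2 * K" using assms(1) norm_triangle_ineq[of b "(t + t0) *\<^sub>R c"] by linarith
  qed simp
  finally show ?thesis by (simp add: mult.commute)
qed

text \<open>The constant does not depend on \<open>l\<close>, so the bound is uniform up to the branch points,
  where \<open>l\<close> vanishes: for \<open>\<bar>t\<bar> \<ge> l\<close> both terms are of size \<open>\<bar>t\<bar>\<close>, otherwise the direction of the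
  path changes by at most a multiple of \<open>\<bar>t\<bar> / l\<close> while its velocity is of size \<open>l\<close>.\<close>

lemma norm_quadratic_path_derivative_bound:
  fixes a b c :: "'a::real_inner" and l K :: real
  assumes b: "norm b \<le> K * l" and c: "norm c \<le> K" and a: "l\<^sup>2 \<le> norm a" and l: "0 \<le> l"
  shows "\<bar>sgn (a + t *\<^sub>R b + t\<^sup>2 *\<^sub>R c) \<bullet> (b + (2 * t) *\<^sub>R c) - sgn a \<bullet> b\<bar> \<le> (8 * K + 12 * K\<^sup>2) * \<bar>t\<bar>"
proof -
  define v where "v = a + t *\<^sub>R b + t\<^sup>2 *\<^sub>R c"
  define w where "w = b + (2 * t) *\<^sub>R c"
  have K: "0 \<le> K" using norm_ge_zero[of c] c by linarith
  have tc: "norm ((2 * t) *\<^sub>R c) \<le> 2 * \<bar>t\<bar> * K" using c by (simp add: abs_mult mult_left_mono)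
  have wb: "norm w \<le> K * (l + 2 * \<bar>t\<bar>)"
    unfolding w_def using norm_triangle_ineq[of b "(2 * t) *\<^sub>R c"] b tc by (simp add: algebra_simps)
  have "sgn v \<bullet> w - sgn a \<bullet> b = (sgn v - sgn a) \<bullet> w + sgn a \<bullet> ((2 * t) *\<^sub>R c)"
    unfolding w_def by (simp add: inner_diff_left inner_add_right algebra_simps)
  then have "\<bar>sgn v \<bullet> w - sgn a \<bullet> b\<bar> \<le> \<bar>(sgn v - sgn a) \<bullet> w\<bar> + \<bar>sgn a \<bullet> ((2 * t) *\<^sub>R c)\<bar>" by linarith
  also have "\<dots> \<le> norm (sgn v - sgn a) * norm w + norm (sgn a) * norm ((2 * t) *\<^sub>R c)"
    by (intro add_mono Cauchy_Schwarz_ineq2)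
  also have "\<dots> \<le> norm (sgn v - sgn a) * (K * (l + 2 * \<bar>t\<bar>)) + 1 * (2 * \<bar>t\<bar> * K)"
    using wb tc by (intro add_mono mult_mono) (auto simp: norm_sgn)
  also have "norm (sgn v - sgn a) * (K * (l + 2 * \<bar>t\<bar>)) \<le> (6 * K + 12 * K\<^sup>2) * \<bar>t\<bar>"
  proof (cases "l \<le> \<bar>t\<bar>")
    case True
    have "norm (sgn v - sgn a) \<le> 2" using norm_triangle_ineq4[of "sgn v" "sgn a"] by (auto simp: norm_sgn split: if_splits)
    then have "norm (sgn v - sgn a) * (K * (l + 2 * \<bar>t\<bar>)) \<le> 2 * (K * (3 * \<bar>t\<bar>))"
      using True K l by (intro mult_mono) auto
    also have "\<dots> \<le> (6 * K + 12 * K\<^sup>2) * \<bar>t\<bar>" by (simp add: distrib_right)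
    finally show ?thesis .
  next
    case False
    then have l0: "0 < l" using l by linarith
    then have a0: "a \<noteq> 0" "0 < norm a" using a zero_less_power[OF l0, of 2] by auto
    have "norm (v - a) \<le> norm (t *\<^sub>R b) + norm (t\<^sup>2 *\<^sub>R c)" unfolding v_def using norm_triangle_ineq[of "t *\<^sub>R b" "t\<^sup>2 *\<^sub>R c"] by simp
    also have "\<dots> \<le> \<bar>t\<bar> * (K * l) + (\<bar>t\<bar> * \<bar>t\<bar>) * K"
      using b c by (intro add_mono) (auto simp: power2_eq_square abs_mult mult_left_mono)
    also have "\<dots> \<le> \<bar>t\<bar> * (K * l) + (\<bar>t\<bar> * l) * K" using False K by (intro add_left_mono mult_right_mono mult_left_mono) auto
    finally have va: "norm (v - a) \<le> 2 * (\<bar>t\<bar> * (K * l))" by (simp add: mult_ac)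
    have "norm (sgn v - sgn a) \<le> 2 * norm (v - a) / norm a" by (rule norm_sgn_diff_le[OF a0(1)])
    also have "\<dots> \<le> 4 * (\<bar>t\<bar> * (K * l)) / l\<^sup>2"
      using va a l0 K by (intro frac_le) (auto simp: mult_ac)
    also have "\<dots> = 4 * K * \<bar>t\<bar> / l" using l0 by (simp add: power2_eq_square)
    finally have "norm (sgn v - sgn a) * (K * (l + 2 * \<bar>t\<bar>)) \<le> (4 * K * \<bar>t\<bar> / l) * (K * (3 * l))"
      using False K l by (intro mult_mono) auto
    also have "\<dots> = 12 * K\<^sup>2 * \<bar>t\<bar>" using l0 by (simp add: power2_eq_square)
    also have "\<dots> \<le> (6 * K + 12 * K\<^sup>2) * \<bar>t\<bar>" using K by (simp add: distrib_right)
    finally show ?thesis .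
  qed
  finally show ?thesis unfolding v_def w_def by (simp add: algebra_simps)
qed

text \<open>The bivector as an antisymmetric matrix. Each pair of indices occurs twice in the matrix
  norm; the factor 1 / sqrt 2 makes that norm the area of the parallelogram.\<close>

definition wedge :: "real^'n \<Rightarrow> real^'n \<Rightarrow> real^'n^'n" where
  "wedge u w = (\<chi> i j. (u $ i * w $ j - u $ j * w $ i) / sqrt 2)"

lemma wedge_inner: "wedge u w \<bullet> wedge u w = (u \<bullet> u) * (w \<bullet> w) - (u \<bullet> w)\<^sup>2"
proof -
  have "wedge u w \<bullet> wedge u w = (\<Sum>i\<in>UNIV. \<Sum>j\<in>UNIV. (u $ i * u $ i * (w $ j * w $ j) + u $ j * u $ j * (w $ i * w $ i)
      - 2 * (u $ i * w $ i * (u $ j * w $ j))) / 2)"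
    unfolding wedge_def inner_vec_def by (intro sum.cong refl) (simp add: field_simps)
  also have "\<dots> = ((u \<bullet> u) * (w \<bullet> w) + (w \<bullet> w) * (u \<bullet> u) - 2 * ((u \<bullet> w) * (u \<bullet> w))) / 2"
    unfolding inner_vec_def sum_product
    by (simp add: sum.distrib sum_subtractf sum_distrib_left sum_divide_distrib add_divide_distrib diff_divide_distrib mult_ac)
  finally show ?thesis by (simp add: power2_eq_square)
qed

lemma norm_wedge: "norm (wedge u w) = sqrt ((u \<bullet> u) * (w \<bullet> w) - (u \<bullet> w)\<^sup>2)"
  unfolding norm_eq_sqrt_inner wedge_inner ..

lemma norm_wedge_le: "norm (wedge u w) \<le> norm u * norm w"
proof -
  have "norm (wedge u w) \<le> sqrt ((u \<bullet> u) * (w \<bullet> w))" unfolding norm_wedge by (rule real_sqrt_le_mono) simp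
  then show ?thesis by (simp add: real_sqrt_mult norm_eq_sqrt_inner)
qed

lemma wedge_variation:
  "wedge (u + t *\<^sub>R x) (w + t *\<^sub>R y) = wedge u w + t *\<^sub>R (wedge u y + wedge x w) + t\<^sup>2 *\<^sub>R wedge x y"
  unfolding wedge_def by (simp add: vec_eq_iff field_simps power2_eq_square)

lemma continuous_on_wedge:
  "continuous_on S f \<Longrightarrow> continuous_on S g \<Longrightarrow> continuous_on S (\<lambda>z. wedge (f z) (g z))"
  unfolding wedge_def by (intro continuous_intros) auto

section \<open>Zeros of finite order\<close>

lemma Cinf_px_iterate: "Cinf S h \<Longrightarrow> Cinf S ((px ^^ n) h)"
  by (induction n) (auto intro: Cinf_px)

lemma px_iterate_quadratic:
  fixes h0 h1 h2 :: "complex \<Rightarrow> real"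
  assumes S: "open S" and C: "Cinf S h0" "Cinf S h1" "Cinf S h2" and z: "z \<in> S"
  shows "(px ^^ n) (\<lambda>z. h0 z + t * h1 z + t\<^sup>2 * h2 z) z = (px ^^ n) h0 z + t * (px ^^ n) h1 z + t\<^sup>2 * (px ^^ n) h2 z"
  using z
proof (induction n arbitrary: z)
  case (Suc n)
  let ?f = "\<lambda>h. (px ^^ n) h"
  have d: "?f h0 differentiable (at z)" "?f h1 differentiable (at z)" "?f h2 differentiable (at z)"
    using Suc.prems C Cinf_px_iterate Cinf_differentiable by blast+
  have d': "(\<lambda>z. t * ?f h1 z) differentiable (at z)" "(\<lambda>z. t\<^sup>2 * ?f h2 z) differentiable (at z)"
    using d by (auto intro: differentiable_mult)
  have d'': "(\<lambda>z. ?f h0 z + t * ?f h1 z) differentiable (at z)" using d(1) d'(1) by (rule differentiable_add)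
  have "(px ^^ Suc n) (\<lambda>z. h0 z + t * h1 z + t\<^sup>2 * h2 z) z = px (\<lambda>z. ?f h0 z + t * ?f h1 z + t\<^sup>2 * ?f h2 z) z"
    unfolding funpow.simps o_apply by (rule px_cong[OF S Suc.prems Suc.IH])
  also have "\<dots> = px (?f h0) z + t * px (?f h1) z + t\<^sup>2 * px (?f h2) z"
    unfolding px_py_add(1)[OF d'' d'(2)] px_py_add(1)[OF d(1) d'(1)] px_py_cmult(1)[OF d(2)] px_py_cmult(1)[OF d(3)] ..
  finally show ?case by simp
qed simp

text \<open>Take the first iterated x-derivative that does not vanish at the zero. The one before it
  has a zero there that is transversal in the direction 1, so countably many null sets cover
  everything.\<close>

lemma negligible_finite_order_zeros:
  fixes h :: "complex \<Rightarrow> real"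
  assumes S: "open S" and h: "Cinf S h"
  shows "negligible {z \<in> S. h z = 0 \<and> (\<exists>n. (px ^^ n) h z \<noteq> 0)}"
proof -
  let ?Z = "\<lambda>k. {z \<in> S. (px ^^ k) h z = 0 \<and> (px ^^ Suc k) h z \<noteq> 0}"
  have "negligible (?Z k)" for k
  proof -
    have C: "Cinf S ((px ^^ k) h)" by (rule Cinf_px_iterate[OF h])
    have d: "((px ^^ k) h has_derivative (\<lambda>v. Re v *\<^sub>R px ((px ^^ k) h) z + Im v *\<^sub>R py ((px ^^ k) h) z)) (at z)" if "z \<in> S" for z
      by (rule has_derivative_px_py[OF Cinf_differentiable[OF C that]])
    from negligible_transversal_zeros[OF S d, of 1] show ?thesis
      using Cinf_continuous[OF Cinf_px[OF C]] by simp
  qed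
  then have "negligible (\<Union>k. ?Z k)" by (intro negligible_countable_Union) auto
  moreover have "{z \<in> S. h z = 0 \<and> (\<exists>n. (px ^^ n) h z \<noteq> 0)} \<subseteq> (\<Union>k. ?Z k)"
  proof clarify
    fix z n assume z: "z \<in> S" "h z = 0" "(px ^^ n) h z \<noteq> 0"
    define m where "m = (LEAST n. (px ^^ n) h z \<noteq> 0)"
    have m: "(px ^^ m) h z \<noteq> 0" unfolding m_def by (rule LeastI) (rule z(3))
    then obtain k where k: "m = Suc k" using z(2) by (cases m) auto
    then have "(px ^^ k) h z = 0" using not_less_Least[of k "\<lambda>n. (px ^^ n) h z \<noteq> 0"] unfolding m_def by force
    then show "z \<in> (\<Union>k. ?Z k)" using z m k by blast
  qed
  ultimately show ?thesis by (rule negligible_subset)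
qed

text \<open>The zero set itself need not be stable, since h0 may vanish at branch points, but a
  nonzero iterated x-derivative persists on a product neighborhood of (0, z). Compactness of K makes
  the range of t uniform.\<close>

lemma negligible_zeros_of_small_perturbation:
  fixes h0 h1 h2 :: "complex \<Rightarrow> real"
  assumes S: "open S" and C: "Cinf S h0" "Cinf S h1" "Cinf S h2" and K: "compact K" "K \<subseteq> S"
    and order: "\<And>z. z \<in> K \<Longrightarrow> \<exists>n. (px ^^ n) h0 z \<noteq> 0"
  shows "\<exists>e>0. \<forall>t. \<bar>t\<bar> < e \<longrightarrow> negligible {z \<in> K. h0 z + t * h1 z + t\<^sup>2 * h2 z = 0}"
proof -
  define H where "H t z = h0 z + t * h1 z + t\<^sup>2 * h2 z" for t z
  have HC: "Cinf S (H t)" for t unfolding H_def by (intro Cinf_add Cinf_mult Cinf_const S C)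
  have local: "\<exists>e U. e > 0 \<and> open U \<and> z \<in> U \<and> (\<forall>t w. \<bar>t\<bar> < e \<longrightarrow> w \<in> U \<inter> S \<longrightarrow> (\<exists>n. (px ^^ n) (H t) w \<noteq> 0))" if z: "z \<in> K" for z
  proof -
    obtain n where n: "(px ^^ n) h0 z \<noteq> 0" using order[OF z] by blast
    define f where "f p = (px ^^ n) h0 (snd p) + fst p * (px ^^ n) h1 (snd p) + (fst p)\<^sup>2 * (px ^^ n) h2 (snd p)" for p :: "real \<times> complex"
    have c: "continuous_on (UNIV \<times> S) (\<lambda>p. (px ^^ n) h (snd p))" if "Cinf S h" for h :: "complex \<Rightarrow> real"
      by (rule continuous_on_compose2[OF Cinf_continuous[OF Cinf_px_iterate[OF that]]]) (auto intro: continuous_intros)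
    have "continuous_on (UNIV \<times> S) f" unfolding f_def by (intro continuous_intros c C)
    then have "open ((UNIV \<times> S) \<inter> f -` (- {0}))"
      by (rule continuous_open_preimage) (use S in \<open>auto simp: open_Times\<close>)
    moreover have "(0, z) \<in> (UNIV \<times> S) \<inter> f -` (- {0})" using n z K unfolding f_def by auto
    ultimately obtain A U where AU: "open A" "open U" "(0, z) \<in> A \<times> U" "A \<times> U \<subseteq> (UNIV \<times> S) \<inter> f -` (- {0})"
      by (rule open_prod_elim)
    then obtain e where e: "e > 0" "ball 0 e \<subseteq> A" using open_contains_ball[of A] by auto
    have "(px ^^ n) (H t) w \<noteq> 0" if "\<bar>t\<bar> < e" "w \<in> U \<inter> S" for t w
    proof -
      have "t \<in> A" using e that by (auto simp: subset_iff)
      then have "f (t, w) \<noteq> 0" using AU(4) that by auto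
      then show ?thesis unfolding H_def using px_iterate_quadratic[OF S C, of w n t] that by (simp add: f_def)
    qed
    then show ?thesis using e AU by (intro exI[of _ e] exI[of _ U]) auto
  qed
  define Pr where "Pr z p \<longleftrightarrow> fst p > (0::real) \<and> open (snd p) \<and> z \<in> snd p \<and>
    (\<forall>t w. \<bar>t\<bar> < fst p \<longrightarrow> w \<in> snd p \<inter> S \<longrightarrow> (\<exists>n. (px ^^ n) (H t) w \<noteq> 0))" for z p
  have "\<forall>z\<in>K. \<exists>p. Pr z p" unfolding Pr_def split_paired_Ex fst_conv snd_conv using local by blast
  then obtain p where p: "\<forall>z\<in>K. Pr z (p z)" by metis
  have "\<And>z. z \<in> K \<Longrightarrow> open (snd (p z))" "K \<subseteq> (\<Union>z\<in>K. snd (p z))" using p unfolding Pr_def by auto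
  then obtain T where T: "T \<subseteq> K" "finite T" "K \<subseteq> (\<Union>z\<in>T. snd (p z))"
    using compactE_image[OF K(1)] by metis
  define e where "e = Min (insert 1 ((\<lambda>z. fst (p z)) ` T))"
  have e: "e > 0" "\<And>z. z \<in> T \<Longrightarrow> e \<le> fst (p z)" unfolding e_def using T p by (auto simp: Pr_def)
  have "negligible {z \<in> K. H t z = 0}" if t: "\<bar>t\<bar> < e" for t
  proof -
    have "{z \<in> K. H t z = 0} \<subseteq> {z \<in> S. H t z = 0 \<and> (\<exists>n. (px ^^ n) (H t) z \<noteq> 0)}"
    proof clarify
      fix z assume z: "z \<in> K" "H t z = 0"
      then obtain y where y: "y \<in> T" "z \<in> snd (p y)" using T by blast
      have "\<bar>t\<bar> < fst (p y)" using t e(2)[OF y(1)] by linarith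
      moreover have "Pr y (p y)" using p y(1) T(1) by blast
      ultimately have "\<exists>n. (px ^^ n) (H t) z \<noteq> 0" using y(2) z(1) K(2) unfolding Pr_def by blast
      then show "z \<in> S \<and> H t z = 0 \<and> (\<exists>n. (px ^^ n) (H t) z \<noteq> 0)" using z K by blast
    qed
    then show ?thesis using negligible_finite_order_zeros[OF S HC] negligible_subset by blast
  qed
  then show ?thesis using e(1) unfolding H_def by blast
qed

text \<open>If all iterated x-derivatives vanished at z0, Taylor's formula along the real direction
  would give h \<le> M x^(m+1), which contradicts c x^m \<le> h for small x.\<close>

lemma finite_order_of_lower_bound:
  fixes h :: "complex \<Rightarrow> real"
  assumes S: "open S" and h: "Cinf S h" and z0: "z0 \<in> S" and c: "c > 0" and r: "r > 0"
    and low: "\<And>x. 0 < x \<Longrightarrow> x < r \<Longrightarrow> c * x ^ m \<le> h (z0 + of_real x)"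
  shows "\<exists>n. (px ^^ n) h z0 \<noteq> 0"
proof (rule ccontr)
  assume no: "\<nexists>n. (px ^^ n) h z0 \<noteq> 0"
  obtain s where s: "s > 0" "ball z0 s \<subseteq> S" using S z0 openE by blast
  define \<rho> where "\<rho> = min (r / 2) (s / 2)"
  have \<rho>: "0 < \<rho>" "\<rho> < r" "\<rho> < s" using r s unfolding \<rho>_def by auto
  have inS: "z0 + of_real x \<in> S" if "0 \<le> x" "x \<le> \<rho>" for x
  proof -
    have "z0 + of_real x \<in> ball z0 s" using that \<rho> by (simp add: dist_norm)
    then show ?thesis using s by blast
  qed
  define diff where "diff n x = (px ^^ n) h (z0 + of_real x)" for n and x :: real
  have D: "(diff n has_real_derivative diff (Suc n) x) (at x)" if "0 \<le> x" "x \<le> \<rho>" for n x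
  proof -
    have d: "(px ^^ n) h differentiable (at (z0 + of_real x))" by (rule Cinf_differentiable[OF Cinf_px_iterate[OF h] inS[OF that]])
    have "((px ^^ n) h has_derivative (\<lambda>v. Re v *\<^sub>R px ((px ^^ n) h) (z0 + of_real x) + Im v *\<^sub>R py ((px ^^ n) h) (z0 + of_real x))) (at (z0 + x *\<^sub>R 1))"
      using has_derivative_px_py[OF d] by (simp add: scaleR_conv_of_real)
    from directional_DERIV[OF this] show ?thesis unfolding diff_def by (simp add: scaleR_conv_of_real)
  qed
  let ?N = "Suc m"
  have "continuous_on {0..\<rho>} (diff ?N)"
    by (intro continuous_at_imp_continuous_on ballI DERIV_isCont[OF D]) auto
  then have "compact (diff ?N ` {0..\<rho>})" by (rule compact_continuous_image) simp
  then obtain M where M: "\<forall>x\<in>{0..\<rho>}. \<bar>diff ?N x\<bar> \<le> M"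
    using compact_imp_bounded[of "diff ?N ` {0..\<rho>}"] unfolding bounded_iff by auto
  have M0: "0 \<le> M" using M \<rho> by (meson abs_ge_zero atLeastAtMost_iff less_imp_le order_refl order_trans)
  have up: "h (z0 + of_real x) \<le> M * x ^ ?N" if x: "0 < x" "x \<le> \<rho>" for x
  proof -
    have "\<exists>t>0. t < x \<and> diff 0 x = (\<Sum>k<?N. diff k 0 / fact k * x ^ k) + diff ?N t / fact ?N * x ^ ?N"
      by (rule Maclaurin[OF x(1)]) (use D x in auto)
    then obtain t where t: "0 < t" "t < x" "diff 0 x = (\<Sum>k<?N. diff k 0 / fact k * x ^ k) + diff ?N t / fact ?N * x ^ ?N" by blast
    have "diff k 0 = 0" for k unfolding diff_def using no by simp
    then have "h (z0 + of_real x) = diff ?N t / fact ?N * x ^ ?N" using t(3) unfolding diff_def by simp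
    also have "\<dots> \<le> M * x ^ ?N"
    proof (rule mult_right_mono)
      have "diff ?N t \<le> M" using M t x by (auto dest!: bspec[of _ _ t])
      moreover have "M / fact ?N \<le> M / 1" using M0 fact_ge_1[of "Suc m", where 'a = real]
        by (intro divide_left_mono) (auto simp del: fact_Suc)
      ultimately show "diff ?N t / fact ?N \<le> M" using divide_right_mono[of "diff ?N t" M "fact ?N"] by simp
    qed (use x in simp)
    finally show ?thesis .
  qed
  \<comment> \<open>Chosen so that M * x \<le> c / 2; M + 1 guards against M = 0.\<close>
  define x where "x = min \<rho> (c / (M + 1) / 2)"
  have x: "0 < x" "x \<le> \<rho>" "x \<le> c / (M + 1) / 2" unfolding x_def using \<rho> c M0 by auto
  have "c * x ^ m \<le> M * x ^ ?N" using low[of x] up[of x] x \<rho> by linarith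
  then have "c * x ^ m \<le> (M * x) * x ^ m" by (simp add: mult_ac)
  then have "c \<le> M * x" using x(1) by (simp add: mult_le_cancel_right)
  also have "M * x \<le> (M + 1) * (c / (M + 1) / 2)" using x M0 by (intro mult_mono) auto
  also have "\<dots> = c / 2"
  proof -
    have "k * (c / k / 2) = c / 2" if "k \<noteq> 0" for k :: real using that by simp
    moreover have "M + 1 \<noteq> 0" using M0 by linarith
    ultimately show ?thesis by blast
  qed
  finally show False using c by simp
qed

text \<open>Since F is not constant, some coordinate of the holomorphic \<Phi> is not identically 0
  and has at worst a zero of finite order n at z0. Conformality gives |\<Phi>_i|^2 \<le> 2 |F_x|^2,
  so |F_x|^2 is at least a multiple of x^(2n).\<close>

lemma branched_minimal_immersion_finite_order:
  fixes F :: "complex \<Rightarrow> real^'n"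
  assumes F: "branched_minimal_immersion S F" and con: "connected S" and z0: "z0 \<in> S"
  shows "\<exists>n. (px ^^ n) (\<lambda>z. px F z \<bullet> px F z) z0 \<noteq> 0"
proof -
  let ?h = "\<lambda>z. px F z \<bullet> px F z"
  have S: "open S" and FC: "Cinf S F" and nc: "\<exists>z\<in>S. \<exists>w\<in>S. F z \<noteq> F w"
    and conf: "\<And>z. z \<in> S \<Longrightarrow> px F z \<bullet> px F z = py F z \<bullet> py F z"
    using F unfolding branched_minimal_immersion_def by auto
  have hol: "gauss_map F i holomorphic_on S" for i by (rule gauss_map_holomorphic[OF F])
  have hC: "Cinf S ?h" by (intro Cinf_inner Cinf_px S FC)
  have low: "(cmod (gauss_map F i z))\<^sup>2 \<le> 2 * ?h z" if "z \<in> S" for i z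
  proof -
    have "(px F z $ i)\<^sup>2 \<le> px F z \<bullet> px F z" "(py F z $ i)\<^sup>2 \<le> py F z \<bullet> py F z"
      unfolding inner_vec_def power2_eq_square inner_real_def by (rule member_le_sum; simp)+
    then show ?thesis using conf[OF that] unfolding gauss_map_def cmod_power2 by simp
  qed
  have "\<exists>i. \<exists>z\<in>S. gauss_map F i z \<noteq> 0"
  proof (rule ccontr)
    assume "\<not> ?thesis"
    then have "px F z = 0 \<and> py F z = 0" if "z \<in> S" for z
      using that unfolding gauss_map_def by (auto simp: vec_eq_iff complex_eq_iff)
    then have "(F has_derivative (\<lambda>v. 0)) (at z)" if "z \<in> S" for z
      using has_derivative_px_py[OF Cinf_differentiable[OF FC that]] that by simp
    then have "F z = F w" if "z \<in> S" "w \<in> S" for z w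
      using has_derivative_zero_unique_connected[OF S con _ that] by blast
    then show False using nc by blast
  qed
  then obtain i z1 where z1: "z1 \<in> S" "gauss_map F i z1 \<noteq> 0" by blast
  show ?thesis
  proof (cases "gauss_map F i z0 = 0")
    case False
    then have "0 < (cmod (gauss_map F i z0))\<^sup>2" by simp
    then have "?h z0 \<noteq> 0" using low[OF z0, of i] by linarith
    then show ?thesis by (intro exI[of _ 0]) simp
  next
    case True
    have "\<not> gauss_map F i constant_on S" using True z1 z0 unfolding constant_on_def by metis
    from holomorphic_factor_zero_nonconstant[OF hol S con z0 True this]
    obtain g r n where g: "0 < n" "0 < r" "ball z0 r \<subseteq> S" "g holomorphic_on ball z0 r"
        "\<And>w. w \<in> ball z0 r \<Longrightarrow> gauss_map F i w = (w - z0) ^ n * g w" "\<And>w. w \<in> ball z0 r \<Longrightarrow> g w \<noteq> 0"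
      by metis
    have cg: "continuous_on (cball z0 (r / 2)) g"
      using continuous_on_subset[OF holomorphic_on_imp_continuous_on[OF g(4)]] g(2) by (simp add: subset_iff)
    have "continuous_on (cball z0 (r / 2)) (\<lambda>z. cmod (g z))" by (intro continuous_intros cg)
    then obtain x0 where x0: "x0 \<in> cball z0 (r / 2)" "\<And>y. y \<in> cball z0 (r / 2) \<Longrightarrow> cmod (g x0) \<le> cmod (g y)"
      using continuous_attains_inf[of "cball z0 (r / 2)" "\<lambda>z. cmod (g z)"] g(2) by auto
    have g0: "cmod (g x0) > 0" using g(6)[of x0] x0(1) g(2) by simp
    show ?thesis
    proof (rule finite_order_of_lower_bound[OF S hC z0, of "(cmod (g x0))\<^sup>2 / 2" "r / 2" "2 * n"])
      fix x :: real assume x: "0 < x" "x < r / 2"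
      let ?z = "z0 + of_real x"
      have zb: "?z \<in> ball z0 r" "?z \<in> cball z0 (r / 2)" using x by (auto simp: dist_norm)
      have "cmod (gauss_map F i ?z) = x ^ n * cmod (g ?z)" using g(5)[OF zb(1)] x by (simp add: norm_mult norm_power)
      then have "x ^ n * cmod (g x0) \<le> cmod (gauss_map F i ?z)" using x0(2)[OF zb(2)] x by (simp add: mult_left_mono)
      then have "(x ^ n * cmod (g x0))\<^sup>2 \<le> (cmod (gauss_map F i ?z))\<^sup>2" using x by (intro power_mono) auto
      also have "\<dots> \<le> 2 * ?h ?z" using low zb(1) g(3) by blast
      finally show "(cmod (g x0))\<^sup>2 / 2 * x ^ (2 * n) \<le> ?h ?z"
        by (simp add: power_mult_distrib power_mult[symmetric] mult.commute)
    qed (use g0 g(2) in auto)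
  qed
qed

section \<open>The Kaehler form as a calibration\<close>

lemma py_px_eq_px_py_vec:
  fixes F :: "complex \<Rightarrow> real^'n"
  assumes S: "open S" and F: "Cinf S F" and z: "z \<in> S"
  shows "py (px F) z = px (py F) z"
proof -
  have i: "px F w $ i = px (\<lambda>z. F z $ i) w" "py F w $ i = py (\<lambda>z. F z $ i) w" if "w \<in> S" for w i
    using px_py_nth[OF Cinf_differentiable[OF F that], of i] by auto
  have "py (px F) z $ i = px (py F) z $ i" for i
  proof -
    have "py (px F) z $ i = py (\<lambda>w. px F w $ i) z"
      using px_py_nth(2)[OF Cinf_differentiable[OF Cinf_px[OF F] z], of i] by simp
    also have "\<dots> = py (px (\<lambda>z. F z $ i)) z" by (rule py_cong[OF S z]) (rule i(1))
    also have "\<dots> = px (py (\<lambda>z. F z $ i)) z" by (rule py_px_eq_px_py[OF S Cinf_nth[OF S F] z])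
    also have "\<dots> = px (\<lambda>w. py F w $ i) z" by (rule px_cong[OF S z]) (rule i(2)[symmetric])
    also have "\<dots> = px (py F) z $ i"
      using px_py_nth(1)[OF Cinf_differentiable[OF Cinf_py[OF F] z], of i] by simp
    finally show ?thesis .
  qed
  then show ?thesis by (simp add: vec_eq_iff)
qed

text \<open>J is an isometry only on V, whereas variations take values in the whole space. J after
  the orthogonal projection onto V is a skew contraction everywhere.\<close>

lemma calibration_exists:
  fixes V :: "(real^'n) set"
  assumes V: "subspace V" and J: "linear J" "\<And>w. w \<in> V \<Longrightarrow> J w \<in> V \<and> J (J w) = - w"
    "\<And>u w. u \<in> V \<Longrightarrow> w \<in> V \<Longrightarrow> J u \<bullet> J w = u \<bullet> w"
  shows "\<exists>K. linear K \<and> (\<forall>u. K u \<bullet> u = 0) \<and> (\<forall>u. norm (K u) \<le> norm u) \<and> (\<forall>u\<in>V. K u = J u)"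
proof -
  obtain B where B: "B \<subseteq> V" "pairwise orthogonal B" "\<And>x. x \<in> B \<Longrightarrow> norm x = 1" "independent B" "span B = V"
    using orthonormal_basis_subspace[OF V] by metis
  have fB: "finite B" using B(4) by (rule independent_imp_finite)
  define \<pi> where "\<pi> u = (\<Sum>b\<in>B. (u \<bullet> b) *\<^sub>R b)" for u
  have \<pi>lin: "linear \<pi>" unfolding \<pi>_def
    by (intro linearI) (auto simp: inner_add_left scaleR_add_left sum.distrib scaleR_sum_right)
  have \<pi>V: "\<pi> u \<in> V" for u unfolding \<pi>_def using B(1) by (intro subspace_sum V subspace_scale) auto
  have \<pi>id: "\<pi> u = u" if "u \<in> V" for u
    unfolding \<pi>_def using orthonormal_basis_expand[OF B(2,3) _ fB, of u] B(5) that by simp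
  have orth: "(u - \<pi> u) \<bullet> w = 0" if "w \<in> V" for u w
  proof -
    have b: "(u - \<pi> u) \<bullet> b = 0" if b: "b \<in> B" for b
    proof -
      have "\<pi> u \<bullet> b = (\<Sum>c\<in>B. (u \<bullet> c) * (c \<bullet> b))" unfolding \<pi>_def by (simp add: inner_sum_left)
      also have "\<dots> = (\<Sum>c\<in>B. if c = b then u \<bullet> b else 0)"
      proof (rule sum.cong[OF refl])
        fix c assume c: "c \<in> B"
        have "b \<bullet> b = 1" using B(3)[OF b] by (simp add: norm_eq_1)
        moreover have "c \<noteq> b \<Longrightarrow> c \<bullet> b = 0" using B(2) b c unfolding pairwise_def orthogonal_def by blast
        ultimately show "(u \<bullet> c) * (c \<bullet> b) = (if c = b then u \<bullet> b else 0)" by auto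
      qed
      also have "\<dots> = u \<bullet> b" using b fB by simp
      finally show ?thesis by (simp add: inner_diff_left)
    qed
    have "subspace {w. (u - \<pi> u) \<bullet> w = 0}" by (rule subspace_hyperplane)
    then have "span B \<subseteq> {w. (u - \<pi> u) \<bullet> w = 0}" using b by (intro span_minimal) auto
    then show ?thesis using that B(5) by blast
  qed
  define K where "K u = J (\<pi> u)" for u
  have "linear K" unfolding K_def using linear_compose[OF \<pi>lin J(1)] by (simp add: o_def)
  moreover have "K u \<bullet> u = 0" for u
  proof -
    have KV: "K u \<in> V" unfolding K_def using J(2) \<pi>V by blast
    have "K u \<bullet> u = K u \<bullet> \<pi> u" using orth[OF KV, of u] by (simp add: inner_diff_left inner_diff_right inner_commute)
    also have "\<dots> = J (K u) \<bullet> J (\<pi> u)" using J(3)[OF KV \<pi>V] by simp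
    also have "\<dots> = - (K u \<bullet> \<pi> u)" using J(2)[OF \<pi>V] unfolding K_def by (simp add: inner_commute)
    finally show ?thesis using orth[OF KV, of u] by (simp add: inner_diff_left inner_diff_right inner_commute)
  qed
  moreover have "norm (K u) \<le> norm u" for u
  proof -
    have "K u \<bullet> K u = \<pi> u \<bullet> \<pi> u" unfolding K_def by (rule J(3)) (rule \<pi>V)+
    moreover have "u \<bullet> u = \<pi> u \<bullet> \<pi> u + (u - \<pi> u) \<bullet> (u - \<pi> u)"
      using orth[OF \<pi>V, of u u] by (simp add: inner_diff_left inner_diff_right inner_commute)
    ultimately have "K u \<bullet> K u \<le> u \<bullet> u" using inner_ge_zero[of "u - \<pi> u"] by linarith
    then show ?thesis by (simp add: norm_eq_sqrt_inner)
  qed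
  moreover have "K u = J u" if "u \<in> V" for u unfolding K_def \<pi>id[OF that] ..
  ultimately show ?thesis by blast
qed

lemma calibration_antisym:
  fixes K :: "'a::real_inner \<Rightarrow> 'a"
  assumes "linear K" "\<And>u. K u \<bullet> u = 0"
  shows "K u \<bullet> v = - (K v \<bullet> u)"
  using assms(2)[of "u + v"] assms(2)[of u] assms(2)[of v] linear_add[OF assms(1), of u v]
  by (simp add: inner_add_left inner_add_right)

text \<open>Wirtinger's inequality for one plane. As K u is orthogonal to u, v may be replaced by
  its component orthogonal to u, and the area is the product of that component's length with the
  length of u.\<close>

lemma calibration_le_area:
  fixes u v :: "real^'n"
  assumes K: "\<And>u. K u \<bullet> u = 0" "\<And>u. norm (K u) \<le> norm u"
  shows "\<bar>K u \<bullet> v\<bar> \<le> norm (wedge u v)"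
proof (cases "u = 0")
  case True
  then have "K u = 0" using K(2)[of u] by simp
  then show ?thesis by simp
next
  case False
  define w where "w = v - ((u \<bullet> v) / (u \<bullet> u)) *\<^sub>R u"
  have u0: "u \<bullet> u \<noteq> 0" "0 < u \<bullet> u" using False by auto
  have w: "w \<bullet> w = v \<bullet> v - (u \<bullet> v)\<^sup>2 / (u \<bullet> u)"
    unfolding w_def using u0 by (simp add: inner_diff_left inner_diff_right inner_commute power2_eq_square field_simps)
  have "K u \<bullet> v = K u \<bullet> w" unfolding w_def using K(1)[of u] by (simp add: inner_diff_right)
  then have "(K u \<bullet> v)\<^sup>2 \<le> (K u \<bullet> K u) * (w \<bullet> w)" using Cauchy_Schwarz_ineq[of "K u" w] by simp
  also have "\<dots> \<le> (u \<bullet> u) * (w \<bullet> w)"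
    using K(2)[of u] by (intro mult_right_mono) (auto simp: norm_eq_sqrt_inner)
  also have "\<dots> = (u \<bullet> u) * (v \<bullet> v) - (u \<bullet> v)\<^sup>2" unfolding w using u0 by (simp add: field_simps)
  finally have "\<bar>K u \<bullet> v\<bar> \<le> sqrt ((u \<bullet> u) * (v \<bullet> v) - (u \<bullet> v)\<^sup>2)" by (rule real_le_rsqrt[of "\<bar>K u \<bullet> v\<bar>", simplified])
  then show ?thesis unfolding norm_wedge .
qed

text \<open>The form (u, v) to K u . v has constant coefficients and is closed: skewness of K and
  equality of mixed derivatives make the integrand a divergence of products with K W, which vanish
  on the frontier. G = F and G = W give the first and second order terms of the calibration
  integral.\<close>

lemma integral_null_lagrangian:
  fixes W G :: "complex \<Rightarrow> real^'n"
  assumes K: "linear K" "\<And>u. K u \<bullet> u = 0" and S: "open S" and C: "Cinf S W" "Cinf S G"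
    and \<Omega>: "compact \<Omega>" "\<Omega> \<subseteq> S" and W0: "\<And>z. z \<in> frontier \<Omega> \<Longrightarrow> W z = 0"
  shows "integral \<Omega> (\<lambda>z. K (px W z) \<bullet> py G z + K (px G z) \<bullet> py W z) = 0"
proof -
  have Kb: "bounded_linear K" using K(1) by (rule linear_conv_bounded_linear[THEN iffD1])
  have KC: "Cinf S (\<lambda>z. K (W z))" by (rule Cinf_linear[OF S Kb C(1)])
  let ?A = "\<lambda>z. K (W z) \<bullet> py G z" and ?B = "\<lambda>z. K (W z) \<bullet> px G z"
  have AC: "Cinf S ?A" and BC: "Cinf S ?B" by (intro Cinf_inner S KC Cinf_px Cinf_py C)+
  have eq: "K (px W z) \<bullet> py G z + K (px G z) \<bullet> py W z = px ?A z - py ?B z" if z: "z \<in> \<Omega>" for z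
  proof -
    have zS: "z \<in> S" using z \<Omega> by blast
    note d = Cinf_differentiable[OF KC zS] Cinf_differentiable[OF Cinf_px[OF C(2)] zS] Cinf_differentiable[OF Cinf_py[OF C(2)] zS]
    have k: "px (\<lambda>z. K (W z)) z = K (px W z)" "py (\<lambda>z. K (W z)) z = K (py W z)"
      by (rule px_py_linear[OF Kb Cinf_differentiable[OF C(1) zS]])+
    show ?thesis
      unfolding px_py_inner(1)[OF d(1,3)] px_py_inner(2)[OF d(1,2)] k py_px_eq_px_py_vec[OF S C(2) zS]
      using calibration_antisym[OF K, of "py W z" "px G z"] by simp
  qed
  have i: "px ?A integrable_on \<Omega>" "py ?B integrable_on \<Omega>"
    by (rule compact_integrable[OF \<Omega>(1) continuous_on_subset[OF _ \<Omega>(2)]]; intro Cinf_continuous Cinf_px Cinf_py AC BC)+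
  have z: "?A z = 0" "?B z = 0" if "z \<in> frontier \<Omega>" for z using W0[OF that] linear_0[OF K(1)] by auto
  have "integral \<Omega> (\<lambda>z. K (px W z) \<bullet> py G z + K (px G z) \<bullet> py W z) = integral \<Omega> (\<lambda>z. px ?A z - py ?B z)"
    by (rule integral_cong) (rule eq)
  also have "\<dots> = integral \<Omega> (px ?A) - integral \<Omega> (py ?B)" by (rule integral_diff[OF i])
  also have "\<dots> = 0" using integral_px_py_eq_0(1)[OF S AC \<Omega> z(1)] integral_px_py_eq_0(2)[OF S BC \<Omega> z(2)] by simp
  finally show ?thesis .
qed

text \<open>F stays in b + V, so F_x is tangent to V. There K agrees with J, and J F_x = F_y is the
  holomorphy condition in the direction 1.\<close>

lemma holomorphic_imp_calibrated:
  fixes F :: "complex \<Rightarrow> real^'n"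
  assumes S: "open S" and F: "Cinf S F" and hol: "holomorphic_up_to_rigid_motion S F"
  shows "\<exists>K. linear K \<and> (\<forall>u. K u \<bullet> u = 0) \<and> (\<forall>u. norm (K u) \<le> norm u) \<and> (\<forall>z\<in>S. K (px F z) = py F z)"
proof -
  obtain b V and J :: "real^'n \<Rightarrow> real^'n" where V: "subspace V" and FV: "\<And>z. z \<in> S \<Longrightarrow> F z - b \<in> V" and J: "linear J"
    "\<And>w. w \<in> V \<Longrightarrow> J w \<in> V \<and> J (J w) = - w" "\<And>u w. u \<in> V \<Longrightarrow> w \<in> V \<Longrightarrow> J u \<bullet> J w = u \<bullet> w"
    and cr: "\<And>z v. z \<in> S \<Longrightarrow> frechet_derivative F (at z) (\<i> * v) = J (frechet_derivative F (at z) v)"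
    using hol unfolding holomorphic_up_to_rigid_motion_def by blast
  have pV: "px F z \<in> V" if z: "z \<in> S" for z
  proof -
    obtain y n where yn: "y \<in> span V" "\<And>w. w \<in> span V \<Longrightarrow> orthogonal n w" "px F z = y + n"
      using orthogonal_subspace_decomp_exists[of V "px F z"] by metis
    have Fn: "F w \<bullet> n = b \<bullet> n" if "w \<in> S" for w
      using yn(2)[OF span_base[OF FV[OF that]]] unfolding orthogonal_def by (simp add: inner_diff_right inner_commute)
    have "px F z \<bullet> n = px (\<lambda>w. F w \<bullet> n) z"
      using px_py_linear(1)[OF bounded_linear_inner_left Cinf_differentiable[OF F z], of n] by simp
    also have "\<dots> = px (\<lambda>w. b \<bullet> n) z" by (rule px_cong[OF S z]) (rule Fn)
    also have "\<dots> = 0" by (simp add: px_def)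
    finally have "(y + n) \<bullet> n = 0" unfolding yn(3) .
    moreover have "y \<bullet> n = 0" using yn(2)[OF yn(1)] unfolding orthogonal_def by (simp add: inner_commute)
    ultimately have "n = 0" by (simp add: inner_add_left)
    then show ?thesis using yn V by (simp add: span_eq_iff[THEN iffD2])
  qed
  obtain K where K: "linear K" "\<forall>u. K u \<bullet> u = 0" "\<forall>u. norm (K u) \<le> norm u" "\<forall>u\<in>V. K u = J u"
    using calibration_exists[OF V J] by blast
  have "K (px F z) = py F z" if "z \<in> S" for z
    using K(4) pV[OF that] cr[OF that, of 1] unfolding px_def py_def by simp
  then show ?thesis using K by blast
qed

proposition holomorphic_imp_stable:
  fixes F :: "complex \<Rightarrow> real^'n"
  assumes F: "branched_minimal_immersion S F" and con: "connected S" and hol: "holomorphic_up_to_rigid_motion S F"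
  shows "stable_on S F"
  unfolding stable_on_def
proof (intro allI impI, elim conjE)
  fix \<Omega> and W :: "complex \<Rightarrow> real^'n"
  assume \<Omega>: "compact_smooth_domain S \<Omega>" and WC: "Cinf S W" and "\<forall>z\<in>frontier \<Omega>. W z = 0"
  then have W0: "\<And>z. z \<in> frontier \<Omega> \<Longrightarrow> W z = 0" by blast
  have S: "open S" and FC: "Cinf S F" and conf: "\<And>z. z \<in> S \<Longrightarrow> px F z \<bullet> px F z = py F z \<bullet> py F z"
      "\<And>z. z \<in> S \<Longrightarrow> px F z \<bullet> py F z = 0"
    using F unfolding branched_minimal_immersion_def by auto
  have cO: "compact \<Omega>" and OS: "\<Omega> \<subseteq> S" using \<Omega> unfolding compact_smooth_domain_def by auto
  obtain K where K: "linear K" "\<And>u. K u \<bullet> u = 0" "\<And>u. norm (K u) \<le> norm u" "\<And>z. z \<in> S \<Longrightarrow> K (px F z) = py F z"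
    using holomorphic_imp_calibrated[OF S FC hol] by blast
  have Kb: "bounded_linear K" using K(1) by (rule linear_conv_bounded_linear[THEN iffD1])
  \<comment> \<open>h0, h1, h2 are the coefficients in t of the Kaehler form on F_x + t W_x and F_y
    + t W_y; h0 is simplified by K F_x = F_y and conformality.\<close>
  define h0 where "h0 z = px F z \<bullet> px F z" for z
  define h1 where "h1 z = K (px W z) \<bullet> py F z + K (px F z) \<bullet> py W z" for z
  define h2 where "h2 z = K (px W z) \<bullet> py W z" for z
  have hC: "Cinf S h0" "Cinf S h1" "Cinf S h2" unfolding h0_def h1_def h2_def
    by (intro Cinf_add Cinf_inner Cinf_linear[OF S Kb] Cinf_px Cinf_py S FC WC)+
  define a b c where "a z = wedge (px F z) (py F z)" and "b z = wedge (px F z) (py W z) + wedge (px W z) (py F z)"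
    and "c z = wedge (px W z) (py W z)" for z
  define v where "v t z = a z + t *\<^sub>R b z + t\<^sup>2 *\<^sub>R c z" for t z
  have v: "v t z = wedge (px F z + t *\<^sub>R px W z) (py F z + t *\<^sub>R py W z)" for t z
    unfolding v_def a_def b_def c_def wedge_variation ..
  have dens: "area_density (\<lambda>z. F z + t *\<^sub>R W z) z = norm (v t z)" if "z \<in> \<Omega>" for t z
    unfolding v norm_wedge by (rule area_density_variation[OF FC WC]) (use that OS in blast)
  \<comment> \<open>This serves twice: it makes the area at least the integral of the form, and it
    shows that v t z is nonzero wherever the form is.\<close>
  have cal: "\<bar>h0 z + t * h1 z + t\<^sup>2 * h2 z\<bar> \<le> norm (v t z)" if z: "z \<in> \<Omega>" for t z
  proof -
    have zS: "z \<in> S" using z OS by blast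
    have "K (px F z + t *\<^sub>R px W z) \<bullet> (py F z + t *\<^sub>R py W z) = h0 z + t * h1 z + t\<^sup>2 * h2 z"
      using conf(1)[OF zS] K(4)[OF zS] unfolding h0_def h1_def h2_def
      by (simp add: linear_add[OF K(1)] linear_scale[OF K(1)] inner_add_left inner_add_right power2_eq_square algebra_simps)
    then show ?thesis unfolding v using calibration_le_area[of K, OF K(2,3), of "px F z + t *\<^sub>R px W z" "py F z + t *\<^sub>R py W z"] by simp
  qed
  have na: "norm (a z) = (norm (px F z))\<^sup>2" if "z \<in> \<Omega>" for z
  proof -
    have "norm (a z) = sqrt ((px F z \<bullet> px F z) * (px F z \<bullet> px F z))"
      unfolding a_def norm_wedge using conf that OS by auto
    then show ?thesis by (simp add: real_sqrt_mult_self power2_norm_eq_inner)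
  qed
  have cont: "continuous_on \<Omega> (px F)" "continuous_on \<Omega> (py F)" "continuous_on \<Omega> (px W)" "continuous_on \<Omega> (py W)"
    by (rule continuous_on_subset[OF _ OS]; intro Cinf_continuous Cinf_px Cinf_py FC WC)+
  have bounded: "\<exists>B\<ge>0. \<forall>z\<in>\<Omega>. norm (f z) \<le> B" if "continuous_on \<Omega> f" for f :: "complex \<Rightarrow> real^'n"
  proof -
    have "bounded (f ` \<Omega>)" by (intro compact_imp_bounded compact_continuous_image that cO)
    then obtain B where B: "\<forall>z\<in>\<Omega>. norm (f z) \<le> B" unfolding bounded_iff by auto
    then show ?thesis by (intro exI[of _ "max B 0"]) auto
  qed
  obtain B1 B2 B3 where B: "0 \<le> B1" "0 \<le> B2" "0 \<le> B3" "\<And>z. z \<in> \<Omega> \<Longrightarrow> norm (px W z) \<le> B1"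
     "\<And>z. z \<in> \<Omega> \<Longrightarrow> norm (py W z) \<le> B2" "\<And>z. z \<in> \<Omega> \<Longrightarrow> norm (px F z) \<le> B3"
    using bounded[OF cont(3)] bounded[OF cont(4)] bounded[OF cont(1)] by metis
  \<comment> \<open>One constant bounds both |c| and |b| / |F_x|. The second ratio stays bounded at
    the branch points because every term of b contains a first derivative of F.\<close>
  define M where "M = B1 + B2 + B1 * B2"
  have M0: "0 \<le> M" unfolding M_def using B by simp
  have cb: "norm (c z) \<le> M" if "z \<in> \<Omega>" for z
  proof -
    have "norm (c z) \<le> norm (px W z) * norm (py W z)" unfolding c_def by (rule norm_wedge_le)
    also have "\<dots> \<le> B1 * B2" using B that by (intro mult_mono) auto
    finally show ?thesis unfolding M_def using B by simp
  qed
  have bb: "norm (b z) \<le> M * norm (px F z)" if z: "z \<in> \<Omega>" for z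
  proof -
    have "norm (py F z) = norm (px F z)" using conf(1)[of z] z OS by (auto simp: norm_eq_sqrt_inner)
    then have "norm (b z) \<le> norm (px F z) * norm (py W z) + norm (px W z) * norm (px F z)"
      unfolding b_def using norm_triangle_ineq[of "wedge (px F z) (py W z)" "wedge (px W z) (py F z)"]
        norm_wedge_le[of "px F z" "py W z"] norm_wedge_le[of "px W z" "py F z"] by simp
    also have "\<dots> \<le> norm (px F z) * B2 + B1 * norm (px F z)"
      using B z by (intro add_mono mult_left_mono mult_right_mono) auto
    also have "\<dots> = (B1 + B2) * norm (px F z)" by (simp add: algebra_simps)
    also have "\<dots> \<le> M * norm (px F z)" unfolding M_def using B by (intro mult_right_mono) auto
    finally show ?thesis .
  qed
  have bB: "norm (b z) \<le> M * B3" if "z \<in> \<Omega>" for z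
    using bb[OF that] mult_left_mono[OF B(6)[OF that] M0] by linarith
  have vc: "continuous_on \<Omega> (v t)" for t
    unfolding v by (intro continuous_on_wedge continuous_intros cont)
  have si: "(\<lambda>z. norm (v t z)) integrable_on \<Omega>" for t
    by (rule compact_integrable[OF cO]) (intro continuous_intros vc)
  have ord: "\<exists>n. (px ^^ n) h0 z \<noteq> 0" if "z \<in> \<Omega>" for z
    unfolding h0_def by (rule branched_minimal_immersion_finite_order[OF F con]) (use that OS in blast)
  obtain e0 where e0: "e0 > 0" "\<And>t. \<bar>t\<bar> < e0 \<Longrightarrow> negligible {z \<in> \<Omega>. h0 z + t * h1 z + t\<^sup>2 * h2 z = 0}"
    using negligible_zeros_of_small_perturbation[OF S hC cO OS ord] by blast
  define N where "N t = {z \<in> \<Omega>. h0 z + t * h1 z + t\<^sup>2 * h2 z = 0}" for t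
  have v0: "v t z \<noteq> 0" if "z \<in> \<Omega>" "z \<notin> N t" for t z
    using cal[OF that(1), of t] that unfolding N_def by auto
  define e where "e = min e0 1"
  have e: "0 < e" "e \<le> 1" "e \<le> e0" unfolding e_def using e0 by auto
  have Nn: "negligible (N t)" if "\<bar>t\<bar> < e" for t unfolding N_def using that e by (intro e0(2)) auto
  define g where "g t z = sgn (v t z) \<bullet> (b z + (2 * t) *\<^sub>R c z)" for t z
  have first: "g t integrable_on \<Omega> \<and> ((\<lambda>t. integral \<Omega> (\<lambda>z. norm (v t z))) has_real_derivative integral \<Omega> (g t)) (at t)"
    if t: "\<bar>t\<bar> < e" for t
  proof -
    \<comment> \<open>Within this distance of t the parameter s stays below e \<le> 1 in absolute
      value, as the Lipschitz bound requires.\<close>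
    have e': "0 < e - \<bar>t\<bar>" using t by simp
    have i: "(\<lambda>z. norm (v s z)) integrable_on \<Omega>" if "\<bar>s - t\<bar> < e - \<bar>t\<bar>" for s by (rule si)
    have l: "\<bar>norm (v s z) - norm (v t z)\<bar> \<le> (M * B3 + 2 * M) * \<bar>s - t\<bar>" if "z \<in> \<Omega>" "\<bar>s - t\<bar> < e - \<bar>t\<bar>" for s z
      unfolding v_def by (rule norm_quadratic_path_lipschitz[OF bB[OF that(1)] cb[OF that(1)]]) (use that e t in auto)
    have d: "((\<lambda>s. norm (v s z)) has_real_derivative g t z) (at t)" if "z \<in> \<Omega>" "z \<notin> N t" for z
      using norm_quadratic_path(1)[of "a z" t "b z" "c z"] v0[OF that] unfolding g_def v_def by blast
    show ?thesis
      using integral_has_real_derivative[of \<Omega> "e - \<bar>t\<bar>" t "\<lambda>s z. norm (v s z)", OF cO e' i l Nn[OF t] d] by blast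
  qed
  have "\<exists>D. ((\<lambda>t. g t z) has_real_derivative D) (at 0)" if "z \<in> \<Omega>" "z \<notin> N 0" for z
  proof -
    have "a z \<noteq> 0" using v0[OF that] unfolding v_def by simp
    then show ?thesis unfolding g_def v_def by (rule norm_quadratic_path(2))
  qed
  then obtain D where D: "\<And>z. z \<in> \<Omega> \<Longrightarrow> z \<notin> N 0 \<Longrightarrow> ((\<lambda>t. g t z) has_real_derivative D z) (at 0)" by metis
  have second: "((\<lambda>t. integral \<Omega> (g t)) has_real_derivative integral \<Omega> D) (at 0)"
  proof (rule integral_has_real_derivative(2)[OF cO e(1), where N = "N 0"])
    show "g t integrable_on \<Omega>" if "\<bar>t - 0\<bar> < e" for t using first[of t] that by simp
    \<comment> \<open>Here l is |F_x|: by \<open>na\<close> the norm of a z is its square, and by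
      \<open>bb\<close> the norm of b z is at most M times it.\<close>
    show "\<bar>g t z - g 0 z\<bar> \<le> (8 * M + 12 * M\<^sup>2) * \<bar>t - 0\<bar>" if "z \<in> \<Omega>" for t z
      using norm_quadratic_path_derivative_bound[of "b z" M "norm (px F z)" "c z" "a z" t] bb[OF that] cb[OF that] na[OF that]
      unfolding g_def v_def by simp
    show "negligible (N 0)" using Nn[of 0] e by simp
  qed (rule D)
  define A where "A t = area_on \<Omega> (\<lambda>z. F z + t *\<^sub>R W z)" for t
  have A: "A t = integral \<Omega> (\<lambda>z. norm (v t z))" for t
    unfolding A_def area_on_def by (rule integral_cong) (rule dens)
  have twice: "has_second_deriv_at A (integral \<Omega> D) 0"
    unfolding has_second_deriv_at_def A using first second e(1)
    by (intro exI[of _ "\<lambda>t. integral \<Omega> (g t)"] exI[of _ e]) auto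
  have hi: "h0 integrable_on \<Omega>" "h1 integrable_on \<Omega>" "h2 integrable_on \<Omega>"
    by (rule compact_integrable[OF cO continuous_on_subset[OF _ OS]]; intro Cinf_continuous hC)+
  have I1: "integral \<Omega> h1 = 0" unfolding h1_def
    by (rule integral_null_lagrangian[OF K(1,2) S WC FC cO OS W0])
  have I2: "integral \<Omega> h2 = 0"
  proof -
    have "integral \<Omega> (\<lambda>z. 2 * h2 z) = 0"
      using integral_null_lagrangian[OF K(1,2) S WC WC cO OS W0] unfolding h2_def by simp
    then show ?thesis by simp
  qed
  \<comment> \<open>The integrals of h1 and h2 vanish, so the calibration integral does not depend
    on t. It equals the area at t = 0 and is at most the area at every t.\<close>
  have min: "integral \<Omega> h0 \<le> A t" for t
  proof -
    have i: "(\<lambda>z. t * h1 z) integrable_on \<Omega>" "(\<lambda>z. t\<^sup>2 * h2 z) integrable_on \<Omega>"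
      by (intro integrable_on_mult_right hi)+
    have "integral \<Omega> h0 = integral \<Omega> (\<lambda>z. h0 z + t * h1 z + t\<^sup>2 * h2 z)"
      using I1 I2 by (simp add: integral_add integrable_add hi i)
    also have "\<dots> \<le> A t" unfolding A
      by (intro integral_le integrable_add hi i si) (rule order_trans[OF abs_ge_self cal])
    finally show ?thesis .
  qed
  have A0: "A 0 = integral \<Omega> h0"
    unfolding A by (rule integral_cong) (use na in \<open>simp add: v_def h0_def power2_norm_eq_inner\<close>)
  have "0 \<le> integral \<Omega> D"
  proof (rule tendsto_lowerbound[OF second_deriv_symmetric_quotient[OF twice]])
    show "\<forall>\<^sub>F t in at 0. 0 \<le> (A t + A (- t) - 2 * A 0) / t\<^sup>2"
    proof (intro always_eventually allI divide_nonneg_nonneg)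
      show "0 \<le> A t + A (- t) - 2 * A 0" for t using min[of t] min[of "- t"] A0 by linarith
    qed simp
  qed simp
  then show "\<exists>a2. has_second_deriv_at (\<lambda>t. area_on \<Omega> (\<lambda>z. F z + t *\<^sub>R W z)) a2 0 \<and> 0 \<le> a2"
    using twice unfolding A_def by blast
qed

theorem theorem1p2:
  fixes P :: "complex set" and F :: "complex \<Rightarrow> real^'n"
  assumes "P sparse_in UNIV"
    and "branched_minimal_immersion (- P) F"
    and "locally_complete_ftc (- P) F P"
  shows "stable_on (- P) F \<longleftrightarrow> holomorphic_up_to_rigid_motion (- P) F"
proof
  have con: "connected (- P)"
    using sparse_imp_connected[OF _ connected_UNIV open_UNIV assms(1)] by (simp add: Compl_eq_Diff_UNIV)
  show "stable_on (- P) F" if "holomorphic_up_to_rigid_motion (- P) F"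
    by (rule holomorphic_imp_stable[OF assms(2) con that])
  show "holomorphic_up_to_rigid_motion (- P) F" if stable: "stable_on (- P) F"
  proof (rule isotropic_imp_holomorphic[OF _ con])
    have FC: "Cinf (- P) F" using assms(2) unfolding branched_minimal_immersion_def by blast
    show "open (- P)" "- P \<noteq> {}" using assms(2) unfolding branched_minimal_immersion_def by blast+
    show "F differentiable (at z)" if "z \<in> - P" for z by (rule Cinf_differentiable[OF FC that])
    show "px F p \<bullet> px F q = py F p \<bullet> py F q \<and> px F p \<bullet> py F q = - (py F p \<bullet> px F q)"
      if "p \<in> - P" "q \<in> - P" for p q
    proof (cases "p = q")
      case True
      then show ?thesis using assms(2) that unfolding branched_minimal_immersion_def by (auto simp: inner_commute)
    next
      case False
      have "(\<Sum>i\<in>UNIV. gauss_map F i p * gauss_map F i q) = 0"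
        by (rule stable_imp_isotropic[OF assms(1,2) stable that False])
      \<comment> \<open>The real part of the pairing gives the equality of the products F_x . F_x
        and F_y . F_y at p and q, the imaginary part the skew relation between the mixed
        products.\<close>
      then have "Re (\<Sum>i\<in>UNIV. gauss_map F i p * gauss_map F i q) = 0" "Im (\<Sum>i\<in>UNIV. gauss_map F i p * gauss_map F i q) = 0"
        by simp_all
      then show ?thesis unfolding gauss_map_def inner_vec_def by (simp add: sum_subtractf sum_negf sum.distrib)
    qed
  qed
qed

end
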